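(* Let $\{g_j\}_{j\in I_{xy}}\subset\mathbb{R}[X,Y]$ and $\{h_k\}_{k\in I_{yz}}\subset\mathbb{R}[Y,Z]$ be finite families of polynomials, where $X=(X_1,\ldots,X_n)$, $Y=(Y_1,\ldots,Y_m)$, $Z=(Z_1,\ldots,Z_p)$, and let $$K_{xy}=\{(x,y)\in\mathbb{R}^{n+m} : g_j(x,y)\ge 0,\ j\in I_{xy}\},$$ $$K_{yz}=\{(y,z)\in\mathbb{R}^{m+p} : h_k(y,z)\ge 0,\ k\in I_{yz}\},$$ $$K=\{(x,y,z)\in\mathbb{R}^{n+m+p} : (x,y)\in K_{xy},\ (y,z)\in K_{yz}\}.$$ Assume that $K_{xy}$, $K_{yz}$ and $K$ are compact and that $K$ has nonempty interior. Let $f\in\mathbb{R}[X,Y]+\mathbb{R}[Y,Z]$. Then: (a) If $f>0$ on $K$, then $f\in P(g)+P(h)$. (b) Suppose $f>0$ on $K$. If $N-\|(X,Y)\|^2\in Q(g)$ for some scalar $N$, then in (a) one may replace $P(g)$ with $Q(g)$, i.e. $f\in Q(g)+P(h)$. If $N-\|(Y,Z)\|^2\in Q(h)$ for some scalar $N$, then in (a) one may replace $P(h)$ with $Q(h)$, i.e. $f\in P(g)+Q(h)$. If both conditions hold, then both replacements may be made simultaneously, i.e. $f\in Q(g)+Q(h)$. (c) Assume that $0\le g_j\le 1$ on $K_{xy}$ for all $j\in I_{xy}$ and $0\le h_k\le 1$ on $K_{yz}$ for all $k\in I_{yz}$. In addition, assume that the family $\{0,1\}\cup\{g_j : j\in I_{xy}\}$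 generates the $\mathbb{R}$-algebra $\mathbb{R}[X,Y]$ and that the family $\{0,1\}\cup\{h_k : k\in I_{yz}\}$ generates the $\mathbb{R}$-algebra $\mathbb{R}[Y,Z]$. If $f>0$ on $K$, then $f\in C(g,1-g)+C(h,1-h)$.
   Context: $\mathbb{R}[X,Y]$, $\mathbb{R}[Y,Z]$ are real polynomial rings, regarded as subrings of $\mathbb{R}[X,Y,Z]$; $\mathbb{R}[X,Y]+\mathbb{R}[Y,Z]$ is the set of sums of an element of $\mathbb{R}[X,Y]$ and an element of $\mathbb{R}[Y,Z]$. Sums of sets such as $P(g)+P(h)$ are Minkowski sums in $\mathbb{R}[X,Y,Z]$. The norm $\|\cdot\|$ is Euclidean, so $\|(X,Y)\|^2=\sum_i X_i^2+\sum_i Y_i^2$ and $\|(Y,Z)\|^2=\sum_i Y_i^2+\sum_i Z_i^2$. Let $\Sigma^2_{xy}\subset\mathbb{R}[X,Y]$ and $\Sigma^2_{yz}\subset\mathbb{R}[Y,Z]$ be the sets of (finite) sums of squares of elements of $\mathbb{R}[X,Y]$ and of $\mathbb{R}[Y,Z]$, respectively. Preordering: $P(g)\subset\mathbb{R}[X,Y]$ is the set of all $\sum_{J\subseteq I_{xy}}\sigma_J\prod_{j\in J}g_j$ with $\sigma_J\in\Sigma^2_{xy}$ for every $J\subseteq I_{xy}$ (the empty product being $1$). $P(h)\subset\mathbb{R}[Y,Z]$ is the set of all $\sum_{L\subseteq I_{yz}}\psi_L\prod_{k\in L}h_k$ with $\psi_L\in\Sigma^2_{yz}$. Quadratic module: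 $Q(g)\subset\mathbb{R}[X,Y]$ is the set of all $\sigma_0+\sum_{j\in I_{xy}}\sigma_j g_j$, where $\sigma_0$ and all the $\sigma_j$ are in $\Sigma^2_{xy}$ ($\sigma_0$ being a separate term, not attached to any index of $I_{xy}$). $Q(h)\subset\mathbb{R}[Y,Z]$ is defined in the same way with $h_k$, $I_{yz}$ and $\Sigma^2_{yz}$. Cone: $C(g,1-g)\subset\mathbb{R}[X,Y]$ is the set of all finite sums $\sum_{\alpha,\beta\in\mathbb{N}^{I_{xy}}}c_{\alpha\beta}\prod_{j\in I_{xy}}g_j^{\alpha_j}(1-g_j)^{\beta_j}$ with nonnegative real coefficients $c_{\alpha\beta}$ (here $0\in\mathbb{N}$). $C(h,1-h)\subset\mathbb{R}[Y,Z]$ is defined in the same way with $h_k$ and $I_{yz}$. *)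

theory Defs
  imports "HOL-Analysis.Analysis" "HOL-Library.Poly_Mapping"
begin

text \<open>
  A polynomial is a finitely supported map from monomials (finitely supported exponent maps on the
  variables) to coefficients; the ring operations are those of \<^theory>\<open>HOL-Library.Poly_Mapping\<close>,
  whose product is convolution.
\<close>

type_synonym 'v mpoly = "('v \<Rightarrow>\<^sub>0 nat) \<Rightarrow>\<^sub>0 real"

definition Const :: "real \<Rightarrow> 'v mpoly" where
  "Const c = Poly_Mapping.single 0 c"

definition Var :: "'v \<Rightarrow> 'v mpoly" where
  "Var v = Poly_Mapping.single (Poly_Mapping.single v 1) 1"

definition poly_eval :: "('v \<Rightarrow> real) \<Rightarrow> 'v mpoly \<Rightarrow> real" where
  "poly_eval a p = (\<Sum>t\<in>Poly_Mapping.keys p.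
     Poly_Mapping.lookup p t * (\<Prod>v\<in>Poly_Mapping.keys t. a v ^ Poly_Mapping.lookup t v))"

definition polys_in :: "'v set \<Rightarrow> 'v mpoly set" where
  "polys_in V = {p. \<forall>t\<in>Poly_Mapping.keys p. Poly_Mapping.keys t \<subseteq> V}"


subsection \<open>Sums of squares, preorderings, quadratic modules, cones\<close>

text \<open>In this part \<open>A\<close> is the subring from which the sum-of-squares multipliers are taken.\<close>

definition sums_of_squares :: "'v mpoly set \<Rightarrow> 'v mpoly set" where
  "sums_of_squares A = {(\<Sum>i<k. (q i)\<^sup>2) | (k::nat) q. \<forall>i<k. q i \<in> A}"

definition poly_preordering :: "'v mpoly set \<Rightarrow> 'i set \<Rightarrow> ('i \<Rightarrow> 'v mpoly) \<Rightarrow> 'v mpoly set" where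
  "poly_preordering A I g =
     {(\<Sum>J\<in>Pow I. \<sigma> J * (\<Prod>j\<in>J. g j)) | \<sigma>. \<forall>J\<in>Pow I. \<sigma> J \<in> sums_of_squares A}"

definition poly_quadratic_module :: "'v mpoly set \<Rightarrow> 'i set \<Rightarrow> ('i \<Rightarrow> 'v mpoly) \<Rightarrow> 'v mpoly set" where
  "poly_quadratic_module A I g =
     {\<sigma>0 + (\<Sum>j\<in>I. \<sigma> j * g j) | \<sigma>0 \<sigma>.
        \<sigma>0 \<in> sums_of_squares A \<and> (\<forall>j\<in>I. \<sigma> j \<in> sums_of_squares A)}"

text \<open>Exponent vectors in \<open>\<nat>\<^sup>I\<close> are extensional functions, so that each is represented once.\<close>

definition poly_cone :: "'i set \<Rightarrow> ('i \<Rightarrow> 'v mpoly) \<Rightarrow> 'v mpoly set" where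
  "poly_cone I g =
     {(\<Sum>(\<alpha>, \<beta>)\<in>F. Const (c \<alpha> \<beta>) * (\<Prod>j\<in>I. g j ^ \<alpha> j * (1 - g j) ^ \<beta> j)) | F c.
        finite F \<and> F \<subseteq> (I \<rightarrow>\<^sub>E UNIV) \<times> (I \<rightarrow>\<^sub>E (UNIV :: nat set)) \<and>
        (\<forall>(\<alpha>, \<beta>)\<in>F. 0 \<le> c \<alpha> \<beta>)}"

definition is_subalgebra :: "'v mpoly set \<Rightarrow> bool" where
  "is_subalgebra B \<longleftrightarrow>
     (\<forall>c. Const c \<in> B) \<and> (\<forall>p\<in>B. \<forall>q\<in>B. p + q \<in> B) \<and> (\<forall>p\<in>B. \<forall>q\<in>B. p * q \<in> B)"

definition generates_algebra :: "'v mpoly set \<Rightarrow> 'v mpoly set \<Rightarrow> bool" where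
  "generates_algebra S A \<longleftrightarrow> is_subalgebra hull S = A"


subsection \<open>Three blocks of variables\<close>

datatype ('x, 'y, 'z) xyz_var = VX 'x | VY 'y | VZ 'z

definition ring_xy :: "('x, 'y, 'z) xyz_var mpoly set" where
  "ring_xy = polys_in (range VX \<union> range VY)"

definition ring_yz :: "('x, 'y, 'z) xyz_var mpoly set" where
  "ring_yz = polys_in (range VY \<union> range VZ)"

definition norm_sq_xy :: "('x::finite, 'y::finite, 'z) xyz_var mpoly" where
  "norm_sq_xy = (\<Sum>i\<in>UNIV. (Var (VX i))\<^sup>2) + (\<Sum>i\<in>UNIV. (Var (VY i))\<^sup>2)"

definition norm_sq_yz :: "('x, 'y::finite, 'z::finite) xyz_var mpoly" where
  "norm_sq_yz = (\<Sum>i\<in>UNIV. (Var (VY i))\<^sup>2) + (\<Sum>i\<in>UNIV. (Var (VZ i))\<^sup>2)"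

fun assignment :: "real ^ 'x \<Rightarrow> real ^ 'y \<Rightarrow> real ^ 'z \<Rightarrow> ('x::finite, 'y::finite, 'z::finite) xyz_var \<Rightarrow> real" where
  "assignment x y z (VX i) = x $ i"
| "assignment x y z (VY i) = y $ i"
| "assignment x y z (VZ i) = z $ i"

definition eval_xyz :: "('x::finite, 'y::finite, 'z::finite) xyz_var mpoly \<Rightarrow> real ^ 'x \<Rightarrow> real ^ 'y \<Rightarrow> real ^ 'z \<Rightarrow> real" where
  "eval_xyz p x y z = poly_eval (assignment x y z) p"

text \<open>
  A polynomial of \<open>\<real>[X,Y]\<close> is evaluated at a point \<open>(x,y)\<close>, and one of \<open>\<real>[Y,Z]\<close> at a point
  \<open>(y,z)\<close>. The value \<open>0\<close> given to the missing block is immaterial by the two lemmas below.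
\<close>

definition eval_xy :: "('x::finite, 'y::finite, 'z::finite) xyz_var mpoly \<Rightarrow> real ^ 'x \<Rightarrow> real ^ 'y \<Rightarrow> real" where
  "eval_xy p x y = eval_xyz p x y 0"

definition eval_yz :: "('x::finite, 'y::finite, 'z::finite) xyz_var mpoly \<Rightarrow> real ^ 'y \<Rightarrow> real ^ 'z \<Rightarrow> real" where
  "eval_yz p y z = eval_xyz p 0 y z"

lemma poly_eval_cong:
  assumes "p \<in> polys_in V" and "\<And>v. v \<in> V \<Longrightarrow> a v = b v"
  shows "poly_eval a p = poly_eval b p"
  using assms unfolding poly_eval_def polys_in_def
  by (intro sum.cong refl arg_cong2[where f = times] prod.cong arg_cong2[where f = power]) blast

lemma eval_xy_eq: "p \<in> ring_xy \<Longrightarrow> eval_xy p x y = eval_xyz p x y z"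
  unfolding eval_xy_def eval_xyz_def ring_xy_def by (erule poly_eval_cong) auto

lemma eval_yz_eq: "p \<in> ring_yz \<Longrightarrow> eval_yz p y z = eval_xyz p x y z"
  unfolding eval_yz_def eval_xyz_def ring_yz_def by (erule poly_eval_cong) auto

definition K_xy :: "'i set \<Rightarrow> ('i \<Rightarrow> ('x::finite, 'y::finite, 'z::finite) xyz_var mpoly) \<Rightarrow> ((real ^ 'x) \<times> (real ^ 'y)) set" where
  "K_xy I g = {(x, y). \<forall>j\<in>I. 0 \<le> eval_xy (g j) x y}"

definition K_yz :: "'k set \<Rightarrow> ('k \<Rightarrow> ('x::finite, 'y::finite, 'z::finite) xyz_var mpoly) \<Rightarrow> ((real ^ 'y) \<times> (real ^ 'z)) set" where
  "K_yz L h = {(y, z). \<forall>k\<in>L. 0 \<le> eval_yz (h k) y z}"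

definition K_xyz :: "'i set \<Rightarrow> ('i \<Rightarrow> ('x::finite, 'y::finite, 'z::finite) xyz_var mpoly) \<Rightarrow>
    'k set \<Rightarrow> ('k \<Rightarrow> ('x::finite, 'y::finite, 'z::finite) xyz_var mpoly) \<Rightarrow> ((real ^ 'x) \<times> (real ^ 'y) \<times> (real ^ 'z)) set" where
  "K_xyz I g L h = {(x, y, z). (x, y) \<in> K_xy I g \<and> (y, z) \<in> K_yz L h}"

end

theory Submission
  imports Defs "HOL-Computational_Algebra.Fraction_Field" "HOL-Algebra.Algebraic_Closure_Type"
begin

text \<open>
  Write \<open>f = p + q\<close> with \<open>p\<close> in the variables \<open>X, Y\<close> and \<open>q\<close> in \<open>Y, Z\<close>. Positivity of \<open>f\<close> on the fibre product
  says that over each \<open>y\<close> the numbers \<open>- p(x, y)\<close> lie below the numbers \<open>q(y, z)\<close>, so by compactness, a partition of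
  unity and Stone--Weierstrass there is a polynomial \<open>r(y)\<close> strictly between them. Then \<open>f = (p + r) + (q - r)\<close>,
  and the classical one-block theorems (Schmuedgen, Putinar, Krivine--Handelman) apply to both summands.
  These follow from an archimedean Positivstellensatz (maximal proper modules are kernels of order homomorphisms to the
  reals), with Woermann's argument deducing the archimedean property from compactness. The latter needs the
  Krivine--Stengle Positivstellensatz: the signs of finitely many polynomials in an arbitrary prime cone of
  \<open>\<real>[X]\<close> occur at a real point. This is proved by eliminating one variable at a time: between two real closed
  fields, sign tables of families closed under derivatives and pseudo-remainders are matched by induction
  on the degree (Cohen--Hoermander), one of the fields being a real closure of the residue field of the cone.
\<close>

hide_const (open) module.smult up_ring.coeff up_ring.monom Polynomials.degree Polynomials.lead_coeff
  Coset.order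

section \<open>Prime cones of commutative rings\<close>

text \<open>Only the splitting involves both blocks: over a fixed y the points x and z vary
  independently, so f > 0 puts the maximum of -p below the minimum of q, and compactness makes the
  room uniform enough for a polynomial approximation. Two obstacles shape the rest. First, all
  polynomials share the type over \<open>xyz_var\<close>, while multipliers must lie in one block.
  Certificates with sums of squares are therefore found with multipliers from the whole ring and
  then pushed into the block by the retraction \<open>restrict_vars\<close>, which fixes the
  generators. Second, compactness speaks of real points, whereas Zorn's lemma yields abstract
  orderings. An ordering cannot in general be replaced by a real point, but finitely many of its
  signs can; hence a transfer of signs rather than an embedding. The two fields are never compared
  directly: both receive a homomorphism from the same coefficient ring, and only the signs of
  coefficients have to coincide. Pseudo-division replaces division because these coefficients are
  themselves polynomials.\<close>

definition ring_preordering :: "'a::comm_ring_1 set \<Rightarrow> bool" where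
  "ring_preordering T \<longleftrightarrow> (\<forall>x\<in>T. \<forall>y\<in>T. x + y \<in> T \<and> x * y \<in> T) \<and> (\<forall>x. x * x \<in> T)"

definition prime_cone :: "'a::comm_ring_1 set \<Rightarrow> bool" where
  "prime_cone P \<longleftrightarrow> ring_preordering P \<and> - 1 \<notin> P \<and> (\<forall>x. x \<in> P \<or> - x \<in> P) \<and>
     (\<forall>x y. x * y \<in> P \<and> - (x * y) \<in> P \<longrightarrow> (x \<in> P \<and> - x \<in> P) \<or> (y \<in> P \<and> - y \<in> P))"

lemma ring_preorderingD:
  assumes "ring_preordering T"
  shows "x \<in> T \<Longrightarrow> y \<in> T \<Longrightarrow> x + y \<in> T" "x \<in> T \<Longrightarrow> y \<in> T \<Longrightarrow> x * y \<in> T" "x * x \<in> T" "0 \<in> T" "1 \<in> T"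
  using assms unfolding ring_preordering_def
  by (blast, blast, blast, metis mult_zero_left, metis mult_1)

lemma neg_one_eqD:
  fixes p z :: "'a::ring_1"
  assumes "- 1 = p + z"
  shows "1 + p = - z"
proof -
  have "1 + (p + z) = 0" unfolding assms[symmetric] by simp
  then show ?thesis by (simp add: eq_neg_iff_add_eq_0 add.assoc)
qed

text \<open>A product of two elements of T + x T contains x^2 q q', which falls back into T because
  squares lie in T; so no higher powers of \<open>x\<close> are needed.\<close>

lemma ring_preordering_adjoin:
  fixes x :: "'a::comm_ring_1"
  assumes T: "ring_preordering T"
  shows "ring_preordering {p + x * q | p q. p \<in> T \<and> q \<in> T}" (is "ring_preordering ?S")
    and "T \<subseteq> {p + x * q | p q. p \<in> T \<and> q \<in> T}" and "x \<in> {p + x * q | p q. p \<in> T \<and> q \<in> T}"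
proof -
  note TD = ring_preorderingD[OF T]
  have sub: "T \<subseteq> ?S"
  proof
    fix p assume "p \<in> T"
    then have "p = p + x * 0 \<and> p \<in> T \<and> 0 \<in> T" using TD(4) by simp
    then show "p \<in> ?S" by blast
  qed
  show "T \<subseteq> ?S" by (fact sub)
  have "x = 0 + x * 1" by simp
  then show "x \<in> ?S" using TD(4,5) by blast
  show "ring_preordering ?S" unfolding ring_preordering_def
  proof (intro conjI ballI allI)
    fix a b assume "a \<in> ?S" "b \<in> ?S"
    then obtain p q p' q' where ab: "a = p + x * q" "b = p' + x * q'" "p \<in> T" "q \<in> T" "p' \<in> T" "q' \<in> T"
      by blast
    have "a + b = (p + p') + x * (q + q')" using ab by (simp add: algebra_simps)
    moreover have "p + p' \<in> T" "q + q' \<in> T" using ab TD(1) by auto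
    ultimately show "a + b \<in> ?S" by blast
    have "a * b = (p * p' + (x * x) * (q * q')) + x * (p * q' + p' * q)" using ab by (simp add: algebra_simps)
    moreover have "p * p' + (x * x) * (q * q') \<in> T" "p * q' + p' * q \<in> T"
      using ab TD(1,2,3) by auto
    ultimately show "a * b \<in> ?S" by blast
  next
    fix a show "a * a \<in> ?S" using sub TD(3) by blast
  qed
qed

text \<open>A maximal proper preordering is a prime cone. Totality and primeness use the same
  device: if two elements cannot be adjoined, the two resulting expressions for -1 are multiplied,
  and the product shows that -1 already lies in \<open>P\<close>.\<close>

lemma prime_cone_extension:
  fixes T :: "'a::comm_ring_1 set"
  assumes T: "ring_preordering T" "- 1 \<notin> T"
  obtains P where "prime_cone P" "T \<subseteq> P"
proof -
  let ?A = "{S. ring_preordering S \<and> - 1 \<notin> S \<and> T \<subseteq> S}"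
  have "\<exists>M\<in>?A. \<forall>S\<in>?A. M \<subseteq> S \<longrightarrow> S = M"
  proof (rule subset_Zorn_nonempty)
    show "?A \<noteq> {}" using T by blast
    fix \<C> assume C: "\<C> \<noteq> {}" "subset.chain ?A \<C>"
    then have el: "\<And>S. S \<in> \<C> \<Longrightarrow> ring_preordering S \<and> - 1 \<notin> S \<and> T \<subseteq> S" unfolding subset_chain_def by blast
    have "ring_preordering (\<Union>\<C>)" unfolding ring_preordering_def
    proof (intro conjI ballI allI)
      fix x y assume "x \<in> \<Union>\<C>" "y \<in> \<Union>\<C>"
      then obtain S where "S \<in> \<C>" "x \<in> S" "y \<in> S" using C(2) unfolding subset_chain_def by blast
      then show "x + y \<in> \<Union>\<C>" "x * y \<in> \<Union>\<C>" using el ring_preorderingD(1,2) by blast+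
    next
      fix x show "x * x \<in> \<Union>\<C>" using C(1) el ring_preorderingD(3) by blast
    qed
    then show "\<Union>\<C> \<in> ?A" using C(1) el by blast
  qed
  then obtain P where P: "ring_preordering P" "- 1 \<notin> P" "T \<subseteq> P"
    and max: "\<And>S. ring_preordering S \<Longrightarrow> - 1 \<notin> S \<Longrightarrow> P \<subseteq> S \<Longrightarrow> S = P" by fastforce
  note PD = ring_preorderingD[OF P(1)]
  have adj: "\<exists>p\<in>P. \<exists>q\<in>P. - 1 = p + x * q" if "x \<notin> P" for x
  proof (rule ccontr)
    assume "\<not> ?thesis"
    then have "- 1 \<notin> {p + x * q | p q. p \<in> P \<and> q \<in> P}" by blast
    from max[OF ring_preordering_adjoin(1)[OF P(1)] this ring_preordering_adjoin(2)[OF P(1)]]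
    show False using ring_preordering_adjoin(3)[OF P(1), of x] that by simp
  qed
  have tot: "x \<in> P \<or> - x \<in> P" for x
  proof (rule ccontr)
    assume "\<not> ?thesis"
    then obtain p q p' q' where m: "p \<in> P" "q \<in> P" "p' \<in> P" "q' \<in> P" "- 1 = p + x * q" "- 1 = p' + (- x) * q'"
      using adj[of x] adj[of "- x"] by blast
    have "1 + p = - (x * q)" "1 + p' = x * q'"
      using neg_one_eqD[OF m(5)] neg_one_eqD[OF m(6)] by simp_all
    then have "(1 + p) * (1 + p') + (x * x) * (q * q') = 0" by (simp add: algebra_simps)
    then have "(x * x) * (q * q') + p + p' + p * p' = - 1"
      by (subst eq_neg_iff_add_eq_0) (simp add: algebra_simps)
    then show False using m PD P(2) by metis
  qed
  have prime: "(x \<in> P \<and> - x \<in> P) \<or> (y \<in> P \<and> - y \<in> P)" if xy: "x * y \<in> P" "- (x * y) \<in> P" for x y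
  proof (rule ccontr)
    assume n: "\<not> ?thesis"
    \<comment> \<open>Up to sign, an element outside the support lies in \<open>P\<close> while its
      negative does not.\<close>
    obtain a where a: "a \<in> P" "- a \<notin> P" "a = x \<or> a = - x" using n tot by (metis minus_minus)
    obtain b where b: "b \<in> P" "- b \<notin> P" "b = y \<or> b = - y" using n tot by (metis minus_minus)
    have ab: "- (a * b) \<in> P" using a(3) b(3) xy by auto
    obtain p q where 1: "p \<in> P" "q \<in> P" "- 1 = p + (- a) * q" using adj[OF a(2)] by blast
    obtain p' q' where 2: "p' \<in> P" "q' \<in> P" "- 1 = p' + (- b) * q'" using adj[OF b(2)] by blast
    have "1 + p = a * q" "1 + p' = b * q'"
      using neg_one_eqD[OF 1(3)] neg_one_eqD[OF 2(3)] by simp_all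
    then have "(1 + p) * (1 + p') + (- (a * b)) * (q * q') = 0" by (simp add: algebra_simps)
    then have "(- (a * b)) * (q * q') + p + p' + p * p' = - 1"
      by (subst eq_neg_iff_add_eq_0) (simp add: algebra_simps)
    then show False using 1 2 ab PD P(2) by metis
  qed
  show ?thesis using that[of P] P tot prime unfolding prime_cone_def by blast
qed

lemma prime_coneD:
  assumes "prime_cone P"
  shows "x \<in> P \<Longrightarrow> y \<in> P \<Longrightarrow> x + y \<in> P" "x \<in> P \<Longrightarrow> y \<in> P \<Longrightarrow> x * y \<in> P" "x * x \<in> P" "0 \<in> P" "1 \<in> P"
    "- 1 \<notin> P" "x \<in> P \<or> - x \<in> P"
    "x * y \<in> P \<Longrightarrow> - (x * y) \<in> P \<Longrightarrow> (x \<in> P \<and> - x \<in> P) \<or> (y \<in> P \<and> - y \<in> P)"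
  using assms ring_preorderingD[of P] unfolding prime_cone_def by auto

text \<open>The support of a prime cone is an ideal: by totality the other factor lies in
  \<open>P\<close> up to sign.\<close>

lemma prime_cone_support_mult:
  assumes "prime_cone P" "x \<in> P" "- x \<in> P"
  shows "x * y \<in> P" "- (x * y) \<in> P"
proof -
  have "x * y \<in> P \<and> - (x * y) \<in> P"
    using prime_coneD(7)[OF assms(1), of y]
  proof
    assume "y \<in> P"
    then show ?thesis using prime_coneD(2)[OF assms(1)] assms(2,3) by (metis mult_minus_left)
  next
    assume "- y \<in> P"
    then show ?thesis using prime_coneD(2)[OF assms(1)] assms(2,3) by (metis minus_mult_minus minus_mult_right)
  qed
  then show "x * y \<in> P" "- (x * y) \<in> P" by auto
qed

section \<open>Real closed fields\<close>

text \<open>For ordered fields, the intermediate value property of polynomials is equivalent to real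
  closedness, and it is the form used below. Polynomials appear as coefficient sums so that the
  axiom involves nothing but the field operations and the order.\<close>

class real_closed_field = linordered_field +
  assumes poly_ivt_sum: "a < b \<Longrightarrow> (\<Sum>i\<le>n. f i * a ^ i) < 0 \<Longrightarrow> 0 < (\<Sum>i\<le>n. f i * b ^ i) \<Longrightarrow>
    \<exists>c. a < c \<and> c < b \<and> (\<Sum>i\<le>n. f i * c ^ i) = 0"

lemma poly_ivt:
  fixes p :: "'a::real_closed_field poly"
  shows "a < b \<Longrightarrow> poly p a < 0 \<Longrightarrow> 0 < poly p b \<Longrightarrow> \<exists>c. a < c \<and> c < b \<and> poly p c = 0"
  using poly_ivt_sum[of a b "coeff p" "degree p"] by (simp add: poly_altdef)

lemma real_closed_fieldI:
  assumes "\<And>p a b :: 'a::linordered_field. a < b \<Longrightarrow> poly p a < 0 \<Longrightarrow> 0 < poly p b \<Longrightarrow> \<exists>c. a < c \<and> c < b \<and> poly p c = 0"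
  shows "OFCLASS('a, real_closed_field_class)"
proof
  fix a b :: 'a and n f
  define p where "p = (\<Sum>i\<le>n. monom (f i) i :: 'a poly)"
  have "poly p x = (\<Sum>i\<le>n. f i * x ^ i)" for x unfolding p_def by (simp add: poly_sum poly_monom)
  then show "a < b \<Longrightarrow> (\<Sum>i\<le>n. f i * a ^ i) < 0 \<Longrightarrow> 0 < (\<Sum>i\<le>n. f i * b ^ i) \<Longrightarrow>
    \<exists>c. a < c \<and> c < b \<and> (\<Sum>i\<le>n. f i * c ^ i) = 0"
    using assms[of a b p] by simp
qed

instance real :: real_closed_field
  by (rule real_closed_fieldI) (meson poly_IVT_pos)

text \<open>In an ordered field, unlike in \<open>\<real>\<close>, a nonnegative weight need not be a square.\<close>

inductive_set weighted_squares :: "'k::linordered_field poly set" where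
  zero: "0 \<in> weighted_squares"
| add: "p \<in> weighted_squares \<Longrightarrow> 0 \<le> c \<Longrightarrow> p + smult c (h * h) \<in> weighted_squares"

lemma weighted_squares_single: "0 \<le> c \<Longrightarrow> smult c (h * h) \<in> weighted_squares"
  using weighted_squares.add[OF weighted_squares.zero] by fastforce

lemma weighted_squares_add:
  "q \<in> weighted_squares \<Longrightarrow> p \<in> weighted_squares \<Longrightarrow> p + q \<in> weighted_squares"
  by (induction rule: weighted_squares.induct) (auto simp: add.assoc[symmetric] intro: weighted_squares.add)

lemma weighted_squares_mult_single:
  "p \<in> weighted_squares \<Longrightarrow> 0 \<le> c \<Longrightarrow> p * smult c (h * h) \<in> weighted_squares"
proof (induction rule: weighted_squares.induct)
  case zero
  then show ?case by (simp add: weighted_squares.zero)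
next
  case (add p d k)
  have "(p + smult d (k * k)) * smult c (h * h) = p * smult c (h * h) + smult (d * c) ((k * h) * (k * h))"
    by (simp add: algebra_simps)
  then show ?case using add weighted_squares.add[OF add(3)] by (metis mult_nonneg_nonneg)
qed

lemma weighted_squares_mult:
  "q \<in> weighted_squares \<Longrightarrow> p \<in> weighted_squares \<Longrightarrow> p * q \<in> weighted_squares"
proof (induction rule: weighted_squares.induct)
  case zero
  then show ?case by (simp add: weighted_squares.zero)
next
  case (add q c h)
  then show ?case unfolding distrib_left by (intro weighted_squares_add weighted_squares_mult_single)
qed

text \<open>Each \<open>h\<close> may be replaced by its remainder modulo \<open>f\<close>, so a sum
  of weighted squares is congruent to one of degree at most 2 deg f - 2. This bound later forces the
  cofactor of \<open>f\<close> to have small degree.\<close>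

lemma weighted_squares_reduce:
  assumes "p \<in> weighted_squares" "0 < degree f"
  shows "\<exists>r q. p = r + f * q \<and> (\<forall>x. 0 \<le> poly r x) \<and> degree r + 1 < 2 * degree f"
  using assms
proof (induction rule: weighted_squares.induct)
  case zero
  then show ?case by (intro exI[of _ 0]) auto
next
  case (add p c h)
  then obtain r q where r: "p = r + f * q" "\<forall>x. 0 \<le> poly r x" "degree r + 1 < 2 * degree f" by blast
  define k where "k = h mod f"
  define s where "s = h div f"
  have h: "h = f * s + k" unfolding k_def s_def by simp
  have dk: "degree k < degree f" unfolding k_def using add(4) by (metis degree_mod_less' degree_0 mod_by_0 not_less0 neq0_conv degree_mod_less)
  have "p + smult c (h * h) = (r + smult c (k * k)) + f * (q + smult c (f * s * s + s * k + s * k))"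
    unfolding r(1) h by (simp add: algebra_simps smult_add_right)
  moreover have "\<forall>x. 0 \<le> poly (r + smult c (k * k)) x" using r(2) add(2) by simp
  moreover have "degree (smult c (k * k)) \<le> 2 * degree k" using degree_mult_le[of k k] degree_smult_le[of c "k * k"] by linarith
  then have "degree (r + smult c (k * k)) + 1 < 2 * degree f"
    using degree_add_le_max[of r "smult c (k * k)"] r(3) dk by linarith
  ultimately show ?case by blast
qed

text \<open>Take a counterexample \<open>f\<close> of least degree and the preordering generated by
  the weighted squares and the ideal of \<open>f\<close>. If it contained -1, there would be r + f u
  = -1 with r nonnegative everywhere, so f u < 0 everywhere, and u would have smaller degree than f
  and opposite signs at \<open>a\<close> and \<open>b\<close>. By minimality u would have a root,
  where f u cannot be negative.\<close>

lemma ivt_failure_imp_prime_cone: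
  fixes p :: "'k::linordered_field poly"
  assumes fail: "a < b" "poly p a < 0" "0 < poly p b" "\<And>c. a < c \<Longrightarrow> c < b \<Longrightarrow> poly p c \<noteq> 0"
  obtains f :: "'k poly" and P where "\<And>c. poly f c \<noteq> 0" "prime_cone P" "f \<in> P" "- f \<in> P" "\<And>c. 0 \<le> c \<Longrightarrow> [:c:] \<in> P"
proof -
  define bad where "bad = (\<lambda>f. \<exists>a b::'k. a < b \<and> poly f a < 0 \<and> 0 < poly f b \<and> (\<forall>c. a < c \<longrightarrow> c < b \<longrightarrow> poly f c \<noteq> 0))"
  have "\<exists>f. bad f" using fail unfolding bad_def by blast
  then obtain f where bf: "bad f" and min: "\<And>g. degree g < degree f \<Longrightarrow> \<not> bad g"
    using exists_least_iff[of "\<lambda>n. \<exists>f. bad f \<and> degree f = n"] by metis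
  obtain a b where ab: "a < b" "poly f a < 0" "0 < poly f b" "\<And>c. a < c \<Longrightarrow> c < b \<Longrightarrow> poly f c \<noteq> 0"
    using bf unfolding bad_def by blast
  have ivt: "\<exists>c. a < c \<and> c < b \<and> poly g c = 0" if "degree g < degree f" "poly g a * poly g b < 0" for g
  proof (cases "poly g a < 0")
    case True
    then have "0 < poly g b" using that(2) by (simp add: mult_less_0_iff)
    then show ?thesis using min[OF that(1)] True ab(1) unfolding bad_def by blast
  next
    case False
    then have "poly (- g) a < 0" "0 < poly (- g) b" using that(2) by (auto simp: mult_less_0_iff)
    then show ?thesis using min[of "- g"] that(1) ab(1) unfolding bad_def by fastforce
  qed
  \<comment> \<open>A root outside the interval can be split off: the quotient still changes sign
    between \<open>a\<close> and \<open>b\<close>, so by minimality it has a root there, which is a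
    root of \<open>f\<close> too.\<close>
  have noroot: "poly f c \<noteq> 0" for c
  proof
    assume c: "poly f c = 0"
    then obtain g where g: "f = [:- c, 1:] * g" by (metis dvdE poly_eq_0_iff_dvd)
    have f0: "f \<noteq> 0" using ab by auto
    then have "g \<noteq> 0" using g by auto
    then have deg: "degree g < degree f" unfolding g by (subst degree_mult_eq) auto
    have "\<not> (a \<le> c \<and> c \<le> b)" using ab c by (metis less_irrefl order_le_less)
    then have "0 < (a - c) * (b - c)" using ab(1) by (auto simp: zero_less_mult_iff not_le)
    moreover have "((a - c) * (b - c)) * (poly g a * poly g b) < 0"
    proof -
      have "poly f a * poly f b < 0" using ab by (simp add: mult_neg_pos)
      then show ?thesis unfolding g by (simp add: algebra_simps)
    qed
    ultimately have "poly g a * poly g b < 0" by (metis mult_less_0_iff order_less_not_sym)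
    from ivt[OF deg this] obtain e where "a < e" "e < b" "poly g e = 0" by blast
    then show False using ab(4)[of e] g by simp
  qed
  have df: "0 < degree f"
  proof (rule ccontr)
    assume "\<not> ?thesis"
    then obtain d where "f = [:d:]" using degree_eq_zeroE by blast
    then show False using ab by simp
  qed
  define T where "T = {s + f * q | s q. s \<in> weighted_squares}"
  have "ring_preordering T" unfolding ring_preordering_def
  proof (intro conjI ballI allI)
    fix x y assume "x \<in> T" "y \<in> T"
    then obtain s q s' q' where e: "x = s + f * q" "y = s' + f * q'" "s \<in> weighted_squares" "s' \<in> weighted_squares"
      unfolding T_def by blast
    have "x + y = (s + s') + f * (q + q')" unfolding e by (simp add: algebra_simps)
    then show "x + y \<in> T" unfolding T_def using e weighted_squares_add by blast
    have "x * y = (s * s') + f * (s * q' + s' * q + f * q * q')" unfolding e by (simp add: algebra_simps)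
    then show "x * y \<in> T" unfolding T_def using e weighted_squares_mult by blast
  next
    fix x :: "'k poly"
    have "x * x = smult 1 (x * x) + f * 0" by simp
    then show "x * x \<in> T" unfolding T_def using weighted_squares_single[of 1 x] by (metis (mono_tags, lifting) mem_Collect_eq zero_le_one)
  qed
  moreover have "- 1 \<notin> T"
  proof
    assume "- 1 \<in> T"
    then obtain s q where s: "- 1 = s + f * q" "s \<in> weighted_squares" unfolding T_def by blast
    then obtain r q' where r: "s = r + f * q'" "\<forall>x. 0 \<le> poly r x" "degree r + 1 < 2 * degree f"
      using weighted_squares_reduce df by blast
    define u where "u = q + q'"
    have eq: "- 1 = r + f * u" using s r unfolding u_def by (simp add: algebra_simps)
    have neg: "poly f x * poly u x < 0" for x
    proof -
      have "poly (- 1) x = poly r x + poly f x * poly u x" unfolding eq by simp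
      moreover have "0 \<le> poly r x" using r(2) by simp
      ultimately show ?thesis by simp
    qed
    \<comment> \<open>f u = -(1 + r) and deg r <= 2 deg f - 2 leave less than deg f for u.\<close>
    have "degree u < degree f"
    proof -
      have u0: "u \<noteq> 0" using neg[of a] by auto
      have "f * u = - (1 + r)" using eq by (metis add.commute add_diff_cancel_left' minus_add uminus_add_conv_diff)
      then have "degree (f * u) \<le> degree r" using degree_add_le[of 1 "degree r" r] by (metis degree_1 degree_minus le0 order_refl)
      then have "degree f + degree u \<le> degree r" using u0 df by (subst (asm) degree_mult_eq) auto
      then show ?thesis using r(3) by linarith
    qed
    moreover have "poly u a * poly u b < 0" using neg[of a] neg[of b] ab(2,3) by (auto simp: mult_less_0_iff)
    ultimately obtain c where "poly u c = 0" using ivt by blast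
    then show False using neg[of c] by simp
  qed
  ultimately obtain P where P: "prime_cone P" "T \<subseteq> P" using prime_cone_extension by blast
  have "f = 0 + f * 1" "- f = 0 + f * (- 1)" by simp_all
  then have "f \<in> T" "- f \<in> T" unfolding T_def using weighted_squares.zero by blast+
  moreover have "[:c:] \<in> T" if "0 \<le> c" for c
  proof -
    have "[:c:] = smult c (1 * 1) + f * 0" by simp
    then show ?thesis unfolding T_def using weighted_squares_single[OF that, of 1] by blast
  qed
  ultimately show ?thesis using that[of f P] noroot P by blast
qed

subsection \<open>The real closure of an ordered field\<close>

text \<open>The positive cone of an ordering on a subfield of the algebraic closure that extends the
  order of the base field. The subfield is C together with -C and is not mentioned separately, so
  Zorn's lemma acts on plain sets.\<close>

definition field_cone :: "'a::linordered_field alg_closure set \<Rightarrow> bool" where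
  "field_cone C \<longleftrightarrow> (\<forall>x\<ge>0. to_ac x \<in> C) \<and>
     (\<forall>x\<in>C. \<forall>y\<in>C. x + y \<in> C \<and> x * y \<in> C \<and> (x - y \<in> C \<or> y - x \<in> C)) \<and>
     (\<forall>x\<in>C. inverse x \<in> C \<and> (- x \<in> C \<longrightarrow> x = 0))"

lemma field_coneD:
  assumes "field_cone C"
  shows "0 \<le> a \<Longrightarrow> to_ac a \<in> C" "0 \<in> C" "1 \<in> C" "x \<in> C \<Longrightarrow> y \<in> C \<Longrightarrow> x + y \<in> C"
    "x \<in> C \<Longrightarrow> y \<in> C \<Longrightarrow> x * y \<in> C" "x \<in> C \<Longrightarrow> y \<in> C \<Longrightarrow> x - y \<in> C \<or> y - x \<in> C"
    "x \<in> C \<Longrightarrow> inverse x \<in> C" "x \<in> C \<Longrightarrow> - x \<in> C \<Longrightarrow> x = 0"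
proof -
  have *: "\<And>a. 0 \<le> a \<Longrightarrow> to_ac a \<in> C" using assms[unfolded field_cone_def, THEN conjunct1] by simp
  then show "0 \<le> a \<Longrightarrow> to_ac a \<in> C" .
  show "0 \<in> C" using *[of 0] unfolding to_ac_0 by simp
  show "1 \<in> C" using *[of 1] unfolding to_ac_1 by simp
  note A = assms[unfolded field_cone_def, THEN conjunct2, THEN conjunct1]
  note B = assms[unfolded field_cone_def, THEN conjunct2, THEN conjunct2]
  show "x \<in> C \<Longrightarrow> y \<in> C \<Longrightarrow> x + y \<in> C" "x \<in> C \<Longrightarrow> y \<in> C \<Longrightarrow> x * y \<in> C"
    "x \<in> C \<Longrightarrow> y \<in> C \<Longrightarrow> x - y \<in> C \<or> y - x \<in> C" using A by simp_all
  show "x \<in> C \<Longrightarrow> inverse x \<in> C" "x \<in> C \<Longrightarrow> - x \<in> C \<Longrightarrow> x = 0" using B by simp_all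
qed

lemma maximal_field_cone_exists:
  "\<exists>C::'a::linordered_field alg_closure set. field_cone C \<and> (\<forall>D. field_cone D \<longrightarrow> C \<subseteq> D \<longrightarrow> D = C)"
proof -
  let ?A = "Collect field_cone :: 'a alg_closure set set"
  have "field_cone (to_ac ` {x::'a. 0 \<le> x})" unfolding field_cone_def
  proof (intro conjI ballI allI impI)
    fix x y :: "'a alg_closure" assume "x \<in> to_ac ` {x. 0 \<le> x}" "y \<in> to_ac ` {x. 0 \<le> x}"
    then obtain a b where ab: "x = to_ac a" "y = to_ac b" "0 \<le> a" "0 \<le> b" by blast
    show "x + y \<in> to_ac ` {x. 0 \<le> x}" unfolding ab(1,2) to_ac_add[symmetric] using ab(3,4) by (intro imageI) simp
    show "x * y \<in> to_ac ` {x. 0 \<le> x}" unfolding ab(1,2) to_ac_mult[symmetric] using ab(3,4) by (intro imageI) simp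
    show "x - y \<in> to_ac ` {x. 0 \<le> x} \<or> y - x \<in> to_ac ` {x. 0 \<le> x}"
      unfolding ab(1,2) to_ac_diff[symmetric] using linear[of b a]
      by (elim disjE) (rule disjI1 disjI2, rule imageI, simp)+
  next
    fix x :: "'a alg_closure" assume "x \<in> to_ac ` {x. 0 \<le> x}"
    then obtain a where a: "x = to_ac a" "0 \<le> a" by blast
    show "inverse x \<in> to_ac ` {x. 0 \<le> x}" unfolding a(1) to_ac_inverse[symmetric] using a(2) by (intro imageI) simp
    assume "- x \<in> to_ac ` {x. 0 \<le> x}"
    then obtain b where b: "- x = to_ac b" "0 \<le> b" by blast
    have "to_ac (- a) = to_ac b" unfolding b(1)[symmetric] a(1) by (rule to_ac_minus)
    then have "- a = b" by (simp only: to_ac_eq_iff)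
    then have "a = 0" using a(2) b(2) by linarith
    then show "x = 0" using a(1) by simp
  qed auto
  then have ne: "?A \<noteq> {}" by blast
  have "\<exists>M\<in>?A. \<forall>S\<in>?A. M \<subseteq> S \<longrightarrow> S = M"
  proof (rule subset_Zorn_nonempty[OF ne])
    fix \<C> assume C: "\<C> \<noteq> {}" "subset.chain ?A \<C>"
    then have el: "\<And>S. S \<in> \<C> \<Longrightarrow> field_cone S" unfolding subset_chain_def by blast
    have two: "\<exists>S\<in>\<C>. x \<in> S \<and> y \<in> S" if "x \<in> \<Union>\<C>" "y \<in> \<Union>\<C>" for x y
      using that C(2) unfolding subset_chain_def by blast
    have "field_cone (\<Union>\<C>)" unfolding field_cone_def
    proof (intro conjI ballI allI impI)
      fix x :: 'a assume "0 \<le> x"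
      then show "to_ac x \<in> \<Union>\<C>" using C(1) el field_coneD(1) by blast
    next
      fix x y assume "x \<in> \<Union>\<C>" "y \<in> \<Union>\<C>"
      then obtain S where S: "S \<in> \<C>" "x \<in> S" "y \<in> S" using two by blast
      note D = field_coneD[OF el[OF S(1)]]
      show "x + y \<in> \<Union>\<C>" "x * y \<in> \<Union>\<C>" "x - y \<in> \<Union>\<C> \<or> y - x \<in> \<Union>\<C>" using D(4-6)[OF S(2,3)] S(1) by blast+
    next
      fix x assume x: "x \<in> \<Union>\<C>"
      then show "inverse x \<in> \<Union>\<C>" using el field_coneD(7) by blast
      assume "- x \<in> \<Union>\<C>"
      then show "x = 0" using two[OF x] el field_coneD(8) by blast
    qed
    then show "\<Union>\<C> \<in> ?A" by blast
  qed
  then show ?thesis by blast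
qed

definition max_cone :: "'a::linordered_field alg_closure set" where
  "max_cone = (SOME C. field_cone C \<and> (\<forall>D. field_cone D \<longrightarrow> C \<subseteq> D \<longrightarrow> D = C))"

lemma field_cone_max_cone: "field_cone max_cone"
  and max_cone_maximal: "field_cone D \<Longrightarrow> max_cone \<subseteq> D \<Longrightarrow> D = max_cone"
  using someI_ex[OF maximal_field_cone_exists] unfolding max_cone_def by blast+

lemmas max_coneD = field_coneD[OF field_cone_max_cone]

text \<open>A maximal ordered extension inside the algebraic closure, hence a type constructed
  uniformly from the base field.\<close>

typedef (overloaded) 'a real_closure = "{x::'a::linordered_field alg_closure. x \<in> max_cone \<or> - x \<in> max_cone}"
  using max_coneD(2) by blast

setup_lifting type_definition_real_closure

lemma max_cone_union_add:
  assumes "x \<in> max_cone \<or> - x \<in> max_cone" "y \<in> max_cone \<or> - y \<in> max_cone"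
  shows "x + y \<in> max_cone \<or> - (x + y) \<in> max_cone"
  using assms max_coneD(4)[of x y] max_coneD(4)[of "- x" "- y"] max_coneD(6)[of x "- y"] max_coneD(6)[of y "- x"]
  by (metis add.commute add_diff_cancel_left' diff_minus_eq_add minus_add_distrib minus_diff_eq uminus_add_conv_diff)

lemma max_cone_union_mult:
  assumes "x \<in> max_cone \<or> - x \<in> max_cone" "y \<in> max_cone \<or> - y \<in> max_cone"
  shows "x * y \<in> max_cone \<or> - (x * y) \<in> max_cone"
  using assms max_coneD(5)[of x y] max_coneD(5)[of "- x" y] max_coneD(5)[of x "- y"] max_coneD(5)[of "- x" "- y"] by auto

lemma max_cone_union_inverse:
  assumes "x \<in> max_cone \<or> - x \<in> max_cone"
  shows "inverse x \<in> max_cone \<or> - inverse x \<in> max_cone"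
  using assms max_coneD(7)[of x] max_coneD(7)[of "- x"] by auto

instantiation real_closure :: (linordered_field) field
begin

lift_definition zero_real_closure :: "'a real_closure" is 0 by (rule disjI1, rule max_coneD(2))
lift_definition one_real_closure :: "'a real_closure" is 1 by (rule disjI1, rule max_coneD(3))
lift_definition plus_real_closure :: "'a real_closure \<Rightarrow> 'a real_closure \<Rightarrow> 'a real_closure" is plus
  by (rule max_cone_union_add)
lift_definition uminus_real_closure :: "'a real_closure \<Rightarrow> 'a real_closure" is uminus by auto
lift_definition minus_real_closure :: "'a real_closure \<Rightarrow> 'a real_closure \<Rightarrow> 'a real_closure" is minus
  using max_cone_union_add by (metis minus_minus uminus_add_conv_diff add.commute)
lift_definition times_real_closure :: "'a real_closure \<Rightarrow> 'a real_closure \<Rightarrow> 'a real_closure" is times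
  by (rule max_cone_union_mult)
lift_definition inverse_real_closure :: "'a real_closure \<Rightarrow> 'a real_closure" is inverse
  by (rule max_cone_union_inverse)
lift_definition divide_real_closure :: "'a real_closure \<Rightarrow> 'a real_closure \<Rightarrow> 'a real_closure" is divide
  unfolding divide_inverse by (intro max_cone_union_mult max_cone_union_inverse)
instance
proof
  fix a b c :: "'a real_closure"
  show "a + b + c = a + (b + c)" by transfer (simp add: algebra_simps)
  show "a + b = b + a" by transfer (simp add: algebra_simps)
  show "0 + a = a" by transfer simp
  show "- a + a = 0" by transfer simp
  show "a - b = a + - b" by transfer simp
  show "a * b * c = a * (b * c)" by transfer (simp add: algebra_simps)
  show "a * b = b * a" by transfer (simp add: algebra_simps)
  show "1 * a = a" by transfer simp
  show "(a + b) * c = a * c + b * c" by transfer (simp add: algebra_simps)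
  show "(0::'a real_closure) \<noteq> 1" by transfer simp
  show "a \<noteq> 0 \<Longrightarrow> inverse a * a = 1" by transfer simp
  show "divide a b = a * inverse b" by transfer (simp add: divide_inverse)
  show "inverse (0::'a real_closure) = 0" by transfer simp
qed

end

instantiation real_closure :: (linordered_field) linordered_field
begin

lift_definition less_eq_real_closure :: "'a real_closure \<Rightarrow> 'a real_closure \<Rightarrow> bool" is "\<lambda>x y. y - x \<in> max_cone" .
definition less_real_closure :: "'a real_closure \<Rightarrow> 'a real_closure \<Rightarrow> bool" where
  "less_real_closure x y \<longleftrightarrow> x \<le> y \<and> x \<noteq> y"
definition abs_real_closure :: "'a real_closure \<Rightarrow> 'a real_closure" where
  "abs_real_closure x = (if x < 0 then - x else x)"
definition sgn_real_closure :: "'a real_closure \<Rightarrow> 'a real_closure" where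
  "sgn_real_closure x = (if x = 0 then 0 else if 0 < x then 1 else - 1)"

instance
proof
  fix a b c :: "'a real_closure"
  show refl: "a \<le> a" by transfer (simp add: max_coneD(2))
  show trans: "a \<le> b \<Longrightarrow> b \<le> c \<Longrightarrow> a \<le> c" 
  proof transfer
    fix x y z :: "'a alg_closure"
    assume "y - x \<in> max_cone" "z - y \<in> max_cone"
    then show "z - x \<in> max_cone" using max_coneD(4)[of "z - y" "y - x"] by simp
  qed
  show antisym: "a \<le> b \<Longrightarrow> b \<le> a \<Longrightarrow> a = b"
  proof transfer
    fix x y :: "'a alg_closure"
    assume "y - x \<in> max_cone" "x - y \<in> max_cone"
    then show "x = y" using max_coneD(8)[of "y - x"] by simp
  qed
  show "(a < b) = (a \<le> b \<and> \<not> b \<le> a)" unfolding less_real_closure_def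
    using refl antisym by blast
  show "a \<le> b \<or> b \<le> a"
  proof transfer
    fix x y :: "'a alg_closure"
    assume "x \<in> max_cone \<or> - x \<in> max_cone" "y \<in> max_cone \<or> - y \<in> max_cone"
    then show "y - x \<in> max_cone \<or> x - y \<in> max_cone" using max_cone_union_add[of y "- x"] by auto
  qed
  show add: "a \<le> b \<Longrightarrow> c + a \<le> c + b" by transfer (simp add: algebra_simps)
  show "\<bar>a\<bar> = (if a < 0 then - a else a)" by (rule abs_real_closure_def)
  show "sgn a = (if a = 0 then 0 else if 0 < a then 1 else - 1)" by (rule sgn_real_closure_def)
  assume ab: "a < b" and c: "0 < c"
  have "c * a \<le> c * b" using ab c unfolding less_real_closure_def
  proof (transfer)
    fix x y z :: "'a alg_closure"
    assume "y - x \<in> max_cone \<and> x \<noteq> y" "z - 0 \<in> max_cone \<and> 0 \<noteq> z"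
    then show "z * y - z * x \<in> max_cone" using max_coneD(5)[of z "y - x"] by (simp add: algebra_simps)
  qed
  moreover have "c * a \<noteq> c * b" using ab c unfolding less_real_closure_def by transfer simp
  ultimately show "c * a < c * b" unfolding less_real_closure_def by simp
qed

end

section \<open>The embedding of the base field, and real closedness of the closure\<close>

lift_definition to_rc :: "'a::linordered_field \<Rightarrow> 'a real_closure" is to_ac
  using max_coneD(1) by (metis linear neg_0_le_iff_le to_ac_minus)

lemma to_rc_hom:
  "to_rc (x + y) = to_rc x + to_rc y" "to_rc (x * y) = to_rc x * to_rc y" "to_rc 1 = 1"
  by (transfer, simp)+

lemma to_rc_nonneg_iff: "0 \<le> to_rc x \<longleftrightarrow> 0 \<le> x"
proof
  show *: "0 \<le> to_rc x" if "0 \<le> x" for x :: 'a using that by transfer (simp add: max_coneD(1))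
  assume h: "0 \<le> to_rc x"
  show "0 \<le> x"
  proof (rule ccontr)
    assume n: "\<not> 0 \<le> x"
    then have "0 \<le> to_rc (- x)" by (intro *) simp
    with h have "x = 0" by transfer (use max_coneD(8) in force)
    with n show False by simp
  qed
qed

abbreviation rc_poly :: "'a::linordered_field real_closure poly \<Rightarrow> 'a alg_closure poly" where
  "rc_poly \<equiv> map_poly Rep_real_closure"

lemma Rep_real_closure_hom:
  "Rep_real_closure 0 = 0" "Rep_real_closure 1 = 1" "Rep_real_closure (x + y) = Rep_real_closure x + Rep_real_closure y"
  "Rep_real_closure (x * y) = Rep_real_closure x * Rep_real_closure y" "Rep_real_closure (- x) = - Rep_real_closure x"
  by (simp_all add: zero_real_closure.rep_eq one_real_closure.rep_eq plus_real_closure.rep_eq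
      times_real_closure.rep_eq uminus_real_closure.rep_eq)

lemma rc_poly_hom:
  "poly (rc_poly (p + q)) z = poly (rc_poly p) z + poly (rc_poly q) z"
  "poly (rc_poly (p * q)) z = poly (rc_poly p) z * poly (rc_poly q) z"
  "poly (rc_poly (- p)) z = - poly (rc_poly p) z"
  "poly (rc_poly [:c:]) z = Rep_real_closure c"
proof -
  show add: "poly (rc_poly (p + q)) z = poly (rc_poly p) z + poly (rc_poly q) z" for p q
    by (induction p q rule: poly_induct2) (simp_all add: map_poly_pCons Rep_real_closure_hom algebra_simps)
  show "poly (rc_poly [:c:]) z = Rep_real_closure c" by (simp add: map_poly_pCons Rep_real_closure_hom)
  have smult: "poly (rc_poly (smult c q)) z = Rep_real_closure c * poly (rc_poly q) z" for c q
    by (induction q) (simp_all add: map_poly_pCons Rep_real_closure_hom algebra_simps)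
  show mult: "poly (rc_poly (p * q)) z = poly (rc_poly p) z * poly (rc_poly q) z" for p q
    by (induction p) (simp_all add: map_poly_pCons Rep_real_closure_hom add smult algebra_simps)
  show "poly (rc_poly (- p)) z = - poly (rc_poly p) z"
    by (induction p) (simp_all add: map_poly_pCons Rep_real_closure_hom algebra_simps)
qed

text \<open>If \<open>poly_ivt\<close> failed, a root of the offending polynomial in the algebraic closure would generate a
  larger ordered subfield.\<close>

instance real_closure :: (linordered_field) real_closed_field
proof (rule real_closed_fieldI)
  have "\<forall>(a::'a real_closure) b p. a < b \<longrightarrow> poly p a < 0 \<longrightarrow> 0 < poly p b \<longrightarrow> (\<exists>c. a < c \<and> c < b \<and> poly p c = 0)"
  proof (rule ccontr)
    assume "\<not> ?thesis"
    then obtain a b :: "'a real_closure" and p where "a < b" "poly p a < 0" "0 < poly p b"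
      "\<And>c. a < c \<Longrightarrow> c < b \<Longrightarrow> poly p c \<noteq> 0" by blast
    from ivt_failure_imp_prime_cone[OF this] obtain f :: "'a real_closure poly" and P where noroot: "\<And>c. poly f c \<noteq> 0" and P: "prime_cone P"
      and fP: "f \<in> P" "- f \<in> P" and cP: "\<And>c. 0 \<le> c \<Longrightarrow> [:c:] \<in> P"
      by metis
    note PD = prime_coneD[OF P]
    \<comment> \<open>The support of \<open>P\<close>: a prime ideal meeting the constants only in
      0. Since \<open>P\<close> need not come from an irreducible \<open>f\<close>, an element
      \<open>m\<close> of least degree in \<open>N\<close> takes over, and \<beta> is a root of
      \<open>m\<close>.\<close>
    define N where "N = {p. p \<in> P \<and> - p \<in> P}"
    have N_add: "p \<in> N \<Longrightarrow> q \<in> N \<Longrightarrow> p + q \<in> N" for p q unfolding N_def using PD(1)[of p q] PD(1)[of "- p" "- q"] by auto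
    have N_mult: "p \<in> N \<Longrightarrow> p * q \<in> N" for p q unfolding N_def using prime_cone_support_mult[OF P] by auto
    have N_minus: "p \<in> N \<Longrightarrow> - p \<in> N" for p unfolding N_def by auto
    have N_prime: "p * q \<in> N \<Longrightarrow> p \<in> N \<or> q \<in> N" for p q unfolding N_def using PD(8) by auto
    have N_const: "c = 0" if "[:c:] \<in> N" for c
    proof (rule ccontr)
      assume "c \<noteq> 0"
      then have "1 \<in> N" using N_mult[OF that, of "[:inverse c:]"] by (simp add: one_pCons)
      then show False unfolding N_def using PD(6) by simp
    qed
    have f: "f \<in> N" "f \<noteq> 0" using fP noroot[of 0] unfolding N_def by auto
    obtain m where m: "m \<in> N" "m \<noteq> 0" and mmin: "\<And>p. p \<in> N \<Longrightarrow> p \<noteq> 0 \<Longrightarrow> degree m \<le> degree p"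
      using exists_least_iff[of "\<lambda>n. \<exists>m. m \<in> N \<and> m \<noteq> 0 \<and> degree m = n"] f by (metis not_le)
    have "degree m \<noteq> 0"
    proof
      assume "degree m = 0"
      then obtain c where "m = [:c:]" by (rule degree_eq_zeroE)
      then show False using m N_const by auto
    qed
    then have "degree (rc_poly m) > 0"
      by (subst map_poly_degree_eq) (use m in \<open>auto simp: Rep_real_closure_inject[of _ 0, unfolded Rep_real_closure_hom]\<close>)
    then obtain \<beta> where \<beta>: "poly (rc_poly m) \<beta> = 0" using alg_closed_imp_poly_has_root by blast
    have m_dvd: "m dvd p" if "p \<in> N" for p
    proof -
      have "p mod m = p + - (m * (p div m))" by (metis minus_mult_div_eq_mod uminus_add_conv_diff add.commute)
      then have "p mod m \<in> N" using that m(1) N_add N_minus N_mult by metis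
      then show ?thesis using mmin[of "p mod m"] degree_mod_less[OF m(2), of p] by (metis dvd_eq_mod_eq_0 not_le)
    qed
    \<comment> \<open>Evaluation at \<beta> has kernel exactly \<open>N\<close>, so the cone on
      polynomials descends to the field generated by \<beta>. The inclusion of the kernel in
      \<open>N\<close> is a Euclidean descent.\<close>
    have ker: "poly (rc_poly p) \<beta> = 0 \<longleftrightarrow> p \<in> N" for p
    proof
      assume "p \<in> N"
      then obtain k where "p = m * k" using m_dvd by (blast elim: dvdE)
      then show "poly (rc_poly p) \<beta> = 0" using \<beta> by (simp add: rc_poly_hom)
    next
      assume "poly (rc_poly p) \<beta> = 0"
      then show "p \<in> N"
      proof (induction "degree p" arbitrary: p rule: less_induct)
        case less
        show ?case
        proof (cases "p = 0")
          case True
          then show ?thesis unfolding N_def using PD(4) by simp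
        next
          case p0: False
          have md: "a = b * (a div b) + a mod b" for a b :: "'a real_closure poly" by simp
          have c0: "degree p \<noteq> 0"
          proof
            assume "degree p = 0"
            then obtain c where "p = [:c:]" by (rule degree_eq_zeroE)
            then show False using less(2) p0 by (simp add: rc_poly_hom Rep_real_closure_inject[of _ 0, unfolded Rep_real_closure_hom])
          qed
          show ?thesis
          proof (cases "degree m \<le> degree p")
            case True
            have "poly (rc_poly (p mod m)) \<beta> = 0"
              using less(2) md[of p m] \<beta> by (metis add_0 mult_zero_left rc_poly_hom(1,2))
            moreover have "p mod m = 0 \<or> degree (p mod m) < degree p" using degree_mod_less[OF m(2), of p] True by linarith
            ultimately have "p mod m \<in> N" using less(1) PD(4) unfolding N_def by fastforce
            then show ?thesis using md[of p m] N_add N_mult[OF m(1)] by metis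
          next
            \<comment> \<open>Now \<open>p\<close> has smaller degree than \<open>m\<close>. The
              remainder of \<open>m\<close> modulo \<open>p\<close> is in \<open>N\<close> by
              induction, so \<open>N\<close> contains the product of \<open>p\<close> and
              \<open>m div p\<close>; by primeness it contains one of them, and
              \<open>m div p\<close> is excluded by the minimality of \<open>m\<close>.\<close>
            case False
            have "poly (rc_poly (m mod p)) \<beta> = 0"
              using less(2) md[of m p] \<beta> by (metis add_0 mult_zero_left rc_poly_hom(1,2))
            moreover have "m mod p = 0 \<or> degree (m mod p) < degree p" using degree_mod_less[OF p0, of m] by linarith
            ultimately have "m mod p \<in> N" using less(1) PD(4) unfolding N_def by fastforce
            then have "m + - (m mod p) \<in> N" using m(1) N_add N_minus by blast
            moreover have "m + - (m mod p) = p * (m div p)" using md[of m p] by (metis add_diff_cancel_right' uminus_add_conv_diff add.commute)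
            ultimately consider "p \<in> N" | "m div p \<in> N" using N_prime by metis
            then show ?thesis
            proof cases
              case 2
              have "m div p \<noteq> 0" using False degree_mod_less[OF p0, of m] md[of m p] m(2) by (metis add_0 mult_zero_right not_le less_imp_le)
              then have "degree m \<le> degree (m div p)" using mmin 2 by blast
              moreover have "degree p + degree (m div p) \<le> degree m"
              proof -
                have "degree (m mod p) \<le> degree m" using degree_mod_less[OF p0, of m] False by force
                then have "degree (m - m mod p) \<le> degree m" by (intro degree_diff_le) auto
                moreover have "m - m mod p = p * (m div p)" using md[of m p] by (metis add_diff_cancel_right')
                ultimately show ?thesis using p0 \<open>m div p \<noteq> 0\<close> by (simp add: degree_mult_eq)
              qed
              ultimately show ?thesis using c0 False by simp
            qed
          qed
        qed
      qed
    qed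
    let ?e = "\<lambda>p. poly (rc_poly p) \<beta>"
    \<comment> \<open>The cone induced by \<open>P\<close> on the field generated by \<beta>; taking
      fractions makes closure under inverses immediate.\<close>
    define D where "D = {?e p / ?e q | p q. p \<in> P \<and> q \<in> P \<and> ?e q \<noteq> 0}"
    have ne: "?e (q * q') \<noteq> 0" if "?e q \<noteq> 0" "?e q' \<noteq> 0" for q q' using that by (simp add: rc_poly_hom)
    have D_const: "Rep_real_closure c \<in> D" if "0 \<le> c" for c
    proof -
      have "Rep_real_closure c = ?e [:c:] / ?e 1" by (simp add: rc_poly_hom Rep_real_closure_hom one_pCons)
      moreover have "?e 1 \<noteq> 0" by (simp add: rc_poly_hom Rep_real_closure_hom one_pCons)
      ultimately show ?thesis unfolding D_def using cP[OF that] PD(5) by blast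
    qed
    have "field_cone D" unfolding field_cone_def
    proof (intro conjI ballI allI impI)
      fix x :: 'a assume "0 \<le> x"
      then have "Rep_real_closure (to_rc x) \<in> D" by (intro D_const) (simp add: to_rc_nonneg_iff)
      then show "to_ac x \<in> D" by (simp add: to_rc.rep_eq)
    next
      fix x y assume "x \<in> D" "y \<in> D"
      then obtain p q p' q' where x: "x = ?e p / ?e q" "p \<in> P" "q \<in> P" "?e q \<noteq> 0"
        and y: "y = ?e p' / ?e q'" "p' \<in> P" "q' \<in> P" "?e q' \<noteq> 0" unfolding D_def by blast
      have "x + y = ?e (p * q' + p' * q) / ?e (q * q')"
        unfolding x(1) y(1) rc_poly_hom using x(4) y(4) by (simp add: add_frac_eq)
      moreover have "p * q' + p' * q \<in> P" "q * q' \<in> P" using x y PD(1,2) by auto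
      ultimately show "x + y \<in> D" unfolding D_def using ne[OF x(4) y(4)] by blast
      have "x * y = ?e (p * p') / ?e (q * q')" unfolding x(1) y(1) rc_poly_hom by simp
      moreover have "p * p' \<in> P" "q * q' \<in> P" using x y PD(1,2) by auto
      ultimately show "x * y \<in> D" unfolding D_def using ne[OF x(4) y(4)] by blast
      have "x - y = ?e (p * q' + - (p' * q)) / ?e (q * q')" "y - x = ?e (- (p * q' + - (p' * q))) / ?e (q * q')"
        unfolding x(1) y(1) rc_poly_hom using x(4) y(4) by (simp_all add: diff_frac_eq mult.commute)
      then show "x - y \<in> D \<or> y - x \<in> D" unfolding D_def
        using ne[OF x(4) y(4)] PD(7)[of "p * q' + - (p' * q)"] \<open>q * q' \<in> P\<close> by blast
    next
      fix x assume "x \<in> D"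
      then obtain p q where x: "x = ?e p / ?e q" "p \<in> P" "q \<in> P" "?e q \<noteq> 0" unfolding D_def by blast
      show "inverse x \<in> D"
      proof (cases "?e p = 0")
        case True
        then show ?thesis using \<open>x \<in> D\<close> x(1) by simp
      next
        case False
        have "inverse x = ?e q / ?e p" unfolding x(1) by simp
        then show ?thesis unfolding D_def using x False by blast
      qed
      assume "- x \<in> D"
      then obtain p' q' where y: "- x = ?e p' / ?e q'" "p' \<in> P" "q' \<in> P" "?e q' \<noteq> 0" unfolding D_def by blast
      have "?e p / ?e q = - (?e p' / ?e q')" using x(1) y(1) by (metis minus_minus)
      then have "?e p * ?e q' + ?e p' * ?e q = 0" using x(4) y(4) by (simp add: field_simps)
      then have "p * q' + p' * q \<in> N" unfolding ker[symmetric] rc_poly_hom .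
      then have "- (p * q') = - (p * q' + p' * q) + p' * q \<and> - (p * q' + p' * q) \<in> P" unfolding N_def by simp
      then have "- (p * q') \<in> P" using PD(1) PD(2)[OF y(2) x(3)] by metis
      then have "p * q' \<in> N" unfolding N_def using PD(2) x y by simp
      then have "p \<in> N" using N_prime ker y(4) by blast
      then show "x = 0" using x ker by simp
    qed
    moreover have "max_cone \<subseteq> D"
    proof
      fix x :: "'a alg_closure" assume x: "x \<in> max_cone"
      then have r: "Rep_real_closure (Abs_real_closure x) = x" by (simp add: Abs_real_closure_inverse)
      then have "0 \<le> Abs_real_closure x" unfolding less_eq_real_closure.rep_eq using x by (simp add: Rep_real_closure_hom)
      then show "x \<in> D" using D_const r by metis
    qed
    ultimately have D: "D = max_cone" by (rule max_cone_maximal)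
    \<comment> \<open>By totality of \<open>P\<close> the indeterminate or its negative lies in
      \<open>P\<close>, so \<beta> belongs to the closure already, where \<open>f\<close> was shown
      to have no root.\<close>
    have "?e [:0, 1:] = \<beta>" by (simp add: map_poly_pCons Rep_real_closure_hom)
    moreover have "?e 1 = 1" by (simp add: rc_poly_hom Rep_real_closure_hom one_pCons)
    moreover have "?e (- [:0, 1:]) = - ?e [:0, 1:]" by (rule rc_poly_hom)
    ultimately have "\<beta> = ?e [:0, 1:] / ?e 1" "- \<beta> = ?e (- [:0, 1:]) / ?e 1" "?e 1 \<noteq> 0" by simp_all
    then have "\<beta> \<in> D \<or> - \<beta> \<in> D" unfolding D_def using PD(7)[of "[:0, 1:]"] PD(5) by blast
    then have r: "Rep_real_closure (Abs_real_closure \<beta>) = \<beta>" unfolding D by (simp add: Abs_real_closure_inverse)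
    have pr: "poly (rc_poly p) (Rep_real_closure c) = Rep_real_closure (poly p c)" for p c
      by (induction p) (simp_all add: map_poly_pCons Rep_real_closure_hom)
    have "?e f = 0" using ker f by blast
    then have "poly f (Abs_real_closure \<beta>) = 0"
      using pr[of f "Abs_real_closure \<beta>"] r by (simp add: Rep_real_closure_inject[of _ 0, unfolded Rep_real_closure_hom])
    then show False using noroot by blast
  qed
  then show "a < b \<Longrightarrow> poly p a < 0 \<Longrightarrow> 0 < poly p b \<Longrightarrow> \<exists>c>a. c < b \<and> poly p c = 0" for a b :: "'a real_closure" and p
    by blast
qed

subsection \<open>Polynomials over real closed fields\<close>

text \<open>The values are integers so that signs taken in two different fields can be
  equated.\<close>

definition sg :: "'a::linordered_idom \<Rightarrow> int" where
  "sg x = (if 0 < x then 1 else if x < 0 then - 1 else 0)"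

lemma sg_simps [simp]: "sg 0 = 0" "sg 1 = 1" "sg (- x) = - sg x" "sg x = 0 \<longleftrightarrow> x = 0" "sg x = 1 \<longleftrightarrow> 0 < x"
  "sg x = - 1 \<longleftrightarrow> x < 0"
  by (auto simp: sg_def)

lemma sg_mult: "sg (x * y) = sg x * sg y"
  by (auto simp: sg_def zero_less_mult_iff mult_less_0_iff)

lemma sg_power: "sg (x ^ n) = sg x ^ n"
  by (induction n) (simp_all add: sg_mult)

lemma sg_cases: "sg x = 1 \<or> sg x = 0 \<or> sg x = - 1"
  by (auto simp: sg_def)

lemma poly_ivt_mult:
  fixes p :: "'a::real_closed_field poly"
  assumes "x < y" "poly p x * poly p y < 0"
  obtains c where "x < c" "c < y" "poly p c = 0"
proof (cases "poly p x < 0")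
  case True
  then show ?thesis using poly_ivt[of x y p] assms that by (auto simp: mult_less_0_iff)
next
  case False
  then show ?thesis using poly_ivt[of x y "- p"] assms that by (auto simp: mult_less_0_iff)
qed

lemma sg_poly_eqI:
  fixes p :: "'a::real_closed_field poly"
  assumes "\<And>c. min x y \<le> c \<Longrightarrow> c \<le> max x y \<Longrightarrow> poly p c \<noteq> 0"
  shows "sg (poly p x) = sg (poly p y)"
proof (rule ccontr)
  assume n: "sg (poly p x) \<noteq> sg (poly p y)"
  have nz: "poly p x \<noteq> 0" "poly p y \<noteq> 0" using assms[of x] assms[of y] by auto
  then have neg: "poly p x * poly p y < 0" using n by (auto simp: sg_def mult_less_0_iff split: if_splits)
  then consider "x < y" | "y < x" using nz by (metis linorder_neqE mult_less_0_iff order_less_asym)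
  then show False
  proof cases
    case 1
    then obtain c where "x < c" "c < y" "poly p c = 0" using poly_ivt_mult neg by blast
    then show False using assms[of c] by simp
  next
    case 2
    then obtain c where "y < c" "c < x" "poly p c = 0" using poly_ivt_mult neg by (metis mult.commute)
    then show False using assms[of c] by simp
  qed
qed

text \<open>Without completeness there is no maximum to look at. With \<open>e\<close> the first
  root after \<open>a\<close>, write p = (X - a)^(m+1) (X - e)^(n+1) q, where q keeps its sign on
  [a, e]. The derivative is (X - a)^m (X - e)^n r, and r has opposite signs at \<open>a\<close> and
  \<open>e\<close>.\<close>

lemma poly_rolle:
  fixes p :: "'a::real_closed_field poly"
  assumes ab: "a < b" and pab: "poly p a = 0" "poly p b = 0"
  shows "\<exists>c. a < c \<and> c < b \<and> poly (pderiv p) c = 0"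
proof (cases "p = 0")
  case True
  then show ?thesis using dense[OF ab] by auto
next
  case p0: False
  define S where "S = {x. a < x \<and> x \<le> b \<and> poly p x = 0}"
  have S: "finite S" "b \<in> S" unfolding S_def using poly_roots_finite[OF p0] ab pab by (auto elim: finite_subset[rotated])
  define e where "e = Min S"
  have "e \<in> S" unfolding e_def using S Min_in by blast
  then have e: "a < e" "e \<le> b" "poly p e = 0" unfolding S_def by auto
  have between: "poly p c \<noteq> 0" if "a < c" "c < e" for c
  proof
    assume "poly p c = 0"
    then have "c \<in> S" unfolding S_def using that e by auto
    then have "e \<le> c" unfolding e_def using S by simp
    then show False using that by simp
  qed
  obtain q1 where q1: "p = [:- a, 1:] ^ order a p * q1" "\<not> [:- a, 1:] dvd q1" using order_decomp[OF p0] by blast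
  have "order a p \<noteq> 0" using pab p0 order_root by blast
  then obtain m where m: "order a p = Suc m" by (metis not0_implies_Suc)
  have q10: "q1 \<noteq> 0" using q1(2) by auto
  obtain q where q: "q1 = [:- e, 1:] ^ order e q1 * q" "\<not> [:- e, 1:] dvd q" using order_decomp[OF q10] by blast
  have "poly q1 e = 0" 
  proof -
    have "poly p e = (e - a) ^ order a p * poly q1 e" by (subst q1(1)) simp
    then show ?thesis using e by simp
  qed
  then have "order e q1 \<noteq> 0" using q10 order_root by blast
  then obtain n where n: "order e q1 = Suc n" by (metis not0_implies_Suc)
  define A where "A = [:- a, 1:]"
  define B where "B = [:- e, 1:]"
  have p: "p = A ^ Suc m * (B ^ Suc n * q)" using q1(1) q(1) unfolding m n A_def B_def by simp
  have qe: "poly q e \<noteq> 0" using q(2) poly_eq_0_iff_dvd by blast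
  have qa: "poly q a \<noteq> 0"
  proof
    assume "poly q a = 0"
    then have "poly q1 a = 0" using q(1) by (metis mult_zero_right poly_mult)
    then show False using q1(2) poly_eq_0_iff_dvd by blast
  qed
  have "sg (poly q a) = sg (poly q e)"
  proof (rule sg_poly_eqI)
    fix c assume "min a e \<le> c" "c \<le> max a e"
    then consider "c = a" | "c = e" | "a < c" "c < e" using e by fastforce
    then show "poly q c \<noteq> 0" using qa qe between[of c] p by cases auto
  qed
  then have pos: "0 < poly q a * poly q e" using qa qe by (auto simp: sg_def zero_less_mult_iff split: if_splits)
  define r where "r = smult (of_nat (Suc m)) (B * q) + smult (of_nat (Suc n)) (A * q) + A * B * pderiv q"
  have dA: "pderiv A = 1" "pderiv B = 1" unfolding A_def B_def by (simp_all add: pderiv_pCons one_pCons)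
  have dp: "pderiv p = A ^ m * B ^ n * r"
    unfolding p r_def pderiv_mult pderiv_power_Suc dA by (simp add: algebra_simps)
  have ra: "poly r a = of_nat (Suc m) * (a - e) * poly q a" unfolding r_def A_def B_def by (simp add: algebra_simps)
  have re: "poly r e = of_nat (Suc n) * (e - a) * poly q e" unfolding r_def A_def B_def by (simp add: algebra_simps)
  have "poly r a * poly r e = - ((of_nat (Suc m) * of_nat (Suc n)) * ((e - a) * (e - a)) * (poly q a * poly q e))"
    unfolding ra re by (simp add: algebra_simps)
  moreover have "0 < (of_nat (Suc m) * of_nat (Suc n)) * ((e - a) * (e - a)) * (poly q a * poly q e)"
    by (intro mult_pos_pos pos) (use e(1) in \<open>auto simp del: of_nat_Suc\<close>)
  ultimately have "poly r a * poly r e < 0" by simp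
  then obtain c where "a < c" "c < e" "poly r c = 0" using poly_ivt_mult e(1) by blast
  then show ?thesis using e(2) by (intro exI[of _ c]) (auto simp: dp)
qed

lemma poly_mvt:
  fixes p :: "'a::real_closed_field poly"
  assumes ab: "a < b"
  obtains c where "a < c" "c < b" "poly p b - poly p a = (b - a) * poly (pderiv p) c"
proof -
  define k where "k = (poly p b - poly p a) / (b - a)"
  define h where "h = p - [:poly p a - k * a, k:]"
  have "k * (b - a) = poly p b - poly p a" unfolding k_def using ab by simp
  then have "poly h a = 0" "poly h b = 0" unfolding h_def by (simp_all add: algebra_simps)
  then obtain c where c: "a < c" "c < b" "poly (pderiv h) c = 0" using poly_rolle[OF ab] by blast
  have "poly (pderiv p) c = k" using c(3) unfolding h_def by (simp add: pderiv_diff pderiv_pCons)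
  then show ?thesis using that[OF c(1,2)] ab unfolding k_def by simp
qed

lemma poly_unbounded_at_top:
  fixes p :: "'a::linordered_field poly"
  shows "0 < degree p \<Longrightarrow> 0 < lead_coeff p \<Longrightarrow> \<exists>B. \<forall>x\<ge>B. M \<le> poly p x"
proof (induction p arbitrary: M)
  case 0
  then show ?case by simp
next
  case (pCons c p)
  have p0: "p \<noteq> 0" using pCons(3) by auto
  show ?case
  proof (cases "degree p = 0")
    case True
    then obtain d where d: "p = [:d:]" by (rule degree_eq_zeroE)
    then have d0: "0 < d" using pCons(4) p0 by simp
    show ?thesis
    proof (intro exI[of _ "(M - c) / d"] allI impI)
      fix x assume "(M - c) / d \<le> x"
      then show "M \<le> poly (pCons c p) x" unfolding d using d0 by (simp add: field_simps)
    qed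
  next
    case False
    then obtain B where B: "\<forall>x\<ge>B. \<bar>M\<bar> + \<bar>c\<bar> \<le> poly p x" using pCons(2)[of "\<bar>M\<bar> + \<bar>c\<bar>"] pCons(4) p0 by auto
    show ?thesis
    proof (intro exI[of _ "max B 1"] allI impI)
      fix x assume "max B 1 \<le> x"
      then have x: "1 \<le> x" "\<bar>M\<bar> + \<bar>c\<bar> \<le> poly p x" using B by auto
      have "0 \<le> \<bar>M\<bar> + \<bar>c\<bar>" by simp
      then have "1 * (\<bar>M\<bar> + \<bar>c\<bar>) \<le> x * poly p x" using x by (intro mult_mono) auto
      moreover have "M \<le> \<bar>M\<bar>" "- c \<le> \<bar>c\<bar>" by (rule abs_ge_self, rule abs_ge_minus_self)
      ultimately show "M \<le> poly (pCons c p) x" by simp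
    qed
  qed
qed

lemma sg_poly_at_top:
  fixes p :: "'a::linordered_field poly"
  shows "\<exists>B. \<forall>x\<ge>B. sg (poly p x) = sg (lead_coeff p)"
proof (cases "degree p = 0")
  case True
  then obtain d where "p = [:d:]" by (rule degree_eq_zeroE)
  then show ?thesis by simp
next
  case False
  then consider "0 < lead_coeff p" | "0 < lead_coeff (- p)" by (metis degree_0 lead_coeff_minus leading_coeff_0_iff linorder_neqE neg_0_less_iff_less)
  then show ?thesis
  proof cases
    case 1
    then obtain B where "\<forall>x\<ge>B. 1 \<le> poly p x" using poly_unbounded_at_top[of p 1] False by auto
    then have "\<forall>x\<ge>B. sg (poly p x) = 1" by force
    then show ?thesis using 1 by (metis sg_simps(5))
  next
    case 2
    then obtain B where B: "\<forall>x\<ge>B. 1 \<le> poly (- p) x" using poly_unbounded_at_top[of "- p" 1] False by auto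
    have "\<forall>x\<ge>B. sg (poly p x) = - 1"
    proof (intro allI impI)
      fix x assume "B \<le> x"
      then have "1 \<le> - poly p x" using B by simp
      then show "sg (poly p x) = - 1" by simp
    qed
    then show ?thesis using 2 by (metis lead_coeff_minus neg_0_less_iff_less sg_simps(6))
  qed
qed

lemma sg_poly_at_bot:
  fixes p :: "'a::linordered_field poly"
  shows "\<exists>B. \<forall>x\<le>B. sg (poly p x) = (- 1) ^ degree p * sg (lead_coeff p)"
proof -
  define q where "q = pcompose p [:0, - 1:]"
  have lc: "lead_coeff q = lead_coeff p * (- 1) ^ degree p" unfolding q_def by (subst lead_coeff_comp) auto
  obtain B where B: "\<forall>x\<ge>B. sg (poly q x) = sg (lead_coeff q)" using sg_poly_at_top by blast
  have "sg (poly p x) = (- 1) ^ degree p * sg (lead_coeff p)" if "x \<le> - B" for x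
  proof -
    have "sg (poly q (- x)) = sg (lead_coeff q)" using B that by simp
    moreover have "poly q (- x) = poly p x" unfolding q_def by (simp add: poly_pcompose)
    ultimately show ?thesis unfolding lc sg_mult sg_power by simp
  qed
  then show ?thesis by blast
qed

lemma between_finite_sets:
  fixes A B :: "'a::linordered_field set"
  assumes "finite A" "finite B" "\<And>a b. a \<in> A \<Longrightarrow> b \<in> B \<Longrightarrow> a < b"
  shows "\<exists>m. (\<forall>a\<in>A. a < m) \<and> (\<forall>b\<in>B. m < b)"
proof (cases "A = {}"; cases "B = {}")
  assume "A \<noteq> {}" "B \<noteq> {}"
  then have "Max A < Min B" using assms by simp
  then obtain m where "Max A < m" "m < Min B" using dense by blast
  then show ?thesis using assms(1,2) \<open>A \<noteq> {}\<close> \<open>B \<noteq> {}\<close> by (intro exI[of _ m]) auto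
next
  assume "A \<noteq> {}" "B = {}"
  then have "\<forall>a\<in>A. a < Max A + 1" using assms by (metis Max_ge less_add_one order_le_less_trans)
  then show ?thesis using \<open>B = {}\<close> by blast
next
  assume "A = {}" "B \<noteq> {}"
  then have "\<forall>b\<in>B. Min B - 1 < b" using assms by (metis Min_le diff_less_eq less_add_one order_le_less_trans)
  then show ?thesis using \<open>A = {}\<close> by blast
qed blast

text \<open>On a stretch where the derivative has no zero, its sign at a single point, possibly an
  end point, tells whether \<open>p\<close> rises or falls.\<close>

lemma sg_poly_diff:
  fixes p :: "'a::real_closed_field poly"
  assumes xy: "x < y" and m: "x \<le> m" "m \<le> y" and nz: "\<And>c. x < c \<Longrightarrow> c < y \<Longrightarrow> poly (pderiv p) c \<noteq> 0"
    "poly (pderiv p) m \<noteq> 0"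
  shows "sg (poly p y - poly p x) = sg (poly (pderiv p) m)"
proof -
  obtain c where c: "x < c" "c < y" "poly p y - poly p x = (y - x) * poly (pderiv p) c" using poly_mvt[OF xy] by blast
  have "sg (poly (pderiv p) c) = sg (poly (pderiv p) m)"
  proof (rule sg_poly_eqI)
    fix e assume e: "min c m \<le> e" "e \<le> max c m"
    show "poly (pderiv p) e \<noteq> 0"
    proof (cases "e = m")
      case False
      then have "x < e \<and> e < y" using e c m by (auto simp: min_def max_def split: if_splits)
      then show ?thesis using nz by blast
    qed (use nz in simp)
  qed
  moreover have "sg (y - x) = 1" using xy by simp
  ultimately show ?thesis unfolding c(3) sg_mult by simp
qed

subsection \<open>Transfer of sign conditions between real closed fields\<close>

definition is_ring_hom :: "('a::comm_ring_1 \<Rightarrow> 'b::comm_ring_1) \<Rightarrow> bool" where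
  "is_ring_hom \<phi> \<longleftrightarrow> \<phi> 1 = 1 \<and> (\<forall>x y. \<phi> (x + y) = \<phi> x + \<phi> y) \<and> (\<forall>x y. \<phi> (x * y) = \<phi> x * \<phi> y)"

lemma is_ring_homD:
  assumes "is_ring_hom \<phi>"
  shows "\<phi> 1 = 1" "\<phi> (x + y) = \<phi> x + \<phi> y" "\<phi> (x * y) = \<phi> x * \<phi> y" "\<phi> 0 = 0" "\<phi> (- x) = - \<phi> x"
    "\<phi> (x - y) = \<phi> x - \<phi> y" "\<phi> (x ^ n) = \<phi> x ^ n" "\<phi> (of_nat n) = of_nat n"
proof -
  show 1: "\<phi> 1 = 1" and add: "\<phi> (x + y) = \<phi> x + \<phi> y" and mult: "\<phi> (x * y) = \<phi> x * \<phi> y" for x y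
    using assms unfolding is_ring_hom_def by simp_all
  show 0: "\<phi> 0 = 0" using add[of 0 0] by simp
  show minus: "\<phi> (- x) = - \<phi> x" for x using add[of x "- x"] 0 by (simp add: eq_neg_iff_add_eq_0 add.commute)
  show "\<phi> (x - y) = \<phi> x - \<phi> y" using add[of x "- y"] minus by simp
  show "\<phi> (x ^ n) = \<phi> x ^ n" by (induction n) (simp_all add: 1 mult)
  show "\<phi> (of_nat n) = of_nat n" by (induction n) (simp_all add: 0 1 add)
qed

lemma map_poly_ring_hom:
  assumes "is_ring_hom \<phi>"
  shows "map_poly \<phi> (p + q) = map_poly \<phi> p + map_poly \<phi> q" "map_poly \<phi> (p * q) = map_poly \<phi> p * map_poly \<phi> q"
    "map_poly \<phi> (smult c p) = smult (\<phi> c) (map_poly \<phi> p)"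
    "coeff (map_poly \<phi> p) i = \<phi> (coeff p i)"
proof -
  note h = is_ring_homD[OF assms]
  show co: "coeff (map_poly \<phi> p) i = \<phi> (coeff p i)" for p i by (simp add: coeff_map_poly h)
  show add: "map_poly \<phi> (p + q) = map_poly \<phi> p + map_poly \<phi> q" for p q by (intro poly_eqI) (simp add: co h)
  show sm: "map_poly \<phi> (smult c p) = smult (\<phi> c) (map_poly \<phi> p)" for c p by (intro poly_eqI) (simp add: co h)
  show "map_poly \<phi> (p * q) = map_poly \<phi> p * map_poly \<phi> q"
    by (induction p) (simp_all add: add sm map_poly_pCons h)
qed

text \<open>The derivative \<^const>\<open>pderiv\<close> is only available over rings without zero divisors.\<close>

definition formal_deriv :: "'a::comm_ring_1 poly \<Rightarrow> 'a poly" where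
  "formal_deriv p = (\<Sum>i<degree p. monom (of_nat (Suc i) * coeff p (Suc i)) i)"

lemma coeff_formal_deriv: "coeff (formal_deriv p) i = of_nat (Suc i) * coeff p (Suc i)"
proof -
  have "coeff (formal_deriv p) i = (\<Sum>j<degree p. if j = i then of_nat (Suc i) * coeff p (Suc i) else 0)"
    unfolding formal_deriv_def coeff_sum by (intro sum.cong) auto
  then show ?thesis by (auto simp: coeff_eq_0)
qed

lemma degree_formal_deriv: "0 < degree p \<Longrightarrow> degree (formal_deriv p) < degree p"
proof -
  assume d: "0 < degree p"
  have "degree (formal_deriv p) \<le> degree p - 1"
    by (rule degree_le) (use d in \<open>auto simp: coeff_formal_deriv coeff_eq_0\<close>)
  with d show ?thesis by linarith
qed

lemma map_formal_deriv:
  fixes \<phi> :: "'a::comm_ring_1 \<Rightarrow> 'b::idom"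
  shows "is_ring_hom \<phi> \<Longrightarrow> map_poly \<phi> (formal_deriv p) = pderiv (map_poly \<phi> p)"
  by (intro poly_eqI) (simp add: map_poly_ring_hom(4) is_ring_homD coeff_pderiv coeff_formal_deriv del: of_nat_Suc)

definition drop_lead :: "'a::comm_ring_1 poly \<Rightarrow> 'a poly" where
  "drop_lead p = p - monom (lead_coeff p) (degree p)"

lemma degree_drop_lead: "0 < degree p \<Longrightarrow> degree (drop_lead p) < degree p"
proof -
  assume d: "0 < degree p"
  have "coeff (drop_lead p) i = 0" if "degree p - 1 < i" for i
    using that d unfolding drop_lead_def by (cases "i = degree p") (auto simp: coeff_eq_0)
  then have "degree (drop_lead p) \<le> degree p - 1" by (intro degree_le) auto
  with d show ?thesis by linarith
qed

text \<open>The degree is measured before \<phi> is applied, so that a level \<open>d\<close>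
  selects the same members of \<open>F\<close> for both homomorphisms. Members mapped to 0 are left
  out to keep the set finite.\<close>

definition zeros :: "('a::comm_ring_1 \<Rightarrow> 'f::idom) \<Rightarrow> 'a poly set \<Rightarrow> nat \<Rightarrow> 'f set" where
  "zeros \<phi> F d = {x. \<exists>p\<in>F. degree p \<le> d \<and> map_poly \<phi> p \<noteq> 0 \<and> poly (map_poly \<phi> p) x = 0}"

text \<open>Two points in different ordered sets are compared only by their position among the
  paired points; coincidence with a paired point means that neither strict comparison holds.\<close>

definition same_cut :: "('f::linorder \<times> 'g::linorder) set \<Rightarrow> 'f \<Rightarrow> 'g \<Rightarrow> bool" where
  "same_cut M t u \<longleftrightarrow> (\<forall>(z, w)\<in>M. (z < t \<longleftrightarrow> w < u) \<and> (t < z \<longleftrightarrow> u < w))"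

definition agree :: "('a::comm_ring_1 \<Rightarrow> 'f::linordered_idom) \<Rightarrow> ('a \<Rightarrow> 'g::linordered_idom) \<Rightarrow> 'a poly set \<Rightarrow> nat \<Rightarrow> 'f \<Rightarrow> 'g \<Rightarrow> bool" where
  "agree \<phi> \<psi> F d t u \<longleftrightarrow> (\<forall>p\<in>F. degree p \<le> d \<longrightarrow> sg (poly (map_poly \<phi> p) t) = sg (poly (map_poly \<psi> p) u))"

text \<open>\<open>M\<close> is the graph of an order isomorphism between the zeros on both sides; the signs at any point are
  determined by its position relative to the zeros.\<close>

definition matching :: "('a::comm_ring_1 \<Rightarrow> 'f::linordered_idom) \<Rightarrow> ('a \<Rightarrow> 'g::linordered_idom) \<Rightarrow> 'a poly set \<Rightarrow> nat \<Rightarrow> ('f \<times> 'g) set \<Rightarrow> bool" where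
  "matching \<phi> \<psi> F d M \<longleftrightarrow> fst ` M = zeros \<phi> F d \<and> snd ` M = zeros \<psi> F d \<and> (\<forall>(z, w)\<in>M. same_cut M z w) \<and>
     (\<forall>t u. same_cut M t u \<longrightarrow> agree \<phi> \<psi> F d t u)"

lemma same_cut_converse: "same_cut (M\<inverse>) u t \<longleftrightarrow> same_cut M t u"
  unfolding same_cut_def by auto

lemma agree_swap: "agree \<psi> \<phi> F d u t \<longleftrightarrow> agree \<phi> \<psi> F d t u"
  unfolding agree_def by auto

lemma matching_converse: "matching \<phi> \<psi> F d M \<Longrightarrow> matching \<psi> \<phi> F d (M\<inverse>)"
proof -
  have "fst ` (M\<inverse>) = snd ` M" "snd ` (M\<inverse>) = fst ` M" by force+
  then show "matching \<phi> \<psi> F d M \<Longrightarrow> matching \<psi> \<phi> F d (M\<inverse>)"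
    unfolding matching_def by (auto simp: same_cut_converse agree_swap[of \<psi> \<phi>])
qed

lemma matchingD:
  assumes "matching \<phi> \<psi> F d M"
  shows "(z, w) \<in> M \<Longrightarrow> z \<in> zeros \<phi> F d" "(z, w) \<in> M \<Longrightarrow> w \<in> zeros \<psi> F d" "(z, w) \<in> M \<Longrightarrow> same_cut M z w"
    "same_cut M t u \<Longrightarrow> agree \<phi> \<psi> F d t u"
proof -
  have m: "fst ` M = zeros \<phi> F d" "snd ` M = zeros \<psi> F d" "\<forall>(z, w)\<in>M. same_cut M z w"
    "\<forall>t u. same_cut M t u \<longrightarrow> agree \<phi> \<psi> F d t u"
    using assms unfolding matching_def by simp_all
  show "(z, w) \<in> M \<Longrightarrow> z \<in> zeros \<phi> F d" using m(1) by force
  show "(z, w) \<in> M \<Longrightarrow> w \<in> zeros \<psi> F d" using m(2) by force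
  show "(z, w) \<in> M \<Longrightarrow> same_cut M z w" using m(3) by blast
  show "same_cut M t u \<Longrightarrow> agree \<phi> \<psi> F d t u" using m(4) by blast
qed

text \<open>The family may contain polynomials whose leading coefficients vanish under the homomorphisms; closure
  under \<^const>\<open>drop_lead\<close> takes care of them.\<close>

locale sign_family =
  fixes \<phi> :: "'a::comm_ring_1 \<Rightarrow> 'f::real_closed_field" and \<psi> :: "'a \<Rightarrow> 'g::real_closed_field" and F :: "'a poly set"
  assumes hom: "is_ring_hom \<phi>" "is_ring_hom \<psi>" and fin: "finite F"
    and F_deriv: "\<And>p. p \<in> F \<Longrightarrow> 0 < degree p \<Longrightarrow> formal_deriv p \<in> F"
    and F_drop: "\<And>p. p \<in> F \<Longrightarrow> 0 < degree p \<Longrightarrow> drop_lead p \<in> F"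
    and F_rem: "\<And>p q. p \<in> F \<Longrightarrow> q \<in> F \<Longrightarrow> 0 < degree q \<Longrightarrow> degree q \<le> degree p \<Longrightarrow>
      \<exists>r\<in>F. \<exists>k s. degree r < degree q \<and> smult (lead_coeff q ^ k) p = q * s + r"
    and sign: "\<And>p i. p \<in> F \<Longrightarrow> sg (\<phi> (coeff p i)) = sg (\<psi> (coeff p i))"
begin

abbreviation f where "f p x \<equiv> poly (map_poly \<phi> p) x"
abbreviation g where "g p x \<equiv> poly (map_poly \<psi> p) x"

lemma sign_family_swap: "sign_family \<psi> \<phi> F"
  by unfold_locales (use hom fin F_deriv F_drop F_rem sign in auto)

lemma lead_zero_iff: "p \<in> F \<Longrightarrow> \<phi> (lead_coeff p) = 0 \<longleftrightarrow> \<psi> (lead_coeff p) = 0"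
  using sign[of p "degree p"] by (metis sg_simps(4))

lemma finite_zeros: "finite (zeros \<phi> F d)"
proof -
  have "zeros \<phi> F d \<subseteq> (\<Union>p\<in>{p\<in>F. map_poly \<phi> p \<noteq> 0}. {x. f p x = 0})" unfolding zeros_def by blast
  moreover have "finite \<dots>" using fin poly_roots_finite by auto
  ultimately show ?thesis by (rule finite_subset)
qed

lemma degree_map:
  assumes "\<phi> (lead_coeff p) \<noteq> 0"
  shows "degree (map_poly \<phi> p) = degree p" "map_poly \<phi> p \<noteq> 0" "lead_coeff (map_poly \<phi> p) = \<phi> (lead_coeff p)"
proof -
  have c: "coeff (map_poly \<phi> p) (degree p) \<noteq> 0" using assms map_poly_ring_hom(4)[OF hom(1)] by simp
  show d: "degree (map_poly \<phi> p) = degree p" 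
  proof (rule antisym)
    show "degree (map_poly \<phi> p) \<le> degree p"
      by (rule degree_le) (simp add: map_poly_ring_hom(4)[OF hom(1)] is_ring_homD(4)[OF hom(1)] coeff_eq_0)
  qed (use c le_degree in blast)
  show "map_poly \<phi> p \<noteq> 0" using c by auto
  show "lead_coeff (map_poly \<phi> p) = \<phi> (lead_coeff p)" unfolding d map_poly_ring_hom(4)[OF hom(1)] ..
qed

lemma map_drop_lead:
  assumes "\<phi> (lead_coeff p) = 0"
  shows "map_poly \<phi> (drop_lead p) = map_poly \<phi> p"
  using assms by (intro poly_eqI)
    (auto simp: map_poly_ring_hom(4)[OF hom(1)] drop_lead_def is_ring_homD(4,6)[OF hom(1)])

text \<open>Leading coefficients vanish simultaneously under \<phi> and \<psi> because their signs
  agree, so dropping them changes neither image.\<close>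

lemma reduce_vanishing_lead:
  assumes "p \<in> F" "map_poly \<phi> p \<noteq> 0"
  shows "\<exists>q\<in>F. degree q \<le> degree p \<and> \<phi> (lead_coeff q) \<noteq> 0 \<and> map_poly \<phi> q = map_poly \<phi> p \<and> map_poly \<psi> q = map_poly \<psi> p"
  using assms
proof (induction "degree p" arbitrary: p rule: less_induct)
  case less
  interpret sw: sign_family \<psi> \<phi> F by (rule sign_family_swap)
  show ?case
  proof (cases "\<phi> (lead_coeff p) = 0")
    case False
    then show ?thesis using less by blast
  next
    case True
    have d: "0 < degree p"
    proof (rule ccontr)
      assume "\<not> ?thesis"
      then obtain c where "p = [:c:]" using degree_eq_zeroE by blast
      then show False using True less(3) by (simp add: map_poly_pCons is_ring_homD(4)[OF hom(1)])
    qed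
    have e: "map_poly \<phi> (drop_lead p) = map_poly \<phi> p" "map_poly \<psi> (drop_lead p) = map_poly \<psi> p"
      using map_drop_lead sw.map_drop_lead True lead_zero_iff[OF less(2)] by auto
    have "map_poly \<phi> (drop_lead p) \<noteq> 0" using less(3) e by simp
    from less(1)[OF degree_drop_lead[OF d] F_drop[OF less(2) d] this] obtain q
      where q: "q \<in> F" "degree q \<le> degree (drop_lead p)" "\<phi> (lead_coeff q) \<noteq> 0" "map_poly \<phi> q = map_poly \<phi> (drop_lead p)"
        "map_poly \<psi> q = map_poly \<psi> (drop_lead p)" by blast
    then show ?thesis using e degree_drop_lead[OF d] by (intro bexI[of _ q]) auto
  qed
qed

text \<open>At a common zero of \<open>q\<close>, pseudo-division lc(q)^k p = q s + r reduces the
  sign of \<open>p\<close> to the signs of lc(q) and of the remainder. The former is a coefficient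
  sign; the latter has degree at most \<open>d\<close>, where agreement is known.\<close>

lemma sign_at_zero:
  assumes agr: "agree \<phi> \<psi> F d t u" and p: "p \<in> F" "degree p = Suc d"
    and q: "q \<in> F" "\<phi> (lead_coeff q) \<noteq> 0" "degree q \<le> Suc d" "f q t = 0" "g q u = 0"
  shows "sg (f p t) = sg (g p u)"
proof -
  have dq: "0 < degree q"
  proof (rule ccontr)
    assume "\<not> ?thesis"
    then obtain c where "q = [:c:]" using degree_eq_zeroE by blast
    then show False using q by (simp add: map_poly_pCons is_ring_homD(4)[OF hom(1)])
  qed
  obtain r k s where r: "r \<in> F" "degree r < degree q" "smult (lead_coeff q ^ k) p = q * s + r"
    using F_rem[OF p(1) q(1) dq] q(3) p(2) by auto
  have ev: "\<phi>' (lead_coeff q) ^ k * poly (map_poly \<phi>' p) x = poly (map_poly \<phi>' q) x * poly (map_poly \<phi>' s) x + poly (map_poly \<phi>' r) x"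
    if "is_ring_hom \<phi>'" for \<phi>' :: "'a \<Rightarrow> 'h::comm_ring_1" and x
    using arg_cong[OF r(3), of "\<lambda>p. poly (map_poly \<phi>' p) x"]
    unfolding map_poly_ring_hom[OF that] is_ring_homD(7)[OF that] by simp
  have "sg (\<phi> (lead_coeff q)) ^ k * sg (f p t) = sg (f r t)"
    using ev[OF hom(1), of t] q(4) by (metis sg_mult sg_power mult_zero_left add_0)
  moreover have "sg (\<psi> (lead_coeff q)) ^ k * sg (g p u) = sg (g r u)"
    using ev[OF hom(2), of u] q(5) by (metis sg_mult sg_power mult_zero_left add_0)
  moreover have "sg (f r t) = sg (g r u)" using agr r(1,2) q(3) unfolding agree_def by auto
  moreover have "sg (\<phi> (lead_coeff q)) = sg (\<psi> (lead_coeff q))" using sign q(1) by blast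
  moreover have "sg (\<phi> (lead_coeff q)) ^ k \<noteq> 0" using q(2) by simp
  ultimately show ?thesis by (metis mult_left_cancel)
qed

lemma matching_partner:
  assumes "matching \<phi> \<psi> F d M"
  shows "z \<in> zeros \<phi> F d \<Longrightarrow> \<exists>w. (z, w) \<in> M \<and> w \<in> zeros \<psi> F d \<and> same_cut M z w"
proof -
  assume "z \<in> zeros \<phi> F d"
  then have "z \<in> fst ` M" using assms unfolding matching_def by simp
  then obtain w where "(z, w) \<in> M" by force
  then show ?thesis using matchingD(2,3)[OF assms] by blast
qed

lemma matching_zero:
  assumes "matching \<phi> \<psi> F d M" "same_cut M t u" "t \<in> zeros \<phi> F d"
  shows "u \<in> zeros \<psi> F d"
proof -
  obtain w where w: "(t, w) \<in> M" "w \<in> zeros \<psi> F d" using matching_partner[OF assms(1,3)] by blast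
  have "\<not> w < u \<and> \<not> u < w" using assms(2) w(1) unfolding same_cut_def by blast
  then have "w = u" by auto
  with w show ?thesis by simp
qed

text \<open>For \<open>t\<close> off the zeros, the partners of the zeros below and above
  \<open>t\<close> are two finite sets, one entirely below the other; an ordered field is dense and
  unbounded, so some point separates them.\<close>

lemma same_cut_exists:
  assumes M: "matching \<phi> \<psi> F d M"
  shows "\<exists>u. same_cut M t u"
proof (cases "t \<in> zeros \<phi> F d")
  case True
  then show ?thesis using matching_partner[OF M] by blast
next
  case False
  interpret sw: sign_family \<psi> \<phi> F by (rule sign_family_swap)
  define A where "A = {w. \<exists>z. (z, w) \<in> M \<and> z < t}"
  define B where "B = {w. \<exists>z. (z, w) \<in> M \<and> t < z}"
  have "A \<subseteq> zeros \<psi> F d" "B \<subseteq> zeros \<psi> F d" unfolding A_def B_def using matchingD(2)[OF M] by blast+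
  then have "finite A" "finite B" using sw.finite_zeros finite_subset by blast+
  moreover have "a < b" if a: "a \<in> A" and b: "b \<in> B" for a b
  proof -
    obtain z z' where z: "(z, a) \<in> M" "z < t" "(z', b) \<in> M" "t < z'" using a b unfolding A_def B_def by blast
    have "same_cut M z' b" using matchingD(3)[OF M z(3)] .
    then have "z < z' \<longleftrightarrow> a < b" using z(1) unfolding same_cut_def by blast
    then show ?thesis using z(2,4) by simp
  qed
  ultimately have "\<exists>u. (\<forall>a\<in>A. a < u) \<and> (\<forall>b\<in>B. u < b)" by (rule between_finite_sets)
  then obtain u where u: "\<And>a. a \<in> A \<Longrightarrow> a < u" "\<And>b. b \<in> B \<Longrightarrow> u < b" by blast
  have "same_cut M t u" unfolding same_cut_def
  proof (intro ballI, clarify)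
    fix z w assume zw: "(z, w) \<in> M"
    then have "z \<noteq> t" using False matchingD(1)[OF M] by blast
    then consider "z < t" | "t < z" by force
    then show "(z < t \<longleftrightarrow> w < u) \<and> (t < z \<longleftrightarrow> u < w)"
    proof cases
      case 1
      then have "w < u" using u(1) zw unfolding A_def by blast
      then show ?thesis using 1 by auto
    next
      case 2
      then have "u < w" using u(2) zw unfolding B_def by blast
      then show ?thesis using 2 by auto
    qed
  qed
  then show ?thesis ..
qed

section \<open>Sign tables: passing from degree \<open>d\<close> to degree
  \<open>Suc d\<close>\<close>

lemma zeros_mono: "d \<le> e \<Longrightarrow> zeros \<phi> F d \<subseteq> zeros \<phi> F e"
  unfolding zeros_def by (auto intro: order_trans)

lemma zero_witness:
  assumes "z \<in> zeros \<phi> F d"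
  obtains q where "q \<in> F" "degree q \<le> d" "\<phi> (lead_coeff q) \<noteq> 0" "f q z = 0"
proof -
  obtain p where p: "p \<in> F" "degree p \<le> d" "map_poly \<phi> p \<noteq> 0" "f p z = 0" using assms unfolding zeros_def by blast
  from reduce_vanishing_lead[OF p(1,3)] obtain q where "q \<in> F" "degree q \<le> degree p" "\<phi> (lead_coeff q) \<noteq> 0" "map_poly \<phi> q = map_poly \<phi> p" by blast
  then show ?thesis using that[of q] p by auto
qed

text \<open>The polynomial of degree at most \<open>d\<close> that witnesses the zero vanishes at
  \<open>u\<close> too, because signs agree at that level; it serves as the divisor in
  \<open>sign_at_zero\<close>.\<close>

lemma sign_at_lower_zero:
  assumes M: "matching \<phi> \<psi> F d M" and c: "same_cut M t u" and t: "t \<in> zeros \<phi> F d" and p: "p \<in> F" "degree p = Suc d"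
  shows "sg (f p t) = sg (g p u)"
proof -
  have a: "agree \<phi> \<psi> F d t u" using matchingD(4)[OF M c] .
  obtain q where q: "q \<in> F" "degree q \<le> d" "\<phi> (lead_coeff q) \<noteq> 0" "f q t = 0" using zero_witness[OF t] by blast
  have "sg (f q t) = sg (g q u)" using a q unfolding agree_def by blast
  then have "g q u = 0" using q(4) by simp
  then show ?thesis using sign_at_zero[OF a p q(1,3) _ q(4)] q(2) by simp
qed

text \<open>The derivative belongs to the family and has degree at most \<open>d\<close>, so its
  zeros are recorded at level \<open>d\<close>. Between those zeros \<open>p\<close> is strictly
  monotone.\<close>

lemma deriv_nonzero:
  assumes p: "p \<in> F" "degree p = Suc d" "\<phi> (lead_coeff p) \<noteq> 0" and x: "x \<notin> zeros \<phi> F d"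
  shows "poly (pderiv (map_poly \<phi> p)) x \<noteq> 0"
proof
  assume z: "poly (pderiv (map_poly \<phi> p)) x = 0"
  have "degree (map_poly \<phi> p) \<noteq> 0" using degree_map[OF p(3)] p(2) by simp
  then have "map_poly \<phi> (formal_deriv p) \<noteq> 0" unfolding map_formal_deriv[OF hom(1)] by (simp add: pderiv_eq_0_iff)
  moreover have "formal_deriv p \<in> F" using F_deriv p by simp
  moreover have "degree (formal_deriv p) \<le> d" using degree_formal_deriv[of p] p(2) by simp
  ultimately have "x \<in> zeros \<phi> F d" unfolding zeros_def using z map_formal_deriv[OF hom(1)] by auto
  with x show False ..
qed

lemma deriv_agree:
  assumes "agree \<phi> \<psi> F d t u" "p \<in> F" "degree p = Suc d"
  shows "sg (poly (pderiv (map_poly \<phi> p)) t) = sg (poly (pderiv (map_poly \<psi> p)) u)"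
  using assms F_deriv[of p] degree_formal_deriv[of p]
  unfolding agree_def map_formal_deriv[OF hom(1), symmetric] map_formal_deriv[OF hom(2), symmetric] by auto

lemma sg_diff:
  assumes p: "p \<in> F" "degree p = Suc d" "\<phi> (lead_coeff p) \<noteq> 0"
    and "x < y" "x \<le> m" "m \<le> y" "m \<notin> zeros \<phi> F d" "\<And>c. x < c \<Longrightarrow> c < y \<Longrightarrow> c \<notin> zeros \<phi> F d"
  shows "sg (f p y - f p x) = sg (poly (pderiv (map_poly \<phi> p)) m)"
  using assms by (intro sg_poly_diff deriv_nonzero[OF p]) auto

text \<open>A point to the left of \<open>t\<close> in the closure of its cell, or far out if the cell is unbounded.\<close>

lemma left_end:
  assumes M: "matching \<phi> \<psi> F d M" and t: "t \<notin> zeros \<phi> F d" and c: "same_cut M t u"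
    and p: "p \<in> F" "degree p = Suc d" "\<phi> (lead_coeff p) \<noteq> 0"
  obtains v v' where "v < t" "v' < u" "\<And>c. v < c \<Longrightarrow> c < t \<Longrightarrow> c \<notin> zeros \<phi> F d"
    "\<And>c. v' < c \<Longrightarrow> c < u \<Longrightarrow> c \<notin> zeros \<psi> F d" "sg (f p v) = sg (g p v')"
proof (cases "\<exists>z\<in>zeros \<phi> F d. z < t")
  interpret sw: sign_family \<psi> \<phi> F by (rule sign_family_swap)
  note M' = matching_converse[OF M]
  case True
  define v where "v = Max {z \<in> zeros \<phi> F d. z < t}"
  have "finite {z \<in> zeros \<phi> F d. z < t}" "{z \<in> zeros \<phi> F d. z < t} \<noteq> {}" using finite_zeros True by auto
  then have "v \<in> {z \<in> zeros \<phi> F d. z < t}" "\<And>c. c \<in> {z \<in> zeros \<phi> F d. z < t} \<Longrightarrow> c \<le> v" unfolding v_def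
    by (rule Max_in, intro Max_ge)
  then have v: "v \<in> zeros \<phi> F d" "v < t" "\<And>c. v < c \<Longrightarrow> c < t \<Longrightarrow> c \<notin> zeros \<phi> F d" by force+
  obtain v' where v': "(v, v') \<in> M" "v' \<in> zeros \<psi> F d" "same_cut M v v'" using matching_partner[OF M v(1)] by blast
  have "v' < u" using c v' v(2) unfolding same_cut_def by blast
  moreover have "c \<notin> zeros \<psi> F d" if "v' < c" "c < u" for c
  proof
    assume "c \<in> zeros \<psi> F d"
    then obtain z where z: "(c, z) \<in> M\<inverse>" "z \<in> zeros \<phi> F d" using sw.matching_partner[OF M'] by blast
    then have "v < z" "z < t" using v'(3) \<open>same_cut M t u\<close> that unfolding same_cut_def by auto
    then show False using v(3) z(2) by blast
  qed
  ultimately show ?thesis using that[of v v'] v sign_at_lower_zero[OF M v'(3) v(1) p(1,2)] by blast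
next
  interpret sw: sign_family \<psi> \<phi> F by (rule sign_family_swap)
  note M' = matching_converse[OF M]
  case False
  have False': "\<not> (\<exists>w\<in>zeros \<psi> F d. w < u)"
  proof
    assume "\<exists>w\<in>zeros \<psi> F d. w < u"
    then obtain w z where z: "(w, z) \<in> M\<inverse>" "z \<in> zeros \<phi> F d" "w < u" using sw.matching_partner[OF M'] by blast
    then have "z < t" using c unfolding same_cut_def by auto
    then show False using False z by blast
  qed
  have p': "\<psi> (lead_coeff p) \<noteq> 0" using p lead_zero_iff by blast
  obtain B where B: "\<forall>x\<le>B. sg (f p x) = (- 1) ^ degree (map_poly \<phi> p) * sg (lead_coeff (map_poly \<phi> p))" using sg_poly_at_bot by blast
  obtain B' where B': "\<forall>x\<le>B'. sg (g p x) = (- 1) ^ degree (map_poly \<psi> p) * sg (lead_coeff (map_poly \<psi> p))" using sg_poly_at_bot by blast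
  \<comment> \<open>Strictly left of \<open>t\<close>, and far enough left for the leading term to
    decide the sign; the same choice is made on the other side.\<close>
  define v where "v = min B (t - 1)"
  define v' where "v' = min B' (u - 1)"
  have "v < t" "v' < u" unfolding v_def v'_def by (auto simp: min_less_iff_disj)
  moreover have "sg (f p v) = sg (g p v')" using B B' sign[OF p(1), of "degree p"]
    unfolding v_def v'_def degree_map(1)[OF p(3)] sw.degree_map(1)[OF p'] map_poly_ring_hom(4)[OF hom(1)]
      map_poly_ring_hom(4)[OF hom(2)] by simp
  ultimately show ?thesis using that[of v v'] False False' by blast
qed

text \<open>The mirror image of \<open>left_end\<close>; far to the right the leading coefficient
  alone gives the sign, without the parity of the degree.\<close>

lemma right_end:
  assumes M: "matching \<phi> \<psi> F d M" and t: "t \<notin> zeros \<phi> F d" and c: "same_cut M t u"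
    and p: "p \<in> F" "degree p = Suc d" "\<phi> (lead_coeff p) \<noteq> 0"
  obtains v v' where "t < v" "u < v'" "\<And>c. t < c \<Longrightarrow> c < v \<Longrightarrow> c \<notin> zeros \<phi> F d"
    "\<And>c. u < c \<Longrightarrow> c < v' \<Longrightarrow> c \<notin> zeros \<psi> F d" "sg (f p v) = sg (g p v')"
proof (cases "\<exists>z\<in>zeros \<phi> F d. t < z")
  interpret sw: sign_family \<psi> \<phi> F by (rule sign_family_swap)
  note M' = matching_converse[OF M]
  case True
  define v where "v = Min {z \<in> zeros \<phi> F d. t < z}"
  have "finite {z \<in> zeros \<phi> F d. t < z}" "{z \<in> zeros \<phi> F d. t < z} \<noteq> {}" using finite_zeros True by auto
  then have "v \<in> {z \<in> zeros \<phi> F d. t < z}" "\<And>c. c \<in> {z \<in> zeros \<phi> F d. t < z} \<Longrightarrow> v \<le> c" unfolding v_def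
    by (rule Min_in, intro Min_le)
  then have v: "v \<in> zeros \<phi> F d" "t < v" "\<And>c. t < c \<Longrightarrow> c < v \<Longrightarrow> c \<notin> zeros \<phi> F d" by force+
  obtain v' where v': "(v, v') \<in> M" "v' \<in> zeros \<psi> F d" "same_cut M v v'" using matching_partner[OF M v(1)] by blast
  have "u < v'" using c v' v(2) unfolding same_cut_def by blast
  moreover have "c \<notin> zeros \<psi> F d" if "u < c" "c < v'" for c
  proof
    assume "c \<in> zeros \<psi> F d"
    then obtain z where z: "(c, z) \<in> M\<inverse>" "z \<in> zeros \<phi> F d" using sw.matching_partner[OF M'] by blast
    then have "t < z" "z < v" using v'(3) \<open>same_cut M t u\<close> that unfolding same_cut_def by auto
    then show False using v(3) z(2) by blast
  qed
  ultimately show ?thesis using that[of v v'] v sign_at_lower_zero[OF M v'(3) v(1) p(1,2)] by blast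
next
  interpret sw: sign_family \<psi> \<phi> F by (rule sign_family_swap)
  note M' = matching_converse[OF M]
  case False
  have False': "\<not> (\<exists>w\<in>zeros \<psi> F d. u < w)"
  proof
    assume "\<exists>w\<in>zeros \<psi> F d. u < w"
    then obtain w z where z: "(w, z) \<in> M\<inverse>" "z \<in> zeros \<phi> F d" "u < w" using sw.matching_partner[OF M'] by blast
    then have "t < z" using c unfolding same_cut_def by auto
    then show False using False z by blast
  qed
  have p': "\<psi> (lead_coeff p) \<noteq> 0" using p lead_zero_iff by blast
  obtain B where B: "\<forall>x\<ge>B. sg (f p x) = sg (lead_coeff (map_poly \<phi> p))" using sg_poly_at_top by blast
  obtain B' where B': "\<forall>x\<ge>B'. sg (g p x) = sg (lead_coeff (map_poly \<psi> p))" using sg_poly_at_top by blast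
  define v where "v = max B (t + 1)"
  define v' where "v' = max B' (u + 1)"
  have "t < v" "u < v'" unfolding v_def v'_def by (auto simp: less_max_iff_disj)
  moreover have "sg (f p v) = sg (g p v')" using B B' sign[OF p(1), of "degree p"]
    unfolding v_def v'_def degree_map(1)[OF p(3)] sw.degree_map(1)[OF p'] map_poly_ring_hom(4)[OF hom(1)]
      map_poly_ring_hom(4)[OF hom(2)] by simp
  ultimately show ?thesis using that[of v v'] False False' by blast
qed

text \<open>New zeros are paired by requiring equal signs of the whole level in corresponding cells,
  instead of by counting them from left to right. That this is an order isomorphism follows from
  totality and monotonicity, each applied in both directions.\<close>

definition extend_matching :: "nat \<Rightarrow> ('f \<times> 'g) set \<Rightarrow> ('f \<times> 'g) set" where
  "extend_matching d M = {(r, r'). r \<in> zeros \<phi> F (Suc d) \<and> r' \<in> zeros \<psi> F (Suc d) \<and> same_cut M r r' \<and> agree \<phi> \<psi> F (Suc d) r r'}"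

text \<open>A member whose leading coefficient is mapped to 0 has the same image as its
  \<open>drop_lead\<close>, which is covered by level \<open>d\<close>.\<close>

lemma agree_SucI:
  assumes "agree \<phi> \<psi> F d t u"
    and "\<And>p. p \<in> F \<Longrightarrow> degree p = Suc d \<Longrightarrow> \<phi> (lead_coeff p) \<noteq> 0 \<Longrightarrow> sg (f p t) = sg (g p u)"
  shows "agree \<phi> \<psi> F (Suc d) t u"
  unfolding agree_def
proof (intro ballI impI)
  interpret sw: sign_family \<psi> \<phi> F by (rule sign_family_swap)
  fix p assume p: "p \<in> F" "degree p \<le> Suc d"
  consider "degree p \<le> d" | "degree p = Suc d" "\<phi> (lead_coeff p) \<noteq> 0" | "degree p = Suc d" "\<phi> (lead_coeff p) = 0" using p(2) by linarith
  then show "sg (f p t) = sg (g p u)"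
  proof cases
    case 1
    then show ?thesis using assms(1) p unfolding agree_def by blast
  next
    case 2
    then show ?thesis using assms(2) p by blast
  next
    case 3
    then have "drop_lead p \<in> F" "degree (drop_lead p) \<le> d" using F_drop[OF p(1)] degree_drop_lead[of p] by auto
    then have "sg (f (drop_lead p) t) = sg (g (drop_lead p) u)" using assms(1) unfolding agree_def by blast
    then show ?thesis using map_drop_lead[OF 3(2)] sw.map_drop_lead[of p] 3(2) lead_zero_iff[OF p(1)] by simp
  qed
qed

text \<open>A zero \<open>r\<close> that is new at this level lies inside a cell on which its
  polynomial \<open>p\<close> is strictly monotone, so \<open>p\<close> has opposite signs at the
  two ends. The corresponding ends on the other side carry the same signs, and the intermediate
  value property gives a zero \<open>r'\<close> there.\<close>

lemma extend_matching_total: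
  assumes M: "matching \<phi> \<psi> F d M" and r: "r \<in> zeros \<phi> F (Suc d)"
  shows "\<exists>r'. (r, r') \<in> extend_matching d M"
proof -
  interpret sw: sign_family \<psi> \<phi> F by (rule sign_family_swap)
  note M_agree = matchingD(4)[OF M]
  show ?thesis
  proof (cases "r \<in> zeros \<phi> F d")
    case True
    then obtain w where w: "w \<in> zeros \<psi> F d" "same_cut M r w" using matching_partner[OF M] by blast
    have "agree \<phi> \<psi> F (Suc d) r w"
      using agree_SucI[OF M_agree[OF w(2)]] sign_at_lower_zero[OF M w(2) True] by blast
    moreover have "w \<in> zeros \<psi> F (Suc d)" using w(1) sw.zeros_mono[of d "Suc d"] by auto
    ultimately show ?thesis using r w(2) unfolding extend_matching_def by blast
  next
    case False
    obtain p where p: "p \<in> F" "degree p \<le> Suc d" "\<phi> (lead_coeff p) \<noteq> 0" "f p r = 0" using zero_witness[OF r] by blast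
    have "degree p = Suc d"
    proof (rule ccontr)
      assume "degree p \<noteq> Suc d"
      then have "r \<in> zeros \<phi> F d" unfolding zeros_def using p degree_map(2)[OF p(3)] by (auto intro!: bexI[of _ p])
      with False show False ..
    qed
    note p = p(1) this p(3,4)
    have p': "\<psi> (lead_coeff p) \<noteq> 0" using p lead_zero_iff by blast
    obtain u where u: "same_cut M r u" using same_cut_exists[OF M] by blast
    have u_nz: "u \<notin> zeros \<psi> F d"
      using sw.matching_zero[OF matching_converse[OF M], of u r] u False by (auto simp: same_cut_converse)
    \<comment> \<open>The direction in which \<open>p\<close> crosses 0 at \<open>r\<close>; the
      ends of the cell then have signs -\<epsilon> and \<epsilon>.\<close>
    define \<epsilon> where "\<epsilon> = sg (poly (pderiv (map_poly \<phi> p)) r)"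
    have eps: "\<epsilon> \<noteq> 0" unfolding \<epsilon>_def using deriv_nonzero[OF p(1-3) False] by simp
    obtain v v' where v: "v < r" "v' < u" "\<And>c. v < c \<Longrightarrow> c < r \<Longrightarrow> c \<notin> zeros \<phi> F d"
      "\<And>c. v' < c \<Longrightarrow> c < u \<Longrightarrow> c \<notin> zeros \<psi> F d" "sg (f p v) = sg (g p v')"
      using left_end[OF M False u p(1-3)] by blast
    obtain y y' where y: "r < y" "u < y'" "\<And>c. r < c \<Longrightarrow> c < y \<Longrightarrow> c \<notin> zeros \<phi> F d"
      "\<And>c. u < c \<Longrightarrow> c < y' \<Longrightarrow> c \<notin> zeros \<psi> F d" "sg (f p y) = sg (g p y')"
      using right_end[OF M False u p(1-3)] by blast
    have "sg (f p r - f p v) = \<epsilon>" unfolding \<epsilon>_def using v False by (intro sg_diff[OF p(1-3)]) auto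
    then have sv: "sg (g p v') = - \<epsilon>" using p(4) v(5) by simp
    have "sg (f p y - f p r) = \<epsilon>" unfolding \<epsilon>_def using y False by (intro sg_diff[OF p(1-3)]) auto
    then have sy: "sg (g p y') = \<epsilon>" using p(4) y(5) by simp
    have "\<epsilon> = 1 \<or> \<epsilon> = - 1" using eps sg_cases unfolding \<epsilon>_def by blast
    then have "sg (g p v' * g p y') = - 1" unfolding sg_mult sv sy by auto
    then have "g p v' * g p y' < 0" by simp
    then obtain r' where r': "v' < r'" "r' < y'" "g p r' = 0" using poly_ivt_mult v(2) y(2) by (metis order.strict_trans)
    have cell: "c \<notin> zeros \<psi> F d" if "v' < c" "c < y'" for c using that v(4) y(4) u_nz by (cases c u rule: linorder_cases) auto
    have cut: "same_cut M r r'" unfolding same_cut_def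
    proof (intro ballI, clarify)
      fix z w assume zw: "(z, w) \<in> M"
      then have "w \<in> zeros \<psi> F d" by (rule matchingD(2)[OF M])
      then have w: "w \<le> v' \<or> y' \<le> w" using cell[of w] by force
      have "(z < r \<longleftrightarrow> w < u) \<and> (r < z \<longleftrightarrow> u < w)" using u zw unfolding same_cut_def by blast
      then show "(z < r \<longleftrightarrow> w < r') \<and> (r < z \<longleftrightarrow> r' < w)" using w r' v(2) y(2) by auto
    qed
    \<comment> \<open>All other members of degree \<open>Suc d\<close> are divided by
      \<open>p\<close>, which vanishes at both points.\<close>
    have "agree \<phi> \<psi> F (Suc d) r r'"
      using sign_at_zero[OF M_agree[OF cut] _ _ p(1,3) _ p(4) r'(3)] p(2) by (intro agree_SucI M_agree[OF cut]) auto
    moreover have "r' \<in> zeros \<psi> F (Suc d)" unfolding zeros_def using p r'(3) sw.degree_map(2)[OF p'] by (auto intro!: bexI[of _ p])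
    ultimately show ?thesis using r cut unfolding extend_matching_def by blast
  qed
qed

text \<open>If a zero of level \<open>d\<close> lies between \<open>r\<close> and \<open>s\<close>,
  its partner separates \<open>r'\<close> from \<open>s'\<close>. Otherwise \<open>r\<close> and
  \<open>s\<close> share a cell, and for a polynomial \<open>p\<close> vanishing at \<open>r\<close>
  the sign of \<open>p\<close> at \<open>s\<close> is the sign of its derivative. The same signs on
  the other side rule out that \<open>s'\<close> is at or before \<open>r'\<close>.\<close>

lemma extend_matching_less:
  assumes M: "matching \<phi> \<psi> F d M" and r: "(r, r') \<in> extend_matching d M" and s: "(s, s') \<in> extend_matching d M" and less: "r < s"
  shows "r' < s'"
proof -
  interpret sw: sign_family \<psi> \<phi> F by (rule sign_family_swap)
  have r: "r \<in> zeros \<phi> F (Suc d)" "same_cut M r r'" "agree \<phi> \<psi> F (Suc d) r r'" using r unfolding extend_matching_def by auto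
  have s: "same_cut M s s'" "agree \<phi> \<psi> F (Suc d) s s'" using s unfolding extend_matching_def by auto
  show ?thesis
  proof (cases "\<exists>z\<in>zeros \<phi> F d. r \<le> z \<and> z \<le> s")
    case True
    then obtain z where z: "z \<in> zeros \<phi> F d" "r \<le> z" "z \<le> s" by blast
    then obtain w where w: "(z, w) \<in> M" using matching_partner[OF M] by blast
    have "r < z \<longleftrightarrow> r' < w" "z < r \<longleftrightarrow> w < r'" "z < s \<longleftrightarrow> w < s'" "s < z \<longleftrightarrow> s' < w" using r s w unfolding same_cut_def by blast+
    then show ?thesis using z less by (metis leD leI order.strict_trans1 order_le_less)
  next
    case False
    then have r_nz: "r \<notin> zeros \<phi> F d" and s_nz: "s \<notin> zeros \<phi> F d" using less by auto
    obtain p where p: "p \<in> F" "degree p \<le> Suc d" "\<phi> (lead_coeff p) \<noteq> 0" "f p r = 0" using zero_witness[OF r(1)] by blast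
    have "degree p = Suc d"
    proof (rule ccontr)
      assume "degree p \<noteq> Suc d"
      then have "r \<in> zeros \<phi> F d" unfolding zeros_def using p degree_map(2)[OF p(3)] by (auto intro!: bexI[of _ p])
      with r_nz show False ..
    qed
    note p = p(1) this p(3,4)
    have p': "\<psi> (lead_coeff p) \<noteq> 0" using p lead_zero_iff by blast
    have gr: "g p r' = 0" using r(3) p unfolding agree_def by (metis order_refl sg_simps(4))
    define \<epsilon> where "\<epsilon> = sg (poly (pderiv (map_poly \<phi> p)) r)"
    have eps: "\<epsilon> \<noteq> 0" unfolding \<epsilon>_def using deriv_nonzero[OF p(1-3) r_nz] by simp
    have Ma: "agree \<phi> \<psi> F d r r'" using matchingD(4)[OF M r(2)] .
    have eps': "\<epsilon> = sg (poly (pderiv (map_poly \<psi> p)) r')" unfolding \<epsilon>_def by (rule deriv_agree[OF Ma p(1,2)])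
    have "sg (f p s - f p r) = \<epsilon>" unfolding \<epsilon>_def
      using False less r_nz by (intro sg_diff[OF p(1-3)]) auto
    then have "sg (f p s) = \<epsilon>" using p(4) by simp
    then have gs: "sg (g p s') = \<epsilon>" using s(2) p unfolding agree_def by auto
    \<comment> \<open>A zero of level \<open>d\<close> between \<open>s'\<close> and
      \<open>r'\<close> would have a partner between \<open>r\<close> and \<open>s\<close>.\<close>
    have nz': "c \<notin> zeros \<psi> F d" if "s' \<le> c" "c \<le> r'" for c
    proof
      assume "c \<in> zeros \<psi> F d"
      then obtain z where z: "(c, z) \<in> M\<inverse>" "z \<in> zeros \<phi> F d" using sw.matching_partner[OF matching_converse[OF M]] by blast
      then have "z < r \<longleftrightarrow> c < r'" "s < z \<longleftrightarrow> s' < c" "z < s \<longleftrightarrow> c < s'" "r < z \<longleftrightarrow> r' < c" using r s unfolding same_cut_def by blast+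
      then show False using that less False z(2) by (metis leD leI order.strict_trans)
    qed
    show ?thesis
    proof (rule ccontr)
      assume "\<not> r' < s'"
      then consider "s' = r'" | "s' < r'" by force
      then show False
      proof cases
        case 1
        then show False using gs gr eps by simp
      next
        case 2
        have "sg (g p r' - g p s') = \<epsilon>" unfolding eps'
          using nz' 2 by (intro sw.sg_diff[OF p(1,2) p']) auto
        then show False using gs gr eps by simp
      qed
    qed
  qed
qed

lemma extend_matching_converse:
  "sign_family.extend_matching \<psi> \<phi> F d (M\<inverse>) = (extend_matching d M)\<inverse>"
  unfolding sign_family.extend_matching_def[OF sign_family_swap] extend_matching_def
  by (auto simp: same_cut_converse agree_swap[of \<psi> \<phi>])

lemma zeros_leadI: "p \<in> F \<Longrightarrow> degree p \<le> d \<Longrightarrow> \<phi> (lead_coeff p) \<noteq> 0 \<Longrightarrow> f p x = 0 \<Longrightarrow> x \<in> zeros \<phi> F d"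
  unfolding zeros_def using degree_map(2) by blast

text \<open>Away from the new zeros, the sign of \<open>p\<close> at \<open>t\<close> is read off
  from the closest new zero \<open>y\<close> on the left: if \<open>p\<close> does not vanish at
  \<open>y\<close>, its sign persists up to \<open>t\<close>; if it does, the sign of the derivative
  at \<open>t\<close> decides. When there is no zero on the left, the sign at minus infinity
  persists. Each case has its counterpart at \<open>u\<close>.\<close>

lemma matching_extend_matching:
  assumes M: "matching \<phi> \<psi> F d M"
  shows "matching \<phi> \<psi> F (Suc d) (extend_matching d M)"
proof -
  interpret sw: sign_family \<psi> \<phi> F by (rule sign_family_swap)
  define M' where "M' = extend_matching d M"
  have M'D: "r \<in> zeros \<phi> F (Suc d)" "r' \<in> zeros \<psi> F (Suc d)" "same_cut M r r'" "agree \<phi> \<psi> F (Suc d) r r'"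
    if "(r, r') \<in> M'" for r r' using that unfolding M'_def extend_matching_def by auto
  have tot: "\<exists>r'. (r, r') \<in> M'" if "r \<in> zeros \<phi> F (Suc d)" for r
    using extend_matching_total[OF M that] unfolding M'_def .
  have tot': "\<exists>r. (r, r') \<in> M'" if "r' \<in> zeros \<psi> F (Suc d)" for r'
    using sw.extend_matching_total[OF matching_converse[OF M] that] unfolding extend_matching_converse M'_def by blast
  have less_iff: "r < s \<longleftrightarrow> r' < s'" if "(r, r') \<in> M'" "(s, s') \<in> M'" for r r' s s'
    using extend_matching_less[OF M] sw.extend_matching_less[OF matching_converse[OF M]] that
    unfolding extend_matching_converse M'_def by blast
  have sub: "M \<subseteq> M'"
  proof (rule subrelI)
    fix z w assume zw: "(z, w) \<in> M"
    note D = matchingD(1-3)[OF M zw]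
    have "agree \<phi> \<psi> F (Suc d) z w"
      using agree_SucI[OF matchingD(4)[OF M D(3)]] sign_at_lower_zero[OF M D(3,1)] by blast
    moreover have "z \<in> zeros \<phi> F (Suc d)" "w \<in> zeros \<psi> F (Suc d)"
      using D(1,2) zeros_mono[of d "Suc d"] sw.zeros_mono[of d "Suc d"] by auto
    ultimately show "(z, w) \<in> M'" using D(3) unfolding M'_def extend_matching_def by blast
  qed
  have "agree \<phi> \<psi> F (Suc d) t u" if c: "same_cut M' t u" for t u
  proof (cases "t \<in> zeros \<phi> F (Suc d) \<or> u \<in> zeros \<psi> F (Suc d)")
    case True
    then obtain z w where zw: "(z, w) \<in> M'" "z = t \<or> w = u" using tot tot' by blast
    then have "(z < t \<longleftrightarrow> w < u) \<and> (t < z \<longleftrightarrow> u < w)" using c unfolding same_cut_def by blast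
    then have "z = t \<and> w = u" using zw(2) by (metis linorder_neqE order_less_irrefl)
    then show ?thesis using M'D(4) zw(1) by blast
  next
    case False
    have cM: "same_cut M t u" using c sub unfolding same_cut_def by blast
    have agr: "agree \<phi> \<psi> F d t u" using matchingD(4)[OF M cM] .
    have tz: "t \<notin> zeros \<phi> F d" and uz: "u \<notin> zeros \<psi> F d"
      using False zeros_mono[of d "Suc d"] sw.zeros_mono[of d "Suc d"] by auto
    show ?thesis
    proof (rule agree_SucI[OF agr])
      fix p assume p: "p \<in> F" "degree p = Suc d" "\<phi> (lead_coeff p) \<noteq> 0"
      then have p': "\<psi> (lead_coeff p) \<noteq> 0" using lead_zero_iff by blast
      show "sg (f p t) = sg (g p u)"
      proof (cases "\<exists>z\<in>zeros \<phi> F (Suc d). z < t")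
        case True
        define A where "A = {z \<in> zeros \<phi> F (Suc d). z < t}"
        have A: "finite A" "A \<noteq> {}" unfolding A_def using finite_zeros True by auto
        define y where "y = Max A"
        have "y \<in> A" unfolding y_def using A by (rule Max_in)
        then have y: "y \<in> zeros \<phi> F (Suc d)" "y < t" unfolding A_def by auto
        have gap: "c \<notin> zeros \<phi> F (Suc d)" if "y < c" "c \<le> t" for c
        proof
          assume cz: "c \<in> zeros \<phi> F (Suc d)"
          then have "c \<noteq> t" using False by blast
          then have "c \<in> A" unfolding A_def using cz that by simp
          then have "c \<le> y" unfolding y_def using A by simp
          then show False using that by simp
        qed
        obtain y' where y': "(y, y') \<in> M'" using tot y by blast
        have y'u: "y' < u" using c y' y(2) unfolding same_cut_def by blast
        have gap': "w \<notin> zeros \<psi> F (Suc d)" if w: "y' < w" "w \<le> u" for w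
        proof
          assume "w \<in> zeros \<psi> F (Suc d)"
          then obtain z where z: "(z, w) \<in> M'" using tot' by blast
          then have "y < z" using less_iff[OF y' z] w by simp
          moreover have "\<not> t < z" using c z w unfolding same_cut_def by force
          ultimately show False using gap[of z] M'D(1)[OF z] by simp
        qed
        have sy: "sg (f p y) = sg (g p y')" using M'D(4)[OF y'] p unfolding agree_def by simp
        show ?thesis
        proof (cases "f p y = 0")
          case True
          then have g0: "g p y' = 0" using sy by (metis sg_simps(4) sg_simps(1))
          have "sg (f p t - f p y) = sg (poly (pderiv (map_poly \<phi> p)) t)"
            using y gap tz zeros_mono[of d "Suc d"] by (intro sg_diff[OF p]) auto
          moreover have "sg (g p u - g p y') = sg (poly (pderiv (map_poly \<psi> p)) u)"
            using y'u gap' uz sw.zeros_mono[of d "Suc d"] by (intro sw.sg_diff[OF p(1,2) p']) auto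
          ultimately show ?thesis using True g0 deriv_agree[OF agr p(1,2)] by simp
        next
          case nz: False
          then have nz': "g p y' \<noteq> 0" using sy by (metis sg_simps(4))
          have "sg (f p y) = sg (f p t)"
          proof (rule sg_poly_eqI)
            fix e assume e: "min y t \<le> e" "e \<le> max y t"
            show "f p e \<noteq> 0"
            proof (cases "e = y")
              case False
              then have "y < e" "e \<le> t" using e y(2) by auto
              then show ?thesis using gap zeros_leadI[OF p(1) _ p(3)] p(2) by auto
            qed (use nz in simp)
          qed
          moreover have "sg (g p y') = sg (g p u)"
          proof (rule sg_poly_eqI)
            fix e assume e: "min y' u \<le> e" "e \<le> max y' u"
            show "g p e \<noteq> 0"
            proof (cases "e = y'")
              case False
              then have "y' < e" "e \<le> u" using e y'u by auto
              then show ?thesis using gap' sw.zeros_leadI[OF p(1) _ p'] p(2) by auto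
            qed (use nz' in simp)
          qed
          ultimately show ?thesis using sy by simp
        qed
      next
        case none: False
        have none': "\<not> (\<exists>w\<in>zeros \<psi> F (Suc d). w < u)"
        proof
          assume "\<exists>w\<in>zeros \<psi> F (Suc d). w < u"
          then obtain w z where z: "w < u" "(z, w) \<in> M'" using tot' by blast
          then have "z < t" using c unfolding same_cut_def by blast
          then show False using none M'D(1)[OF z(2)] by blast
        qed
        obtain B where B: "\<forall>x\<le>B. sg (f p x) = (- 1) ^ degree (map_poly \<phi> p) * sg (lead_coeff (map_poly \<phi> p))" using sg_poly_at_bot by blast
        obtain B' where B': "\<forall>x\<le>B'. sg (g p x) = (- 1) ^ degree (map_poly \<psi> p) * sg (lead_coeff (map_poly \<psi> p))" using sg_poly_at_bot by blast
        have "sg (f p (min B t)) = sg (g p (min B' u))" using B B' sign[OF p(1), of "degree p"]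
          unfolding degree_map(1)[OF p(3)] sw.degree_map(1)[OF p'] map_poly_ring_hom(4)[OF hom(1)]
            map_poly_ring_hom(4)[OF hom(2)] by simp
        moreover have "sg (f p (min B t)) = sg (f p t)"
        proof (rule sg_poly_eqI)
          fix e assume "min (min B t) t \<le> e" "e \<le> max (min B t) t"
          then have "e < t \<or> e = t" by auto
          then show "f p e \<noteq> 0" using none False zeros_leadI[OF p(1) _ p(3)] p(2) by auto
        qed
        moreover have "sg (g p (min B' u)) = sg (g p u)"
        proof (rule sg_poly_eqI)
          fix e assume "min (min B' u) u \<le> e" "e \<le> max (min B' u) u"
          then have "e < u \<or> e = u" by auto
          then show "g p e \<noteq> 0" using none' False sw.zeros_leadI[OF p(1) _ p'] p(2) by auto
        qed
        ultimately show ?thesis by simp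
      qed
    qed
  qed
  moreover have "fst ` M' = zeros \<phi> F (Suc d)" using tot M'D(1) by force
  moreover have "snd ` M' = zeros \<psi> F (Suc d)" using tot' M'D(2) by force
  moreover have "\<forall>(z, w)\<in>M'. same_cut M' z w" unfolding same_cut_def using less_iff by auto
  ultimately show ?thesis unfolding matching_def M'_def by blast
qed

text \<open>At level 0 only constants occur; those not mapped to 0 have no zeros, so the empty
  relation is a matching.\<close>

lemma matching_exists: "\<exists>M. matching \<phi> \<psi> F d M"
proof (induction d)
  case 0
  have const: "\<exists>c. p = [:c:] \<and> sg (\<phi> c) = sg (\<psi> c)" if "p \<in> F" "degree p = 0" for p
  proof -
    obtain c where c: "p = [:c:]" using \<open>degree p = 0\<close> degree_eq_zeroE by blast
    then show ?thesis using sign[OF that(1), of 0] by simp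
  qed
  note h = is_ring_homD(4)[OF hom(1)] is_ring_homD(4)[OF hom(2)]
  have "agree \<phi> \<psi> F 0 t u" for t u unfolding agree_def
    using const by (fastforce simp: map_poly_pCons h)
  moreover have "zeros \<phi> F 0 = {}" "zeros \<psi> F 0 = {}" unfolding zeros_def
    using const by (fastforce simp: map_poly_pCons h)+
  ultimately have "matching \<phi> \<psi> F 0 {}" unfolding matching_def same_cut_def by auto
  then show ?case by blast
next
  case (Suc d)
  then show ?case using matching_extend_matching by blast
qed

theorem sign_transfer: "\<exists>u. \<forall>p\<in>F. sg (f p t) = sg (g p u)"
proof -
  define d where "d = Max (insert 0 (degree ` F))"
  have d: "degree p \<le> d" if "p \<in> F" for p unfolding d_def using fin that by (intro Max_ge) auto
  obtain M where M: "matching \<phi> \<psi> F d M" using matching_exists by blast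
  obtain u where "same_cut M t u" using same_cut_exists[OF M] by blast
  then have "agree \<phi> \<psi> F d t u" using matchingD(4)[OF M] by blast
  then show ?thesis using d unfolding agree_def by blast
qed

end

section \<open>Multivariate polynomials\<close>

abbreviation monomial_eval :: "('v \<Rightarrow> real) \<Rightarrow> ('v \<Rightarrow>\<^sub>0 nat) \<Rightarrow> real" where
  "monomial_eval a t \<equiv> \<Prod>v\<in>Poly_Mapping.keys t. a v ^ Poly_Mapping.lookup t v"

lemma monomial_eval_superset:
  "finite S \<Longrightarrow> Poly_Mapping.keys t \<subseteq> S \<Longrightarrow> monomial_eval a t = (\<Prod>v\<in>S. a v ^ Poly_Mapping.lookup t v)"
  by (intro prod.mono_neutral_left) (auto simp: in_keys_iff)

lemma monomial_eval_add: "monomial_eval a (s + t) = monomial_eval a s * monomial_eval a t"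
proof -
  let ?S = "Poly_Mapping.keys s \<union> Poly_Mapping.keys t"
  have "monomial_eval a (s + t) = (\<Prod>v\<in>?S. a v ^ Poly_Mapping.lookup (s + t) v)"
    by (intro monomial_eval_superset) (auto simp: Poly_Mapping.keys_add)
  also have "\<dots> = (\<Prod>v\<in>?S. a v ^ Poly_Mapping.lookup s v) * (\<Prod>v\<in>?S. a v ^ Poly_Mapping.lookup t v)"
    by (simp add: lookup_add power_add prod.distrib)
  also have "\<dots> = monomial_eval a s * monomial_eval a t"
    using monomial_eval_superset[of ?S s a] monomial_eval_superset[of ?S t a] by simp
  finally show ?thesis .
qed

lemma poly_eval_superset:
  "finite S \<Longrightarrow> Poly_Mapping.keys p \<subseteq> S \<Longrightarrow> poly_eval a p = (\<Sum>t\<in>S. Poly_Mapping.lookup p t * monomial_eval a t)"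
  unfolding poly_eval_def by (intro sum.mono_neutral_left) (auto simp: in_keys_iff)

lemma poly_eval_add: "poly_eval a (p + q) = poly_eval a p + poly_eval a q"
proof -
  let ?S = "Poly_Mapping.keys p \<union> Poly_Mapping.keys q"
  have "poly_eval a (p + q) = (\<Sum>t\<in>?S. Poly_Mapping.lookup (p + q) t * monomial_eval a t)"
    by (intro poly_eval_superset) (auto simp: Poly_Mapping.keys_add)
  also have "\<dots> = (\<Sum>t\<in>?S. Poly_Mapping.lookup p t * monomial_eval a t) + (\<Sum>t\<in>?S. Poly_Mapping.lookup q t * monomial_eval a t)"
    by (simp add: lookup_add distrib_right sum.distrib)
  also have "\<dots> = poly_eval a p + poly_eval a q"
    using poly_eval_superset[of ?S p a] poly_eval_superset[of ?S q a] by simp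
  finally show ?thesis .
qed

lemma poly_eval_single: "poly_eval a (Poly_Mapping.single t c) = c * monomial_eval a t"
  by (subst poly_eval_superset[of "{t}"]) auto

lemma poly_eval_zero: "poly_eval a 0 = 0"
  by (simp add: poly_eval_def)

lemma poly_eval_sum: "poly_eval a (\<Sum>i\<in>A. p i) = (\<Sum>i\<in>A. poly_eval a (p i))"
  by (induction A rule: infinite_finite_induct) (simp_all add: poly_eval_zero poly_eval_add)

lemma sum_single_lookup: "p = (\<Sum>t\<in>Poly_Mapping.keys p. Poly_Mapping.single t (Poly_Mapping.lookup p t))"
proof (rule poly_mapping_eqI)
  fix k
  have "Poly_Mapping.lookup (\<Sum>t\<in>Poly_Mapping.keys p. Poly_Mapping.single t (Poly_Mapping.lookup p t)) k
    = (\<Sum>t\<in>Poly_Mapping.keys p. if t = k then Poly_Mapping.lookup p k else 0)"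
    unfolding lookup_sum by (intro sum.cong) (auto simp: lookup_single when_def)
  also have "\<dots> = Poly_Mapping.lookup p k" by (auto simp: in_keys_iff)
  finally show "Poly_Mapping.lookup p k = Poly_Mapping.lookup (\<Sum>t\<in>Poly_Mapping.keys p. Poly_Mapping.single t (Poly_Mapping.lookup p t)) k" by simp
qed

lemma poly_eval_mult: "poly_eval a (p * q) = poly_eval a p * poly_eval a q"
proof -
  have "poly_eval a (p * q) = poly_eval a ((\<Sum>s\<in>Poly_Mapping.keys p. Poly_Mapping.single s (Poly_Mapping.lookup p s)) * (\<Sum>t\<in>Poly_Mapping.keys q. Poly_Mapping.single t (Poly_Mapping.lookup q t)))"
    using sum_single_lookup[of p] sum_single_lookup[of q] by simp
  also have "\<dots> = poly_eval a p * poly_eval a q"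
    unfolding sum_product mult_single poly_eval_sum poly_eval_single monomial_eval_add
    unfolding poly_eval_def sum_product by (intro sum.cong) auto
  finally show ?thesis .
qed

lemma Const_simps: "Const 0 = 0" "Const 1 = 1" "Const (a + b) = Const a + Const b" "Const (a * b) = Const a * Const b"
  "Const (- a) = - Const a" "Const (a - b) = Const a - Const b"
  unfolding Const_def by (simp_all add: single_add mult_single single_uminus single_diff)

lemma poly_eval_Const [simp]: "poly_eval a (Const c) = c"
  unfolding Const_def by (simp add: poly_eval_single)

lemma poly_eval_Var [simp]: "poly_eval a (Var v) = a v"
  unfolding Var_def by (simp add: poly_eval_single)

lemma is_ring_hom_poly_eval: "is_ring_hom (poly_eval a)"
  unfolding is_ring_hom_def using poly_eval_Const[of a 1] by (simp add: Const_simps poly_eval_add poly_eval_mult)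

lemmas poly_eval_simps = poly_eval_add poly_eval_mult poly_eval_zero poly_eval_sum
  is_ring_homD(1,5,6,7,8)[OF is_ring_hom_poly_eval]

lemma polys_in_add: "p \<in> polys_in V \<Longrightarrow> q \<in> polys_in V \<Longrightarrow> p + q \<in> polys_in V"
  unfolding polys_in_def using Poly_Mapping.keys_add[of p q] by blast

lemma polys_in_mult: "p \<in> polys_in V \<Longrightarrow> q \<in> polys_in V \<Longrightarrow> p * q \<in> polys_in V"
proof -
  assume p: "p \<in> polys_in V" and q: "q \<in> polys_in V"
  have "Poly_Mapping.keys t \<subseteq> V" if t: "t \<in> Poly_Mapping.keys (p * q)" for t
  proof -
    obtain r s where rs: "t = r + s" "r \<in> Poly_Mapping.keys p" "s \<in> Poly_Mapping.keys q" using t Poly_Mapping.keys_mult[of p q] by blast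
    have "Poly_Mapping.keys t \<subseteq> Poly_Mapping.keys r \<union> Poly_Mapping.keys s" unfolding rs(1) by (rule Poly_Mapping.keys_add)
    then show ?thesis using p q rs(2,3) unfolding polys_in_def by blast
  qed
  then show ?thesis unfolding polys_in_def by blast
qed

lemma polys_in_Const: "Const c \<in> polys_in V"
  unfolding polys_in_def Const_def by simp

lemma polys_in_Var: "v \<in> V \<Longrightarrow> Var v \<in> polys_in V"
  unfolding polys_in_def Var_def by simp

lemma polys_in_uminus: "p \<in> polys_in V \<Longrightarrow> - p \<in> polys_in V"
  unfolding polys_in_def by simp

lemma polys_in_diff: "p \<in> polys_in V \<Longrightarrow> q \<in> polys_in V \<Longrightarrow> p - q \<in> polys_in V"
  using polys_in_add[OF _ polys_in_uminus, of p V q] by simp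

lemma polys_in_0: "0 \<in> polys_in V" and polys_in_1: "1 \<in> polys_in V"
  using polys_in_Const[of 0 V] polys_in_Const[of 1 V] by (simp_all add: Const_simps)

lemma polys_in_power: "p \<in> polys_in V \<Longrightarrow> p ^ n \<in> polys_in V"
  by (induction n) (simp_all add: polys_in_1 polys_in_mult)

lemma polys_in_sum: "(\<And>i. i \<in> A \<Longrightarrow> p i \<in> polys_in V) \<Longrightarrow> (\<Sum>i\<in>A. p i) \<in> polys_in V"
  by (induction A rule: infinite_finite_induct) (simp_all add: polys_in_0 polys_in_add)

lemma polys_in_prod: "(\<And>i. i \<in> A \<Longrightarrow> p i \<in> polys_in V) \<Longrightarrow> (\<Prod>i\<in>A. p i) \<in> polys_in V"
  by (induction A rule: infinite_finite_induct) (simp_all add: polys_in_1 polys_in_mult)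

lemma polys_in_induct [consumes 1, case_names Const Var add mult]:
  assumes p: "p \<in> polys_in V"
    and Const: "\<And>c. Q (Const c)" and Var: "\<And>v. v \<in> V \<Longrightarrow> Q (Var v)"
    and add: "\<And>p q. Q p \<Longrightarrow> Q q \<Longrightarrow> Q (p + q)" and mult: "\<And>p q. Q p \<Longrightarrow> Q q \<Longrightarrow> Q (p * q)"
  shows "Q p"
proof -
  have Q0: "Q 0" and Q1: "Q 1" using Const[of 0] Const[of 1] by (simp_all add: Const_simps)
  have Qpow: "Q (Var v ^ n)" if "v \<in> V" for v n
    by (induction n) (simp_all add: Q1 mult Var[OF that])
  have Qmon: "Q (Poly_Mapping.single t 1)" if "Poly_Mapping.keys t \<subseteq> V" for t
    using that
  proof (induction "card (Poly_Mapping.keys t)" arbitrary: t)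
    case 0
    then have "t = 0" by simp
    then show ?case using Q1 by simp
  next
    case (Suc n)
    then obtain v where v: "v \<in> Poly_Mapping.keys t" by (metis card.empty ex_in_conv nat.distinct(1))
    define m where "m = Poly_Mapping.lookup t v"
    define s where "s = t - Poly_Mapping.single v m"
    have ls: "Poly_Mapping.lookup s w = (if w = v then 0 else Poly_Mapping.lookup t w)" for w
      unfolding s_def m_def lookup_minus by (auto simp: lookup_single when_def)
    then have "Poly_Mapping.keys s = Poly_Mapping.keys t - {v}" by (auto simp: in_keys_iff split: if_splits)
    then have s: "Q (Poly_Mapping.single s 1)" using Suc v by (intro Suc(1)) auto
    have pow: "Var v ^ k = Poly_Mapping.single (Poly_Mapping.single v k) 1" for k
      by (induction k) (simp_all add: Var_def mult_single single_add[symmetric])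
    have "t = Poly_Mapping.single v m + s"
      by (rule poly_mapping_eqI) (simp add: lookup_add ls lookup_single when_def m_def)
    then have "Poly_Mapping.single t 1 = Var v ^ m * Poly_Mapping.single s (1::real)"
      unfolding pow by (simp add: mult_single)
    then show ?case using mult[OF Qpow s] v Suc(3) by auto
  qed
  have "Q (\<Sum>t\<in>T. Poly_Mapping.single t (Poly_Mapping.lookup p t))" if "finite T" "T \<subseteq> Poly_Mapping.keys p" for T
    using that
  proof (induction T rule: finite_induct)
    case (insert t T)
    have "Poly_Mapping.single t (Poly_Mapping.lookup p t) = Const (Poly_Mapping.lookup p t) * Poly_Mapping.single t 1"
      unfolding Const_def by (simp add: mult_single)
    moreover have "Poly_Mapping.keys t \<subseteq> V" using p insert unfolding polys_in_def by blast
    ultimately have "Q (Poly_Mapping.single t (Poly_Mapping.lookup p t))" using mult[OF Const Qmon] by simp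
    then show ?case using insert add by simp
  qed (simp add: Q0)
  from this[OF finite_keys order_refl] show ?thesis using sum_single_lookup[of p] by simp
qed

lemma finite_variables: "finite \<Phi> \<Longrightarrow> \<exists>W. finite W \<and> \<Phi> \<subseteq> polys_in W"
proof (intro exI conjI)
  let ?W = "\<Union>p\<in>\<Phi>. \<Union>t\<in>Poly_Mapping.keys p. Poly_Mapping.keys t"
  show "finite \<Phi> \<Longrightarrow> finite ?W" by auto
  show "\<Phi> \<subseteq> polys_in ?W" unfolding polys_in_def by blast
qed

subsection \<open>Finite families closed under pseudo-division\<close>

definition coeffs_in :: "'a::comm_ring_1 set \<Rightarrow> 'a poly \<Rightarrow> bool" where
  "coeffs_in B p \<longleftrightarrow> (\<forall>i. coeff p i \<in> B)"

definition subring_set :: "'a::comm_ring_1 set \<Rightarrow> bool" where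
  "subring_set B \<longleftrightarrow> 0 \<in> B \<and> 1 \<in> B \<and> (\<forall>x\<in>B. \<forall>y\<in>B. x + y \<in> B \<and> x - y \<in> B \<and> x * y \<in> B)"

lemma subring_set_polys_in: "subring_set (polys_in V)"
  by (simp add: subring_set_def polys_in_0 polys_in_1 polys_in_add polys_in_diff polys_in_mult)

lemma subring_setD:
  assumes "subring_set B"
  shows "0 \<in> B" "1 \<in> B" "x \<in> B \<Longrightarrow> y \<in> B \<Longrightarrow> x + y \<in> B" "x \<in> B \<Longrightarrow> y \<in> B \<Longrightarrow> x - y \<in> B" "x \<in> B \<Longrightarrow> y \<in> B \<Longrightarrow> x * y \<in> B"
    "of_nat n \<in> B"
proof -
  show z: "0 \<in> B" "1 \<in> B" and add: "x \<in> B \<Longrightarrow> y \<in> B \<Longrightarrow> x + y \<in> B" and "x \<in> B \<Longrightarrow> y \<in> B \<Longrightarrow> x - y \<in> B" "x \<in> B \<Longrightarrow> y \<in> B \<Longrightarrow> x * y \<in> B" for x y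
    using assms unfolding subring_set_def by auto
  show "of_nat n \<in> B" by (induction n) (simp_all add: z add)
qed

lemma coeffs_in_ops:
  assumes B: "subring_set B"
  shows "coeffs_in B p \<Longrightarrow> coeffs_in B q \<Longrightarrow> coeffs_in B (p + q)" "coeffs_in B p \<Longrightarrow> coeffs_in B q \<Longrightarrow> coeffs_in B (p - q)"
    "c \<in> B \<Longrightarrow> coeffs_in B p \<Longrightarrow> coeffs_in B (smult c p)" "c \<in> B \<Longrightarrow> coeffs_in B (monom c n)"
    "coeffs_in B p \<Longrightarrow> coeffs_in B q \<Longrightarrow> coeffs_in B (p * q)" "coeffs_in B p \<Longrightarrow> coeffs_in B (formal_deriv p)"
    "coeffs_in B p \<Longrightarrow> coeffs_in B (drop_lead p)"
proof -
  note D = subring_setD[OF B]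
  show "coeffs_in B p \<Longrightarrow> coeffs_in B q \<Longrightarrow> coeffs_in B (p + q)" unfolding coeffs_in_def by (simp add: D)
  show diff: "coeffs_in B p \<Longrightarrow> coeffs_in B q \<Longrightarrow> coeffs_in B (p - q)" for p q unfolding coeffs_in_def by (simp add: D)
  show "c \<in> B \<Longrightarrow> coeffs_in B p \<Longrightarrow> coeffs_in B (smult c p)" unfolding coeffs_in_def by (simp add: D)
  show mon: "c \<in> B \<Longrightarrow> coeffs_in B (monom c n)" for c n unfolding coeffs_in_def by (simp add: D)
  have sum: "(\<And>i. i \<in> A \<Longrightarrow> h i \<in> B) \<Longrightarrow> sum h A \<in> B" for h and A :: "nat set"
    by (induction A rule: infinite_finite_induct) (simp_all add: D)
  show "coeffs_in B p \<Longrightarrow> coeffs_in B q \<Longrightarrow> coeffs_in B (p * q)" unfolding coeffs_in_def coeff_mult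
    by (intro allI sum) (simp add: D)
  show "coeffs_in B p \<Longrightarrow> coeffs_in B (formal_deriv p)" unfolding coeffs_in_def by (simp add: coeff_formal_deriv D del: of_nat_Suc)
  show "coeffs_in B p \<Longrightarrow> coeffs_in B (drop_lead p)" unfolding drop_lead_def by (intro diff mon) (simp_all add: coeffs_in_def)
qed

text \<open>Multiplying by the leading coefficient of \<open>q\<close> in each step avoids division.
  That coefficients stay in \<open>B\<close> is recorded because elimination needs them to be free
  of the eliminated variable.\<close>

lemma pseudo_remainder_exists:
  assumes B: "subring_set B" and q: "coeffs_in B q" "0 < degree q"
  shows "coeffs_in B p \<Longrightarrow> \<exists>r k s. coeffs_in B r \<and> degree r < degree q \<and> smult (lead_coeff q ^ k) p = q * s + r"
proof (induction "degree p" arbitrary: p rule: less_induct)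
  case less
  show ?case
  proof (cases "degree p < degree q")
    case True
    then show ?thesis using less(2) by (intro exI[of _ p] exI[of _ 0] exI[of _ 0]) simp
  next
    case False
    define m where "m = monom (lead_coeff p) (degree p - degree q)"
    define p1 where "p1 = smult (lead_coeff q) p - m * q"
    have lcB: "lead_coeff q \<in> B" "lead_coeff p \<in> B" using q less(2) unfolding coeffs_in_def by auto
    have cm: "coeff (m * q) i = (if i < degree p - degree q then 0 else lead_coeff p * coeff q (i - (degree p - degree q)))" for i
      unfolding m_def by (simp add: coeff_monom_mult)
    have "coeff p1 i = 0" if "degree p - 1 < i" for i
    proof (cases "i = degree p")
      case True
      then show ?thesis using False q(2) unfolding p1_def by (simp add: cm)
    next
      case neq: False
      then have "degree p < i" "degree q < i - (degree p - degree q)" using that False q(2) by auto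
      then show ?thesis unfolding p1_def by (simp add: cm coeff_eq_0)
    qed
    then have "degree p1 \<le> degree p - 1" by (intro degree_le) auto
    then have d1: "degree p1 < degree p" using False q(2) by linarith
    have "coeffs_in B p1" unfolding p1_def m_def by (intro coeffs_in_ops[OF B] lcB less(2) q)
    from less(1)[OF d1 this] obtain r k s where r: "coeffs_in B r" "degree r < degree q" "smult (lead_coeff q ^ k) p1 = q * s + r" by blast
    have "smult (lead_coeff q ^ Suc k) p = smult (lead_coeff q ^ k) (p1 + m * q)" unfolding p1_def by (simp add: mult.commute)
    also have "\<dots> = q * (s + smult (lead_coeff q ^ k) m) + r" using r(3) by (simp add: smult_add_right algebra_simps)
    finally show ?thesis using r(1,2) by blast
  qed
qed

text \<open>The closure is built from the top degree downwards: after \<open>j\<close> stages it is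
  closed at all degrees above \<open>D - j\<close>. The elements added while treating degree
  \<open>m\<close> have degree below \<open>m\<close>, so they do not disturb the degrees already
  treated, and each stage adds finitely many.\<close>

lemma closed_family_exists:
  assumes B: "subring_set B" and fin: "finite \<Phi>" and \<Phi>: "\<forall>p\<in>\<Phi>. coeffs_in B p"
  obtains F where "finite F" "\<Phi> \<subseteq> F" "\<forall>p\<in>F. coeffs_in B p"
    "\<And>p. p \<in> F \<Longrightarrow> 0 < degree p \<Longrightarrow> formal_deriv p \<in> F \<and> drop_lead p \<in> F"
    "\<And>p q. p \<in> F \<Longrightarrow> q \<in> F \<Longrightarrow> 0 < degree q \<Longrightarrow> degree q \<le> degree p \<Longrightarrow>
      \<exists>r\<in>F. \<exists>k s. degree r < degree q \<and> smult (lead_coeff q ^ k) p = q * s + r"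
proof -
  define D where "D = Max (insert 0 (degree ` \<Phi>))"
  have D: "degree p \<le> D" if "p \<in> \<Phi>" for p unfolding D_def using fin that by (intro Max_ge) auto
  \<comment> \<open>One remainder is fixed for each pair; this keeps the family finite.\<close>
  have "\<forall>p q. \<exists>r. coeffs_in B p \<and> coeffs_in B q \<and> 0 < degree q \<longrightarrow>
      coeffs_in B r \<and> degree r < degree q \<and> (\<exists>k s. smult (lead_coeff q ^ k) p = q * s + r)"
    using pseudo_remainder_exists[OF B] by meson
  then obtain rm where rm: "\<And>p q. coeffs_in B p \<Longrightarrow> coeffs_in B q \<Longrightarrow> 0 < degree q \<Longrightarrow>
      coeffs_in B (rm p q) \<and> degree (rm p q) < degree q \<and> (\<exists>k s. smult (lead_coeff q ^ k) p = q * s + rm p q)"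
    by metis
  have "\<exists>F. finite F \<and> \<Phi> \<subseteq> F \<and> (\<forall>p\<in>F. coeffs_in B p \<and> degree p \<le> D) \<and>
      (\<forall>p\<in>F. D - j < degree p \<longrightarrow> formal_deriv p \<in> F \<and> drop_lead p \<in> F) \<and>
      (\<forall>p\<in>F. \<forall>q\<in>F. D - j < degree q \<longrightarrow> degree q \<le> degree p \<longrightarrow> rm p q \<in> F)" for j
  proof (induction j)
    case 0
    show ?case using fin \<Phi> D by (intro exI[of _ \<Phi>]) fastforce
  next
    case (Suc j)
    then obtain F where F: "finite F" "\<Phi> \<subseteq> F" "\<And>p. p \<in> F \<Longrightarrow> coeffs_in B p \<and> degree p \<le> D"
      "\<And>p. p \<in> F \<Longrightarrow> D - j < degree p \<Longrightarrow> formal_deriv p \<in> F \<and> drop_lead p \<in> F"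
      "\<And>p q. p \<in> F \<Longrightarrow> q \<in> F \<Longrightarrow> D - j < degree q \<Longrightarrow> degree q \<le> degree p \<Longrightarrow> rm p q \<in> F" by metis
    show ?case
    proof (cases "D - j = 0")
      case True
      then have "D - Suc j = D - j" by simp
      then show ?thesis using Suc by simp
    next
      case False
      define m where "m = D - j"
      have m: "0 < m" "m \<le> D" "D - Suc j < k \<longleftrightarrow> m \<le> k" for k using False unfolding m_def by auto
      define N where "N = formal_deriv ` {p\<in>F. degree p = m} \<union> drop_lead ` {p\<in>F. degree p = m} \<union>
        (\<lambda>(p, q). rm p q) ` (F \<times> {q\<in>F. degree q = m})"
      have N: "coeffs_in B p \<and> degree p < m" if "p \<in> N" for p
        using that unfolding N_def using F(3) m(1) coeffs_in_ops(6,7)[OF B] degree_formal_deriv degree_drop_lead rm by fastforce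
      have "finite (F \<union> N)" unfolding N_def using F(1) by auto
      moreover have "\<Phi> \<subseteq> F \<union> N" using F(2) by blast
      moreover have "\<forall>p\<in>F \<union> N. coeffs_in B p \<and> degree p \<le> D" using F(3) N m(2) by fastforce
      moreover have "formal_deriv p \<in> F \<union> N \<and> drop_lead p \<in> F \<union> N" if p: "p \<in> F \<union> N" "m \<le> degree p" for p
      proof -
        have pF: "p \<in> F" using p N by force
        show ?thesis
        proof (cases "degree p = m")
          case True
          then show ?thesis unfolding N_def using pF by blast
        next
          case False
          then show ?thesis using F(4)[OF pF] p(2) unfolding m_def by auto
        qed
      qed
      moreover have "rm p q \<in> F \<union> N" if p: "p \<in> F \<union> N" "q \<in> F \<union> N" "m \<le> degree q" "degree q \<le> degree p" for p q
      proof -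
        have pF: "p \<in> F" "q \<in> F" using p N by force+
        show ?thesis
        proof (cases "degree q = m")
          case True
          then show ?thesis unfolding N_def using pF by blast
        next
          case False
          then show ?thesis using F(5)[OF pF] p(3,4) unfolding m_def by auto
        qed
      qed
      ultimately show ?thesis unfolding m(3) by blast
    qed
  qed
  from this[of D] obtain F where F: "finite F" "\<Phi> \<subseteq> F" "\<forall>p\<in>F. coeffs_in B p \<and> degree p \<le> D"
      "\<forall>p\<in>F. 0 < degree p \<longrightarrow> formal_deriv p \<in> F \<and> drop_lead p \<in> F"
      "\<forall>p\<in>F. \<forall>q\<in>F. 0 < degree q \<longrightarrow> degree q \<le> degree p \<longrightarrow> rm p q \<in> F" by auto
  show ?thesis
  proof (rule that[OF F(1,2)])
    show "\<forall>p\<in>F. coeffs_in B p" using F(3) by blast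
    show "\<And>p. p \<in> F \<Longrightarrow> 0 < degree p \<Longrightarrow> formal_deriv p \<in> F \<and> drop_lead p \<in> F" using F(4) by blast
    show "\<exists>r\<in>F. \<exists>k s. degree r < degree q \<and> smult (lead_coeff q ^ k) p = q * s + r"
      if "p \<in> F" "q \<in> F" "0 < degree q" "degree q \<le> degree p" for p q
      using F(3,5) rm[of p q] that by blast
  qed
qed

subsection \<open>Transfer of sign conditions to real points\<close>

text \<open>The coefficients remain in the type of all multivariate polynomials, so the induction
  over the set of variables involves no change of type.\<close>

lemma univariate_form:
  assumes "p \<in> polys_in (insert v W)"
  shows "\<exists>P. coeffs_in (polys_in W) P \<and> poly P (Var v) = p"
  using assms
proof (induction rule: polys_in_induct)
  case (Const c)
  show ?case by (intro exI[of _ "[:Const c:]"]) (auto simp: coeffs_in_def coeff_pCons polys_in_Const polys_in_0 split: nat.split)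
next
  case (Var w)
  show ?case
  proof (cases "w = v")
    case True
    then show ?thesis
      by (intro exI[of _ "[:0, 1:]"]) (auto simp: coeffs_in_def coeff_pCons polys_in_0 polys_in_1 split: nat.split)
  next
    case False
    then show ?thesis using Var
      by (intro exI[of _ "[:Var w:]"]) (auto simp: coeffs_in_def coeff_pCons polys_in_0 polys_in_Var split: nat.split)
  qed
next
  case (add p q)
  then obtain P Q where "coeffs_in (polys_in W) P" "poly P (Var v) = p" "coeffs_in (polys_in W) Q" "poly Q (Var v) = q" by blast
  then show ?case using coeffs_in_ops(1)[OF subring_set_polys_in] by (intro exI[of _ "P + Q"]) auto
next
  case (mult p q)
  then obtain P Q where "coeffs_in (polys_in W) P" "poly P (Var v) = p" "coeffs_in (polys_in W) Q" "poly Q (Var v) = q" by blast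
  then show ?case using coeffs_in_ops(5)[OF subring_set_polys_in] by (intro exI[of _ "P * Q"]) auto
qed

lemma ring_hom_poly:
  assumes "is_ring_hom \<theta>"
  shows "\<theta> (poly P x) = poly (map_poly \<theta> P) (\<theta> x)"
  by (induction P) (simp_all add: map_poly_pCons is_ring_homD[OF assms])

text \<open>A positive constant is a square, so its image is nonnegative, and it is a unit, so its
  image is nonzero.\<close>

lemma sg_Const:
  fixes \<theta> :: "'v mpoly \<Rightarrow> 'f::linordered_field"
  assumes "is_ring_hom \<theta>"
  shows "sg (\<theta> (Const c)) = sg c"
proof -
  note h = is_ring_homD[OF assms]
  have pos: "0 < \<theta> (Const c)" if "0 < c" for c
  proof -
    have "Const c = Const (sqrt c) * Const (sqrt c)" using that by (simp add: Const_simps(4)[symmetric])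
    then have "0 \<le> \<theta> (Const c)" using h(3) by (metis zero_le_square)
    moreover have "\<theta> (Const c) * \<theta> (Const (1 / c)) = 1"
      using that by (simp add: h(3)[symmetric] Const_simps(4)[symmetric] Const_simps(2) h(1))
    ultimately show ?thesis by (metis mult_zero_left order_le_less zero_neq_one)
  qed
  consider "0 < c" | "c = 0" | "0 < - c" by linarith
  then show ?thesis
  proof cases
    case 3
    have "\<theta> (Const (- c)) = - \<theta> (Const c)" by (simp add: Const_simps h)
    then have "\<theta> (Const c) < 0" using pos[OF 3] by simp
    then show ?thesis using 3 by (metis neg_0_less_iff_less sg_simps(6))
  qed (use pos in \<open>auto simp: Const_simps h, metis sg_simps(5)\<close>)
qed

text \<open>One variable is eliminated at a time. The induction hypothesis realizes the signs of all
  coefficients of a closed family by a real assignment \<open>a\<close>;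
  \<open>sign_transfer\<close>, started at the image of \<open>Var v\<close>, then supplies the real
  value for \<open>v\<close>.\<close>

lemma sg_realized:
  fixes \<theta> :: "'v mpoly \<Rightarrow> 'f::real_closed_field"
  assumes \<theta>: "is_ring_hom \<theta>" and "finite W"
  shows "finite \<Phi> \<Longrightarrow> \<Phi> \<subseteq> polys_in W \<Longrightarrow> \<exists>a. \<forall>p\<in>\<Phi>. sg (\<theta> p) = sg (poly_eval a p)"
  using \<open>finite W\<close>
proof (induction W arbitrary: \<Phi> rule: finite_induct)
  case empty
  have "\<exists>c. p = Const c" if p: "p \<in> polys_in {}" for p :: "'v mpoly"
    using p by (induction rule: polys_in_induct) (auto simp: Const_simps(3,4)[symmetric])
  then have "sg (\<theta> p) = sg (poly_eval (\<lambda>_. 0) p)" if "p \<in> \<Phi>" for p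
    using that empty(2) sg_Const[OF \<theta>] by fastforce
  then show ?case by blast
next
  case (insert v W)
  have "\<forall>p\<in>\<Phi>. \<exists>P. coeffs_in (polys_in W) P \<and> poly P (Var v) = p"
    using insert(5) by (auto intro!: univariate_form)
  then obtain up where up: "\<And>p. p \<in> \<Phi> \<Longrightarrow> coeffs_in (polys_in W) (up p) \<and> poly (up p) (Var v) = p" by metis
  have "finite (up ` \<Phi>)" "\<forall>P\<in>up ` \<Phi>. coeffs_in (polys_in W) P" using insert(4) up by auto
  from closed_family_exists[OF subring_set_polys_in this] obtain F where F: "finite F" "up ` \<Phi> \<subseteq> F" "\<forall>p\<in>F. coeffs_in (polys_in W) p"
    "\<And>p. p \<in> F \<Longrightarrow> 0 < degree p \<Longrightarrow> formal_deriv p \<in> F \<and> drop_lead p \<in> F"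
    "\<And>p q. p \<in> F \<Longrightarrow> q \<in> F \<Longrightarrow> 0 < degree q \<Longrightarrow> degree q \<le> degree p \<Longrightarrow>
      \<exists>r\<in>F. \<exists>k s. degree r < degree q \<and> smult (lead_coeff q ^ k) p = q * s + r" by blast
  define \<Psi> where "\<Psi> = (\<Union>p\<in>F. coeff p ` {..degree p})"
  have "finite \<Psi>" "\<Psi> \<subseteq> polys_in W" unfolding \<Psi>_def using F(1,3) by (auto simp: coeffs_in_def)
  from insert(3)[OF this] obtain a where a: "\<And>c. c \<in> \<Psi> \<Longrightarrow> sg (\<theta> c) = sg (poly_eval a c)" by blast
  have sign: "sg (\<theta> (coeff p i)) = sg (poly_eval a (coeff p i))" if "p \<in> F" for p i
  proof (cases "i \<le> degree p")
    case True
    then show ?thesis using that by (intro a) (auto simp: \<Psi>_def)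
  next
    case False
    then show ?thesis by (simp add: coeff_eq_0 is_ring_homD(4)[OF \<theta>] poly_eval_zero)
  qed
  interpret sign_family \<theta> "poly_eval a" F
  proof (rule sign_family.intro)
    show "is_ring_hom \<theta>" by (fact \<theta>)
    show "is_ring_hom (poly_eval a)" by (fact is_ring_hom_poly_eval)
    show "finite F" by (fact F(1))
    show "formal_deriv p \<in> F" "drop_lead p \<in> F" if "p \<in> F" "0 < degree p" for p using F(4)[OF that] by simp_all
    show "sg (\<theta> (coeff p i)) = sg (poly_eval a (coeff p i))" if "p \<in> F" for p i using sign[OF that] .
  qed (fact F(5))
  obtain u where u: "\<And>P. P \<in> F \<Longrightarrow> sg (poly (map_poly \<theta> P) (\<theta> (Var v))) = sg (poly (map_poly (poly_eval a) P) u)"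
    using sign_transfer by blast
  have "sg (\<theta> p) = sg (poly_eval (a(v := u)) p)" if p: "p \<in> \<Phi>" for p
  proof -
    have "map_poly (poly_eval (a(v := u))) (up p) = map_poly (poly_eval a) (up p)"
    proof (rule poly_eqI)
      fix i
      have "coeff (up p) i \<in> polys_in W" using up[OF p] unfolding coeffs_in_def by blast
      then have "poly_eval (a(v := u)) (coeff (up p) i) = poly_eval a (coeff (up p) i)"
        using insert(2) by (intro poly_eval_cong) auto
      then show "coeff (map_poly (poly_eval (a(v := u))) (up p)) i = coeff (map_poly (poly_eval a) (up p)) i"
        by (simp add: map_poly_ring_hom(4)[OF is_ring_hom_poly_eval])
    qed
    moreover have "\<theta> p = poly (map_poly \<theta> (up p)) (\<theta> (Var v))" using ring_hom_poly[OF \<theta>] up[OF p] by metis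
    moreover have "poly_eval (a(v := u)) p = poly (map_poly (poly_eval (a(v := u))) (up p)) u"
      using ring_hom_poly[OF is_ring_hom_poly_eval, of "a(v := u)" "up p" "Var v"] up[OF p] by simp
    ultimately show ?thesis using u[of "up p"] F(2) p by auto
  qed
  then show ?case by blast
qed

subsection \<open>Prime cones are realized by real points\<close>

text \<open>Density of the real points in the real spectrum with its constructible topology:
  finitely many membership conditions on the cone can be met by a point.\<close>

definition realizable :: "'v mpoly set \<Rightarrow> bool" where
  "realizable P \<longleftrightarrow> (\<forall>\<Phi>. finite \<Phi> \<longrightarrow> (\<exists>a. \<forall>p\<in>\<Phi>. p \<in> P \<longleftrightarrow> 0 \<le> poly_eval a p))"

text \<open>The residue field of a prime cone \<open>P\<close> cannot be a type depending on \<open>P\<close>. It is therefore only built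
  for one cone, chosen to be a counterexample to realizability if there is any.\<close>

definition test_cone :: "'v mpoly set" where
  "test_cone = (if \<exists>P::'v mpoly set. prime_cone P \<and> \<not> realizable P then SOME P. prime_cone P \<and> \<not> realizable P
     else {p. 0 \<le> poly_eval (\<lambda>_. 0) p})"

text \<open>If there is no counterexample, the default is the cone of polynomials nonnegative at the
  origin.\<close>

lemma prime_cone_test_cone: "prime_cone (test_cone :: 'v mpoly set)"
proof (cases "\<exists>P::'v mpoly set. prime_cone P \<and> \<not> realizable P")
  case True
  then show ?thesis unfolding test_cone_def using someI_ex[OF True] by simp
next
  case False
  have "prime_cone {p :: 'v mpoly. 0 \<le> poly_eval (\<lambda>_. 0) p}"
    unfolding prime_cone_def ring_preordering_def by (auto simp: poly_eval_simps antisym)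
  then show ?thesis unfolding test_cone_def if_not_P[OF False] .
qed

lemma realizable_if_test_cone:
  assumes "realizable (test_cone :: 'v mpoly set)" "prime_cone (P :: 'v mpoly set)"
  shows "realizable P"
proof (rule ccontr)
  assume "\<not> realizable P"
  then have ex: "\<exists>P::'v mpoly set. prime_cone P \<and> \<not> realizable P" using assms(2) by blast
  then have "\<not> realizable (test_cone :: 'v mpoly set)" unfolding test_cone_def using someI_ex[OF ex] by simp
  then show False using assms(1) by simp
qed

section \<open>The residue ring of the chosen cone and its order\<close>

lemmas test_coneD = prime_coneD[OF prime_cone_test_cone]

definition residue_rel :: "'v mpoly \<Rightarrow> 'v mpoly \<Rightarrow> bool" where
  "residue_rel p q \<longleftrightarrow> p - q \<in> test_cone \<and> q - p \<in> test_cone"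

lemma residue_rel_mult:
  assumes "residue_rel p q" shows "residue_rel (p * r) (q * r)"
proof -
  have "p - q \<in> test_cone" "- (p - q) \<in> test_cone" using assms unfolding residue_rel_def by auto
  from prime_cone_support_mult[OF prime_cone_test_cone this, of r] show ?thesis
    unfolding residue_rel_def by (simp add: left_diff_distrib)
qed

lemma residue_rel_trans: "residue_rel p q \<Longrightarrow> residue_rel q r \<Longrightarrow> residue_rel p r"
  unfolding residue_rel_def using test_coneD(1)[of "p - q" "q - r"] test_coneD(1)[of "r - q" "q - p"] by auto

lemma residue_rel_cone: "residue_rel p q \<Longrightarrow> p \<in> test_cone \<Longrightarrow> q \<in> test_cone"
  unfolding residue_rel_def using test_coneD(1)[of "q - p" p] by auto

quotient_type 'v residue = "'v mpoly" / residue_rel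
  morphisms residue_rep residue_class
proof (rule equivpI)
  show "reflp residue_rel" by (rule reflpI) (simp add: residue_rel_def test_coneD)
  show "symp residue_rel" by (rule sympI) (auto simp: residue_rel_def)
  show "transp residue_rel" by (rule transpI) (rule residue_rel_trans)
qed

instantiation residue :: (type) comm_ring_1
begin

lift_definition zero_residue :: "'a residue" is 0 .
lift_definition one_residue :: "'a residue" is 1 .
lift_definition plus_residue :: "'a residue \<Rightarrow> 'a residue \<Rightarrow> 'a residue" is plus
proof -
  fix p p' q q' :: "'a mpoly" assume "residue_rel p p'" "residue_rel q q'"
  then show "residue_rel (p + q) (p' + q')" unfolding residue_rel_def
    using test_coneD(1)[of "p - p'" "q - q'"] test_coneD(1)[of "p' - p" "q' - q"] by (simp add: algebra_simps)
qed
lift_definition uminus_residue :: "'a residue \<Rightarrow> 'a residue" is uminus by (auto simp: residue_rel_def)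
lift_definition minus_residue :: "'a residue \<Rightarrow> 'a residue \<Rightarrow> 'a residue" is minus
proof -
  fix p p' q q' :: "'a mpoly" assume "residue_rel p p'" "residue_rel q q'"
  then show "residue_rel (p - q) (p' - q')" unfolding residue_rel_def
    using test_coneD(1)[of "p - p'" "q' - q"] test_coneD(1)[of "p' - p" "q - q'"] by (simp add: algebra_simps)
qed
lift_definition times_residue :: "'a residue \<Rightarrow> 'a residue \<Rightarrow> 'a residue" is times
proof -
  fix p p' q q' :: "'a mpoly" assume "residue_rel p p'" "residue_rel q q'"
  then show "residue_rel (p * q) (p' * q')"
    using residue_rel_mult[of p p' q] residue_rel_mult[of q q' p'] residue_rel_trans by (metis mult.commute)
qed
instance
proof
  have rr: "residue_rel p p" for p :: "'a mpoly" by (simp add: residue_rel_def test_coneD)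
  fix a b c :: "'a residue"
  show "a + b + c = a + (b + c)" by transfer (simp add: algebra_simps rr)
  show "a + b = b + a" by transfer (simp add: algebra_simps rr)
  show "0 + a = a" by transfer (simp add: rr)
  show "- a + a = 0" by transfer (simp add: rr)
  show "a - b = a + - b" by transfer (simp add: rr)
  show assoc: "a * b * c = a * (b * c)" by transfer (simp add: algebra_simps rr)
  show comm: "a * b = b * a" by transfer (simp add: algebra_simps rr)
  show "1 * a = a" by transfer (simp add: rr)
  show "(a + b) * c = a * c + b * c" by transfer (simp add: algebra_simps rr)
  show "(0::'a residue) \<noteq> 1" by transfer (simp add: residue_rel_def test_coneD)
qed

end

instantiation residue :: (type) linordered_idom
begin

lift_definition less_eq_residue :: "'a residue \<Rightarrow> 'a residue \<Rightarrow> bool" is "\<lambda>p q. q - p \<in> test_cone"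
proof -
  fix p p' q q' :: "'a mpoly" assume "residue_rel p p'" "residue_rel q q'"
  then have "residue_rel (q - p) (q' - p')" "residue_rel (q' - p') (q - p)" unfolding residue_rel_def
    using test_coneD(1)[of "p - p'" "q' - q"] test_coneD(1)[of "p' - p" "q - q'"] by (simp_all add: algebra_simps)
  then show "q - p \<in> test_cone \<longleftrightarrow> q' - p' \<in> test_cone" using residue_rel_cone by blast
qed
definition less_residue :: "'a residue \<Rightarrow> 'a residue \<Rightarrow> bool" where
  "less_residue x y \<longleftrightarrow> x \<le> y \<and> x \<noteq> y"
definition abs_residue :: "'a residue \<Rightarrow> 'a residue" where
  "abs_residue x = (if x < 0 then - x else x)"
definition sgn_residue :: "'a residue \<Rightarrow> 'a residue" where
  "sgn_residue x = (if x = 0 then 0 else if 0 < x then 1 else - 1)"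

instance
proof
  fix a b c :: "'a residue"
  have zero_div: "x * y = 0 \<Longrightarrow> x = 0 \<or> y = 0" for x y :: "'a residue"
    by transfer (use test_coneD(8) in \<open>auto simp: residue_rel_def\<close>)
  show refl: "a \<le> a" by transfer (simp add: test_coneD)
  show "a \<le> b \<Longrightarrow> b \<le> c \<Longrightarrow> a \<le> c"
  proof transfer
    fix p q r :: "'a mpoly" assume "q - p \<in> test_cone" "r - q \<in> test_cone"
    then show "r - p \<in> test_cone" using test_coneD(1)[of "r - q" "q - p"] by simp
  qed
  show antisym: "a \<le> b \<Longrightarrow> b \<le> a \<Longrightarrow> a = b" by transfer (simp add: residue_rel_def)
  show "(a < b) = (a \<le> b \<and> \<not> b \<le> a)" unfolding less_residue_def using refl antisym by blast
  show "a \<le> b \<or> b \<le> a"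
  proof transfer
    fix p q :: "'a mpoly"
    show "q - p \<in> test_cone \<or> p - q \<in> test_cone" using test_coneD(7)[of "q - p"] by simp
  qed
  show "a \<le> b \<Longrightarrow> c + a \<le> c + b" by transfer (simp add: algebra_simps)
  show "\<bar>a\<bar> = (if a < 0 then - a else a)" by (rule abs_residue_def)
  show "sgn a = (if a = 0 then 0 else if 0 < a then 1 else - 1)" by (rule sgn_residue_def)
  assume ab: "a < b" and c: "0 < c"
  have "c * a \<le> c * b" using ab c unfolding less_residue_def
  proof (elim conjE, transfer)
    fix p q r :: "'a mpoly" assume "q - p \<in> test_cone" "r - 0 \<in> test_cone"
    then show "r * q - r * p \<in> test_cone" using test_coneD(2)[of r "q - p"] by (simp add: algebra_simps)
  qed
  moreover have "c * a \<noteq> c * b"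
  proof
    assume "c * a = c * b"
    then have "c * (b + - a) = 0" by transfer (simp add: residue_rel_def algebra_simps)
    then have "b + - a = 0" using zero_div c unfolding less_residue_def by blast
    then have "a = b" by transfer (simp add: residue_rel_def)
    then show False using ab unfolding less_residue_def by simp
  qed
  ultimately show "c * a < c * b" unfolding less_residue_def by simp
qed

end

lemma residue_class_hom: "is_ring_hom residue_class" "0 \<le> residue_class p \<longleftrightarrow> p \<in> test_cone"
  unfolding is_ring_hom_def
  by (simp_all add: plus_residue.abs_eq times_residue.abs_eq one_residue_def zero_residue_def less_eq_residue.abs_eq)

text \<open>The homomorphism \<theta> passes from polynomials to the residue ring, its fraction
  field and the real closure of the latter. Every stage preserves and reflects nonnegativity, so
  membership in the cone is a sign condition on \<theta>, which \<open>sg_realized\<close> brings to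
  a real point.\<close>

theorem prime_cone_realizable:
  fixes P :: "'v mpoly set"
  assumes "prime_cone P"
  shows "realizable P"
proof -
  define \<theta> where "\<theta> = (\<lambda>p :: 'v mpoly. to_rc (Fract (residue_class p) 1))"
  note h = is_ring_homD[OF residue_class_hom(1)]
  have "Fract (x + y) 1 = Fract x 1 + Fract y 1" "Fract (x * y) 1 = Fract x 1 * Fract y 1" for x y :: "'v residue"
    by simp_all
  then have hom: "is_ring_hom \<theta>" unfolding is_ring_hom_def \<theta>_def
    by (simp only: h(1-3) to_rc_hom One_fract_def[symmetric] simp_thms)
  have nonneg: "0 \<le> \<theta> p \<longleftrightarrow> p \<in> test_cone" for p
    unfolding \<theta>_def to_rc_nonneg_iff by (simp add: zero_le_Fract_iff residue_class_hom(2))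
  have "realizable (test_cone :: 'v mpoly set)" unfolding realizable_def
  proof (intro allI impI)
    fix \<Phi> :: "'v mpoly set" assume fin: "finite \<Phi>"
    obtain W where W: "finite W" "\<Phi> \<subseteq> polys_in W" using finite_variables[OF fin] by blast
    obtain a where a: "\<And>p. p \<in> \<Phi> \<Longrightarrow> sg (\<theta> p) = sg (poly_eval a p)" using sg_realized[OF hom W(1) fin W(2)] by blast
    have "p \<in> test_cone \<longleftrightarrow> 0 \<le> poly_eval a p" if "p \<in> \<Phi>" for p
      unfolding nonneg[symmetric] using a[OF that] by (metis not_le sg_simps(6))
    then show "\<exists>a. \<forall>p\<in>\<Phi>. p \<in> test_cone \<longleftrightarrow> 0 \<le> poly_eval a p" by blast
  qed
  then show ?thesis using realizable_if_test_cone assms by blast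
qed

section \<open>The archimedean Positivstellensatz\<close>

definition module_over :: "'a::comm_ring_1 set \<Rightarrow> 'a set \<Rightarrow> bool" where
  "module_over S M \<longleftrightarrow> (\<forall>x\<in>M. \<forall>y\<in>M. x + y \<in> M) \<and> (\<forall>s\<in>S. \<forall>x\<in>M. s * x \<in> M) \<and> 1 \<in> M"

lemma module_overD:
  assumes "module_over S M"
  shows "x \<in> M \<Longrightarrow> y \<in> M \<Longrightarrow> x + y \<in> M" "s \<in> S \<Longrightarrow> x \<in> M \<Longrightarrow> s * x \<in> M" "1 \<in> M" "s \<in> S \<Longrightarrow> s \<in> M"
proof -
  show *: "s \<in> S \<Longrightarrow> x \<in> M \<Longrightarrow> s * x \<in> M" "1 \<in> M" for s x using assms unfolding module_over_def by simp_all
  show "s \<in> S \<Longrightarrow> s \<in> M" using *(1)[of s 1] *(2) by simp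
qed (use assms in \<open>simp add: module_over_def\<close>)

text \<open>For quadratic modules and preorderings the multipliers \<open>S\<close> are the sums of squares; for the cones
  \<open>C(g, 1 - g)\<close> they are the cone itself.\<close>

locale archimedean_module =
  fixes c :: "real \<Rightarrow> 'a::comm_ring_1" and S M :: "'a set"
  assumes c_hom: "is_ring_hom c"
    and S_add: "x \<in> S \<Longrightarrow> y \<in> S \<Longrightarrow> x + y \<in> S" and S_mult: "x \<in> S \<Longrightarrow> y \<in> S \<Longrightarrow> x * y \<in> S"
    and S_const: "0 \<le> r \<Longrightarrow> c r \<in> S"
    and M: "module_over S M"
    and arch: "\<exists>r. c r - x \<in> M"
    and generating: "\<exists>s\<in>S. \<exists>s'\<in>S. x = s - s'"
    and square: "s \<in> S \<Longrightarrow> \<exists>k0. \<forall>k\<ge>k0. (c k - s) * (c k - s) \<in> S"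
begin

lemmas c_simps = is_ring_homD[OF c_hom]

lemma adjoin_module:
  assumes "module_over S T"
  shows "module_over S {m + x * s | m s. m \<in> T \<and> s \<in> S}" "T \<subseteq> {m + x * s | m s. m \<in> T \<and> s \<in> S}" "x \<in> {m + x * s | m s. m \<in> T \<and> s \<in> S}"
proof -
  note TD = module_overD[OF assms]
  let ?T = "{m + x * s | m s. m \<in> T \<and> s \<in> S}"
  have S01: "0 \<in> S" "1 \<in> S" using S_const[of 0] S_const[of 1] by (simp_all add: c_simps)
  have T0: "0 \<in> T" using TD(4) S01 by blast
  show sub: "T \<subseteq> ?T"
  proof
    fix m assume "m \<in> T"
    moreover have "m = m + x * 0" by simp
    ultimately show "m \<in> ?T" using S01 by blast
  qed
  have "x = 0 + x * 1" by simp
  then show "x \<in> ?T" using S01 T0 by blast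
  show "module_over S ?T" unfolding module_over_def
  proof (intro conjI ballI)
    fix y z assume "y \<in> ?T" "z \<in> ?T"
    then obtain m s m' s' where e: "y = m + x * s" "z = m' + x * s'" "m \<in> T" "m' \<in> T" "s \<in> S" "s' \<in> S" by blast
    have "y + z = (m + m') + x * (s + s')" unfolding e(1,2) by (simp add: algebra_simps)
    then show "y + z \<in> ?T" using TD(1) S_add e(3-6) by blast
  next
    fix r y assume r: "r \<in> S" and "y \<in> ?T"
    then obtain m s where e: "y = m + x * s" "m \<in> T" "s \<in> S" by blast
    have "r * y = (r * m) + x * (r * s)" unfolding e(1) by (simp add: algebra_simps)
    then show "r * y \<in> ?T" using TD(2) S_mult e(2,3) r by blast
  next
    show "1 \<in> ?T" using sub TD(3) by blast
  qed
qed

text \<open>A maximal proper module \<open>T\<close> is total, and modulo its support every ring element is a real number.\<close>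

lemma hom_exists:
  assumes "- 1 \<notin> M"
  obtains \<phi> where "is_ring_hom \<phi>" "\<And>r. \<phi> (c r) = r" "\<And>x. x \<in> M \<Longrightarrow> 0 \<le> (\<phi> x :: real)"
proof -
  let ?A = "{T. module_over S T \<and> M \<subseteq> T \<and> - 1 \<notin> T}"
  have "\<exists>T\<in>?A. \<forall>U\<in>?A. T \<subseteq> U \<longrightarrow> U = T"
  proof (rule subset_Zorn_nonempty)
    show "?A \<noteq> {}" using M assms by blast
    fix \<C> assume C: "\<C> \<noteq> {}" "subset.chain ?A \<C>"
    then have el: "\<And>T. T \<in> \<C> \<Longrightarrow> module_over S T \<and> M \<subseteq> T \<and> - 1 \<notin> T" unfolding subset_chain_def by blast
    have "module_over S (\<Union>\<C>)" unfolding module_over_def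
    proof (intro conjI ballI)
      fix x y assume "x \<in> \<Union>\<C>" "y \<in> \<Union>\<C>"
      then obtain T where "T \<in> \<C>" "x \<in> T" "y \<in> T" using C(2) unfolding subset_chain_def by blast
      then show "x + y \<in> \<Union>\<C>" using el module_overD(1) by blast
    next
      fix s x assume "s \<in> S" "x \<in> \<Union>\<C>"
      then show "s * x \<in> \<Union>\<C>" using el module_overD(2) by blast
    next
      show "1 \<in> \<Union>\<C>" using C(1) el module_overD(3) by blast
    qed
    then show "\<Union>\<C> \<in> ?A" using C(1) el by blast
  qed
  then obtain T where T: "module_over S T" "M \<subseteq> T" "- 1 \<notin> T"
    and max: "\<And>U. module_over S U \<Longrightarrow> T \<subseteq> U \<Longrightarrow> - 1 \<notin> U \<Longrightarrow> U = T"
  proof -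
    assume r: "\<And>T. module_over S T \<Longrightarrow> M \<subseteq> T \<Longrightarrow> - 1 \<notin> T \<Longrightarrow>
      (\<And>U. module_over S U \<Longrightarrow> T \<subseteq> U \<Longrightarrow> - 1 \<notin> U \<Longrightarrow> U = T) \<Longrightarrow> thesis"
    assume "\<exists>T\<in>?A. \<forall>U\<in>?A. T \<subseteq> U \<longrightarrow> U = T"
    then obtain T where "T \<in> ?A" "\<forall>U\<in>?A. T \<subseteq> U \<longrightarrow> U = T" by blast
    then show thesis using r[of T] by (metis (mono_tags, lifting) mem_Collect_eq order_trans)
  qed
  note TD = module_overD[OF T(1)]
  have T0: "0 \<in> T" using TD(4) S_const[of 0] by (simp add: c_simps)
  define J where "J = {x. x \<in> T \<and> - x \<in> T}"
  have J_add: "x \<in> J \<Longrightarrow> y \<in> J \<Longrightarrow> x + y \<in> J" for x y unfolding J_def using TD(1)[of x y] TD(1)[of "- x" "- y"] by auto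
  have J_minus: "x \<in> J \<Longrightarrow> - x \<in> J" for x unfolding J_def by auto
  have J_S: "s \<in> S \<Longrightarrow> x \<in> J \<Longrightarrow> s * x \<in> J" for s x unfolding J_def using TD(2)[of s x] TD(2)[of s "- x"] by auto
  have J_mult: "x \<in> J \<Longrightarrow> y * x \<in> J" for x y
  proof -
    assume x: "x \<in> J"
    obtain s s' where s: "s \<in> S" "s' \<in> S" "y = s - s'" using generating by blast
    have "y * x = s * x + - (s' * x)" unfolding s(3) by (simp add: algebra_simps)
    moreover have "s * x \<in> J" "- (s' * x) \<in> J" using J_minus J_S x s(1,2) by blast+
    ultimately show "y * x \<in> J" using J_add by metis
  qed
  have total: "x \<in> T \<or> - x \<in> T" for x
  proof (rule ccontr)
    assume n: "\<not> ?thesis"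
    have adj: "\<exists>m\<in>T. \<exists>s\<in>S. - 1 = m + y * s" if "y \<notin> T" for y
    proof (rule ccontr)
      assume "\<not> ?thesis"
      then have "- 1 \<notin> {m + y * s | m s. m \<in> T \<and> s \<in> S}" by blast
      from max[OF adjoin_module(1,2)[OF T(1)] this] show False using adjoin_module(3)[OF T(1), of y] that by simp
    qed
    obtain m s where 1: "m \<in> T" "s \<in> S" "- 1 = m + x * s" using adj[of x] n by blast
    obtain m' s' where 2: "m' \<in> T" "s' \<in> S" "- 1 = m' + (- x) * s'" using adj[of "- x"] n by blast
    \<comment> \<open>Members of \<open>T\<close> may not be multiplied with each other, only by
      multipliers. Crosswise multiplication by s' and s cancels the terms with x and puts -s into
      \<open>T\<close>; then s and x s lie in the ideal \<open>J\<close>, and -1 = m + x s lies in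
      \<open>T\<close>.\<close>
    have "- s' = s' * m + x * s * s'" using arg_cong[OF 1(3), of "\<lambda>z. s' * z"] by (simp add: algebra_simps)
    moreover have "- s = s * m' - x * s * s'" using arg_cong[OF 2(3), of "\<lambda>z. s * z"] by (simp add: algebra_simps)
    ultimately have *: "- s + - s' = s * m' + s' * m" by simp
    have "- s = (- s + - s') + s'" by simp
    then have "- s = s * m' + s' * m + s'" unfolding * .
    then have "- s \<in> T" using TD(1,2,4) 1 2 by simp
    then have "s \<in> J" unfolding J_def using TD(4) 1 by simp
    then have "x * s \<in> J" by (rule J_mult)
    then have "- 1 \<in> T" unfolding 1(3) using TD(1) 1(1) unfolding J_def by blast
    with T(3) show False ..
  qed
  have c_T: "c r \<in> T \<longleftrightarrow> 0 \<le> r" for r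
  proof
    assume r: "c r \<in> T"
    show "0 \<le> r"
    proof (rule ccontr)
      assume n: "\<not> 0 \<le> r"
      then have "c (1 / - r) \<in> S" by (intro S_const) (simp add: field_simps)
      then have "c (1 / - r) * c r \<in> T" using TD(2) r by blast
      also have "c (1 / - r) * c r = - 1" using n by (simp add: c_simps(3)[symmetric] c_simps(5)[symmetric] c_simps(1)[symmetric])
      finally show False using T(3) by simp
    qed
  qed (use S_const TD(4) in blast)
  have bound: "\<exists>r>0. c r - x \<in> T" for x
  proof -
    obtain r where r: "c r - x \<in> T" using arch T(2) by blast
    have "c (max r 1) - x = c (max r 1 - r) + (c r - x)" by (simp add: c_simps)
    moreover have "c (max r 1 - r) \<in> T" using c_T by simp
    ultimately have "c (max r 1) - x \<in> T" using TD(1) r by metis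
    then show ?thesis by (intro exI[of _ "max r 1"]) auto
  qed
  \<comment> \<open>The closure of \<open>T\<close> with respect to small constants. By maximality
    it equals \<open>T\<close>, so limits of members stay in \<open>T\<close>; this makes the
    supremum below attained.\<close>
  define T' where "T' = {x. \<forall>\<epsilon>>0. x + c \<epsilon> \<in> T}"
  have "T' = T"
  proof (rule max)
    show "T \<subseteq> T'"
    proof
      fix x assume "x \<in> T"
      then show "x \<in> T'" unfolding T'_def using TD(1) c_T by simp
    qed
    show "- 1 \<notin> T'"
    proof
      assume "- 1 \<in> T'"
      then have "- 1 + c (1/2) \<in> T" unfolding T'_def by simp
      moreover have "- 1 + c (1/2) = c (- 1 + 1/2)" by (simp only: c_simps)
      ultimately show False using c_T by simp
    qed
    show "module_over S T'" unfolding module_over_def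
    proof (intro conjI ballI)
      fix x y assume x: "x \<in> T'" and y: "y \<in> T'"
      show "x + y \<in> T'" unfolding T'_def
      proof (intro CollectI allI impI)
        fix \<epsilon> :: real assume "\<epsilon> > 0"
        then have "x + c (\<epsilon> / 2) \<in> T" "y + c (\<epsilon> / 2) \<in> T" using x y unfolding T'_def by simp_all
        then have "(x + c (\<epsilon> / 2)) + (y + c (\<epsilon> / 2)) \<in> T" by (rule TD(1))
        also have "(x + c (\<epsilon> / 2)) + (y + c (\<epsilon> / 2)) = x + y + c (\<epsilon> / 2 + \<epsilon> / 2)" by (simp only: c_simps algebra_simps)
        finally show "x + y + c \<epsilon> \<in> T" by simp
      qed
    next
      fix s x assume s: "s \<in> S" and x: "x \<in> T'"
      show "s * x \<in> T'" unfolding T'_def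
      proof (intro CollectI allI impI)
        fix \<epsilon> :: real assume e: "\<epsilon> > 0"
        \<comment> \<open>A bound for the multiplier \<open>s\<close>: a perturbation of x by
          \<epsilon>/r becomes one of at most \<epsilon> after multiplication by s.\<close>
        obtain r where r: "r > 0" "c r - s \<in> T" using bound by blast
        have "s * (x + c (\<epsilon> / r)) \<in> T" using TD(2) s x e r unfolding T'_def by simp
        moreover have "c (\<epsilon> / r) * (c r - s) \<in> T" using TD(2) S_const e r by simp
        ultimately have "s * (x + c (\<epsilon> / r)) + c (\<epsilon> / r) * (c r - s) \<in> T" by (rule TD(1))
        also have "s * (x + c (\<epsilon> / r)) + c (\<epsilon> / r) * (c r - s) = s * x + c (\<epsilon> / r * r)"
          unfolding c_simps(3) by (simp add: algebra_simps)
        finally show "s * x + c \<epsilon> \<in> T" using r by simp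
      qed
    next
      show "1 \<in> T'" using \<open>T \<subseteq> T'\<close> TD(3) by blast
    qed
  qed
  have ex: "\<exists>r. x - c r \<in> J" for x
  proof -
    \<comment> \<open>The lower part of a Dedekind cut whose supremum is the real number represented
      by \<open>x\<close>; closedness of \<open>T\<close> gives one inequality, totality together
      with closedness the other.\<close>
    define R where "R = {r. x - c r \<in> T}"
    obtain b where b: "c b - x \<in> T" using bound by blast
    obtain b' where b': "c b' - (- x) \<in> T" using bound by blast
    then have ne: "- b' \<in> R" unfolding R_def by (simp add: c_simps add.commute)
    have up: "r \<le> b" if "r \<in> R" for r
    proof -
      have "(c b - x) + (x - c r) \<in> T" using TD(1) b that unfolding R_def by blast
      then have "c (b - r) \<in> T" by (simp add: c_simps)
      then show ?thesis using c_T by simp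
    qed
    then have bdd: "bdd_above R" by (auto simp: bdd_above_def)
    define r where "r = Sup R"
    have "x - c r + c \<epsilon> \<in> T" if e: "\<epsilon> > 0" for \<epsilon>
    proof -
      have "r - \<epsilon> < Sup R" unfolding r_def using e by simp
      then obtain r' where r': "r' \<in> R" "r - \<epsilon> < r'" using less_cSup_iff[OF _ bdd] ne by blast
      have "(x - c r') + c (r' - (r - \<epsilon>)) \<in> T" using TD(1) c_T r' unfolding R_def by simp
      then show ?thesis by (simp add: c_simps algebra_simps)
    qed
    then have 1: "x - c r \<in> T" using \<open>T' = T\<close> unfolding T'_def by blast
    have "c r - x + c \<epsilon> \<in> T" if e: "\<epsilon> > 0" for \<epsilon>
    proof -
      have "r + \<epsilon> \<notin> R"
      proof
        assume "r + \<epsilon> \<in> R"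
        then have "r + \<epsilon> \<le> r" unfolding r_def using bdd by (rule cSup_upper)
        then show False using e by simp
      qed
      then have "- (x - c (r + \<epsilon>)) \<in> T" using total unfolding R_def by blast
      then show ?thesis by (simp add: c_simps algebra_simps)
    qed
    then have 2: "c r - x \<in> T" using \<open>T' = T\<close> unfolding T'_def by blast
    show ?thesis using 1 2 unfolding J_def by (intro exI[of _ r]) simp
  qed
  have c_J: "r = 0" if "c r \<in> J" for r using that c_T[of r] c_T[of "- r"] unfolding J_def by (simp add: c_simps)
  obtain \<phi> where \<phi>: "\<And>x. x - c (\<phi> x) \<in> J" using ex by metis
  have uniq: "\<phi> x = r" if "x - c r \<in> J" for x r
  proof -
    have "(x - c r) + - (x - c (\<phi> x)) \<in> J" using J_add J_minus \<phi> that by blast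
    then have "c (\<phi> x - r) \<in> J" by (simp add: c_simps)
    then show ?thesis using c_J by fastforce
  qed
  show ?thesis
  proof (rule that[of \<phi>])
    have "0 \<in> J" unfolding J_def using T0 by simp
    then show c: "\<phi> (c r) = r" for r by (intro uniq) simp
    show "is_ring_hom \<phi>" unfolding is_ring_hom_def
    proof (intro conjI allI)
      show "\<phi> 1 = 1" using c[of 1] by (simp add: c_simps)
      fix x y
      have "(x - c (\<phi> x)) + (y - c (\<phi> y)) \<in> J" using J_add \<phi> by blast
      then show "\<phi> (x + y) = \<phi> x + \<phi> y" by (intro uniq) (simp add: c_simps algebra_simps)
      have "y * (x - c (\<phi> x)) + c (\<phi> x) * (y - c (\<phi> y)) \<in> J" using J_add J_mult \<phi> by blast
      then show "\<phi> (x * y) = \<phi> x * \<phi> y" by (intro uniq) (simp add: c_simps algebra_simps)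
    qed
    fix x assume "x \<in> M"
    then have "x + - (x - c (\<phi> x)) \<in> T" using TD(1) T(2) \<phi>[of x] unfolding J_def by blast
    then show "0 \<le> \<phi> x" using c_T by simp
  qed
qed

text \<open>If -1 were outside M - a S, \<open>hom_exists\<close> for that larger module would give
  a homomorphism with value at most 0 at \<open>a\<close>. So s a - 1 lies in \<open>M\<close> for
  some multiplier \<open>s\<close>. Division by \<open>s\<close> is impossible; instead a + r is
  lowered in steps of fixed length 1/k^2 until \<open>a\<close> itself is reached.\<close>

theorem positive_imp_mem:
  assumes pos: "\<And>\<phi>. is_ring_hom \<phi> \<Longrightarrow> (\<And>r. \<phi> (c r) = r) \<Longrightarrow> (\<And>x. x \<in> M \<Longrightarrow> 0 \<le> (\<phi> x :: real)) \<Longrightarrow> 0 < \<phi> a"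
  shows "a \<in> M"
proof -
  note MD = module_overD[OF M]
  have cM: "c r \<in> M" if "0 \<le> r" for r using S_const[OF that] MD(4) by blast
  let ?N = "{m + (- a) * s | m s. m \<in> M \<and> s \<in> S}"
  have "- 1 \<in> ?N"
  proof (rule ccontr)
    assume n: "- 1 \<notin> ?N"
    note adj = adjoin_module[OF M, of "- a"]
    have "archimedean_module c S ?N"
    proof (rule archimedean_module.intro)
      show "\<exists>r. c r - x \<in> ?N" for x using arch adj(2) by (meson subsetD)
    qed (fact c_hom S_add S_mult S_const adj(1) generating square)+
    then interpret N: archimedean_module c S ?N .
    obtain \<phi> :: "'a \<Rightarrow> real" where h: "is_ring_hom \<phi>" "\<And>r. \<phi> (c r) = r" "\<And>x. x \<in> ?N \<Longrightarrow> 0 \<le> \<phi> x" using N.hom_exists[OF n] by blast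
    have "0 < \<phi> a"
    proof (rule pos[OF h(1,2)])
      fix x assume "x \<in> M"
      then show "0 \<le> \<phi> x" by (intro h(3)) (rule subsetD[OF adj(2)])
    qed
    moreover have "0 \<le> \<phi> (- a)" by (rule h(3)[OF adj(3)])
    ultimately show False by (simp add: is_ring_homD[OF h(1)])
  qed
  then obtain m s where ms: "m \<in> M" "s \<in> S" "- 1 = m + (- a) * s" by blast
  then have sa: "s * a - 1 \<in> M" by (simp add: algebra_simps)
  obtain k0 where k0: "\<And>k. k \<ge> k0 \<Longrightarrow> (c k - s) * (c k - s) \<in> S" using square[OF ms(2)] by blast
  obtain k1 where k1: "c k1 - s \<in> M" using arch by blast
  obtain k2 where k2: "c k2 - (s * s * a + 1) \<in> M" using arch by blast
  \<comment> \<open>Beyond k0 the square of k - s is a multiplier, and k1 and k2 give 2k - s and 2k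
    - s^2 a - 1 in \<open>M\<close>; the bound 1 permits division by k^2.\<close>
  define k where "k = max (max k0 1) (max k1 k2)"
  have k: "k \<ge> k0" "k \<ge> 1" "k \<ge> k1" "k \<ge> k2" unfolding k_def by auto
  have "(c k1 - s) + c (2 * k - k1) \<in> M" using MD(1)[OF k1 cM] k by simp
  then have A: "c (2 * k) - s \<in> M" by (simp add: c_simps)
  have "(c k2 - (s * s * a + 1)) + c (2 * k - k2) \<in> M" using MD(1)[OF k2 cM] k by simp
  then have B: "c (2 * k) - s * s * a - 1 \<in> M" by (simp add: c_simps algebra_simps)
  have step: "a + c (r - 1 / k\<^sup>2) \<in> M" if r: "a + c r \<in> M" "0 \<le> r" for r
  proof -
    \<comment> \<open>Expanding (k - s)^2 (a + r) leaves the unwanted terms -2ksa, -2ksr, s^2 a and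
      s^2 r. The three further summands, all in \<open>M\<close>, cancel them, and k^2 (a + r) - 1
      remains.\<close>
    have "(c k - s) * (c k - s) * (a + c r) + c (2 * k) * (s * a - 1) + (c r * s * (c (2 * k) - s) + (c (2 * k) - s * s * a - 1)) \<in> M"
    proof (intro MD(1))
      show "(c k - s) * (c k - s) * (a + c r) \<in> M" using MD(2)[OF k0[OF k(1)] r(1)] .
      show "c (2 * k) * (s * a - 1) \<in> M" using k(2) by (intro MD(2)[OF S_const sa]) simp
      show "c r * s * (c (2 * k) - s) \<in> M" using MD(2)[OF S_mult[OF S_const[OF r(2)] ms(2)] A] .
    qed (fact B)
    also have "(c k - s) * (c k - s) * (a + c r) + c (2 * k) * (s * a - 1) + (c r * s * (c (2 * k) - s) + (c (2 * k) - s * s * a - 1))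
      = c k * c k * (a + c r) - 1"
      unfolding mult_2 c_simps(2) by (simp add: algebra_simps)
    finally have "c (1 / k\<^sup>2) * (c k * c k * (a + c r) - 1) \<in> M" using MD(2) S_const by simp
    moreover have "c (1 / k\<^sup>2) * (c k * c k * (a + c r) - 1) = c (1 / k\<^sup>2 * k * k) * (a + c r) - c (1 / k\<^sup>2)"
      unfolding c_simps by (simp add: algebra_simps)
    moreover have "1 / k\<^sup>2 * k * k = 1" using k by (simp add: power2_eq_square)
    ultimately show ?thesis by (simp add: c_simps algebra_simps)
  qed
  obtain r0 where r0: "c r0 - (- a) \<in> M" using arch by blast
  \<comment> \<open>The cut-off at 0 is there because a step may start only from a nonnegative
    \<open>r\<close>.\<close>
  have "a + c (max 0 (r0 - real n / k\<^sup>2)) \<in> M" for n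
  proof (induction n)
    case 0
    have "(c r0 - (- a)) + c (max 0 r0 - r0) \<in> M" using MD(1)[OF r0 cM] by simp
    then show ?case by (simp add: c_simps algebra_simps)
  next
    case (Suc n)
    define r where "r = max 0 (r0 - real n / k\<^sup>2)"
    have "a + c (r - 1 / k\<^sup>2) \<in> M" using step Suc unfolding r_def by simp
    moreover have "0 \<le> max 0 (r0 - real (Suc n) / k\<^sup>2) - (r - 1 / k\<^sup>2)"
    proof -
      have "0 \<le> 1 / k\<^sup>2" by simp
      moreover have "real (Suc n) / k\<^sup>2 = 1 / k\<^sup>2 + real n / k\<^sup>2" by (simp add: add_divide_distrib)
      ultimately show ?thesis unfolding r_def by linarith
    qed
    ultimately have "a + c (r - 1 / k\<^sup>2) + c (max 0 (r0 - real (Suc n) / k\<^sup>2) - (r - 1 / k\<^sup>2)) \<in> M" using MD(1) cM by blast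
    then show ?case by (simp add: c_simps)
  qed
  moreover obtain n :: nat where "r0 * k\<^sup>2 \<le> real n" using real_arch_simple by blast
  then have "max 0 (r0 - real n / k\<^sup>2) = 0" using k by (simp add: field_simps)
  ultimately show ?thesis by (metis add.right_neutral c_simps(4))
qed

end

section \<open>Positivstellensaetze for one block of variables\<close>

subsection \<open>Setting the other variables to zero\<close>

definition restrict_vars :: "'v set \<Rightarrow> 'v mpoly \<Rightarrow> 'v mpoly" where
  "restrict_vars V p = (\<Sum>t\<in>Poly_Mapping.keys p.
     if Poly_Mapping.keys t \<subseteq> V then Poly_Mapping.single t (Poly_Mapping.lookup p t) else 0)"

lemma restrict_vars_superset:
  "finite S \<Longrightarrow> Poly_Mapping.keys p \<subseteq> S \<Longrightarrow> restrict_vars V p =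
    (\<Sum>t\<in>S. if Poly_Mapping.keys t \<subseteq> V then Poly_Mapping.single t (Poly_Mapping.lookup p t) else 0)"
  unfolding restrict_vars_def by (intro sum.mono_neutral_left) (auto simp: in_keys_iff)

lemma restrict_vars_add: "restrict_vars V (p + q) = restrict_vars V p + restrict_vars V q"
proof -
  let ?S = "Poly_Mapping.keys p \<union> Poly_Mapping.keys q"
  have "restrict_vars V (p + q) = (\<Sum>t\<in>?S. if Poly_Mapping.keys t \<subseteq> V then Poly_Mapping.single t (Poly_Mapping.lookup (p + q) t) else 0)"
    by (intro restrict_vars_superset) (auto simp: Poly_Mapping.keys_add)
  also have "\<dots> = (\<Sum>t\<in>?S. if Poly_Mapping.keys t \<subseteq> V then Poly_Mapping.single t (Poly_Mapping.lookup p t) else 0) +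
      (\<Sum>t\<in>?S. if Poly_Mapping.keys t \<subseteq> V then Poly_Mapping.single t (Poly_Mapping.lookup q t) else 0)"
    unfolding sum.distrib[symmetric] by (intro sum.cong) (auto simp: lookup_add single_add)
  also have "\<dots> = restrict_vars V p + restrict_vars V q"
    using restrict_vars_superset[of ?S p V] restrict_vars_superset[of ?S q V] by simp
  finally show ?thesis .
qed

lemma restrict_vars_single:
  "restrict_vars V (Poly_Mapping.single t c) = (if Poly_Mapping.keys t \<subseteq> V then Poly_Mapping.single t c else 0)"
  by (subst restrict_vars_superset[of "{t}"]) auto

lemma restrict_vars_sum: "restrict_vars V (\<Sum>i\<in>A. p i) = (\<Sum>i\<in>A. restrict_vars V (p i))"
  by (induction A rule: infinite_finite_induct) (simp_all add: restrict_vars_add, simp_all add: restrict_vars_def)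

text \<open>Natural exponents cannot cancel; this is what makes discarding monomials with foreign
  variables multiplicative.\<close>

lemma keys_add_nat: "Poly_Mapping.keys (s + t) = Poly_Mapping.keys s \<union> Poly_Mapping.keys (t :: 'v \<Rightarrow>\<^sub>0 nat)"
  by (auto simp: in_keys_iff lookup_add)

lemma restrict_vars_mult: "restrict_vars V (p * q) = restrict_vars V p * restrict_vars V q"
proof -
  have "restrict_vars V (p * q) = restrict_vars V ((\<Sum>s\<in>Poly_Mapping.keys p. Poly_Mapping.single s (Poly_Mapping.lookup p s)) * (\<Sum>t\<in>Poly_Mapping.keys q. Poly_Mapping.single t (Poly_Mapping.lookup q t)))"
    using sum_single_lookup[of p] sum_single_lookup[of q] by simp
  also have "\<dots> = restrict_vars V p * restrict_vars V q"
    unfolding sum_product mult_single restrict_vars_sum restrict_vars_single keys_add_nat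
    unfolding restrict_vars_def sum_product by (intro sum.cong) (auto simp: mult_single)
  finally show ?thesis .
qed

lemma restrict_vars_id: "p \<in> polys_in V \<Longrightarrow> restrict_vars V p = p"
proof -
  assume "p \<in> polys_in V"
  then have "restrict_vars V p = (\<Sum>t\<in>Poly_Mapping.keys p. Poly_Mapping.single t (Poly_Mapping.lookup p t))"
    unfolding restrict_vars_def polys_in_def by (intro sum.cong) auto
  then show ?thesis using sum_single_lookup[of p] by simp
qed

lemma restrict_vars_in: "restrict_vars V p \<in> polys_in V"
  unfolding restrict_vars_def by (rule polys_in_sum) (auto simp: polys_in_def)

lemma is_ring_hom_restrict_vars: "is_ring_hom (restrict_vars V)"
  unfolding is_ring_hom_def by (simp add: restrict_vars_add restrict_vars_mult restrict_vars_id polys_in_1)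

lemmas restrict_vars_simps = is_ring_homD[OF is_ring_hom_restrict_vars]

lemma restrict_vars_Const [simp]: "restrict_vars V (Const c) = Const c"
  by (intro restrict_vars_id polys_in_Const)

subsection \<open>Sums of squares, quadratic modules and preorderings\<close>

lemma sos_zero: "0 \<in> sums_of_squares A"
  unfolding sums_of_squares_def by (intro CollectI exI[of _ "0::nat"]) auto

lemma sos_add_square:
  assumes "p \<in> sums_of_squares A" "r \<in> A"
  shows "p + r\<^sup>2 \<in> sums_of_squares A"
proof -
  obtain k :: nat and q where q: "p = (\<Sum>i<k. (q i)\<^sup>2)" "\<forall>i<k. q i \<in> A" using assms(1) unfolding sums_of_squares_def by blast
  have "p + r\<^sup>2 = (\<Sum>i<Suc k. ((q(k := r)) i)\<^sup>2)" unfolding q(1) sum.lessThan_Suc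
    by (intro arg_cong2[where f = plus] sum.cong) auto
  moreover have "\<forall>i<Suc k. (q(k := r)) i \<in> A" using q(2) assms(2) by (auto simp: less_Suc_eq)
  ultimately show ?thesis unfolding sums_of_squares_def by blast
qed

lemma sos_induct [consumes 1, case_names zero add]:
  assumes p: "p \<in> sums_of_squares A" and 0: "Q 0" and add: "\<And>p r. r \<in> A \<Longrightarrow> Q p \<Longrightarrow> Q (p + r\<^sup>2)"
  shows "Q p"
proof -
  obtain k :: nat and q where q: "p = (\<Sum>i<k. (q i)\<^sup>2)" "\<forall>i<k. q i \<in> A" using p unfolding sums_of_squares_def by blast
  have "Q (\<Sum>i<n. (q i)\<^sup>2)" if "n \<le> k" for n using that by (induction n) (simp_all add: 0 add q(2))
  then show ?thesis using q(1) by blast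
qed

lemma sos_square: "r \<in> A \<Longrightarrow> r\<^sup>2 \<in> sums_of_squares A"
  using sos_add_square[OF sos_zero] by fastforce

lemma sos_add:
  assumes "q \<in> sums_of_squares A" "p \<in> sums_of_squares A" shows "p + q \<in> sums_of_squares A"
  using assms by (induction rule: sos_induct) (simp_all add: add.assoc[symmetric] sos_add_square)

lemma sos_mult:
  assumes "q \<in> sums_of_squares UNIV" "p \<in> sums_of_squares UNIV" shows "p * q \<in> sums_of_squares UNIV"
  using assms(1)
proof (induction rule: sos_induct)
  case (add q r)
  have "p * r\<^sup>2 \<in> sums_of_squares UNIV" using assms(2)
  proof (induction rule: sos_induct)
    case (add p s)
    have "(p + s\<^sup>2) * r\<^sup>2 = p * r\<^sup>2 + (s * r)\<^sup>2" by (simp add: algebra_simps power_mult_distrib)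
    then show ?case using sos_add_square[OF add(2), of "s * r"] by simp
  qed (simp add: sos_zero)
  then show ?case using add by (simp add: distrib_left sos_add)
qed (simp add: sos_zero)

lemma sos_Const: "0 \<le> r \<Longrightarrow> Const r \<in> sums_of_squares (polys_in V)"
proof -
  assume "0 \<le> r"
  then have "Const r = (Const (sqrt r))\<^sup>2" by (simp add: power2_eq_square Const_simps(4)[symmetric])
  then show ?thesis using sos_square[OF polys_in_Const] by metis
qed

lemma sos_mono: "A \<subseteq> B \<Longrightarrow> sums_of_squares A \<subseteq> sums_of_squares B"
  unfolding sums_of_squares_def by blast

lemma sos_restrict: "p \<in> sums_of_squares A \<Longrightarrow> restrict_vars V p \<in> sums_of_squares (polys_in V)"
proof (induction rule: sos_induct)
  case (add p r)
  then show ?case unfolding restrict_vars_simps by (intro sos_add_square restrict_vars_in)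
qed (simp add: restrict_vars_simps sos_zero)

lemma quadratic_module_mono: "A \<subseteq> B \<Longrightarrow> poly_quadratic_module A I g \<subseteq> poly_quadratic_module B I g"
  unfolding poly_quadratic_module_def using sos_mono by blast

lemma preordering_mono: "A \<subseteq> B \<Longrightarrow> poly_preordering A I g \<subseteq> poly_preordering B I g"
  unfolding poly_preordering_def using sos_mono by blast

lemma restrict_quadratic_module:
  assumes g: "\<forall>j\<in>I. g j \<in> polys_in V" and p: "p \<in> poly_quadratic_module A I g"
  shows "restrict_vars V p \<in> poly_quadratic_module (polys_in V) I g"
proof -
  obtain \<sigma>0 \<sigma> where s: "p = \<sigma>0 + (\<Sum>j\<in>I. \<sigma> j * g j)" "\<sigma>0 \<in> sums_of_squares A" "\<forall>j\<in>I. \<sigma> j \<in> sums_of_squares A"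
    using p unfolding poly_quadratic_module_def by blast
  have "restrict_vars V p = restrict_vars V \<sigma>0 + (\<Sum>j\<in>I. restrict_vars V (\<sigma> j) * g j)"
    unfolding s(1) restrict_vars_simps restrict_vars_sum using g by (simp add: restrict_vars_simps restrict_vars_id)
  moreover have "restrict_vars V \<sigma>0 \<in> sums_of_squares (polys_in V)" "\<forall>j\<in>I. restrict_vars V (\<sigma> j) \<in> sums_of_squares (polys_in V)"
    using s(2,3) sos_restrict by blast+
  ultimately show ?thesis unfolding poly_quadratic_module_def
    by (intro CollectI exI[of _ "restrict_vars V \<sigma>0"] exI[of _ "\<lambda>j. restrict_vars V (\<sigma> j)"]) simp
qed

lemma restrict_preordering:
  assumes g: "\<forall>j\<in>I. g j \<in> polys_in V" and p: "p \<in> poly_preordering A I g"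
  shows "restrict_vars V p \<in> poly_preordering (polys_in V) I g"
proof -
  obtain \<sigma> where s: "p = (\<Sum>J\<in>Pow I. \<sigma> J * (\<Prod>j\<in>J. g j))" "\<forall>J\<in>Pow I. \<sigma> J \<in> sums_of_squares A"
    using p unfolding poly_preordering_def by blast
  have "restrict_vars V (\<Prod>j\<in>J. g j) = (\<Prod>j\<in>J. g j)" if "J \<in> Pow I" for J
    using that g by (intro restrict_vars_id polys_in_prod) auto
  then have "restrict_vars V p = (\<Sum>J\<in>Pow I. restrict_vars V (\<sigma> J) * (\<Prod>j\<in>J. g j))"
    unfolding s(1) restrict_vars_sum by (simp add: restrict_vars_simps)
  moreover have "\<forall>J\<in>Pow I. restrict_vars V (\<sigma> J) \<in> sums_of_squares (polys_in V)" using s(2) sos_restrict by blast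
  ultimately show ?thesis unfolding poly_preordering_def
    by (intro CollectI exI[of _ "\<lambda>J. restrict_vars V (\<sigma> J)"]) simp
qed

lemma module_over_quadratic_module: "module_over (sums_of_squares UNIV) (poly_quadratic_module UNIV I g)"
  unfolding module_over_def
proof (intro conjI ballI)
  let ?S = "sums_of_squares UNIV :: 'a mpoly set"
  fix x y assume "x \<in> poly_quadratic_module UNIV I g" "y \<in> poly_quadratic_module UNIV I g"
  then obtain \<sigma>0 \<sigma> \<tau>0 \<tau> where s: "x = \<sigma>0 + (\<Sum>j\<in>I. \<sigma> j * g j)" "\<sigma>0 \<in> ?S" "\<forall>j\<in>I. \<sigma> j \<in> ?S"
    "y = \<tau>0 + (\<Sum>j\<in>I. \<tau> j * g j)" "\<tau>0 \<in> ?S" "\<forall>j\<in>I. \<tau> j \<in> ?S" unfolding poly_quadratic_module_def by blast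
  have "x + y = (\<sigma>0 + \<tau>0) + (\<Sum>j\<in>I. (\<sigma> j + \<tau> j) * g j)" unfolding s(1,4) by (simp add: distrib_right sum.distrib)
  then show "x + y \<in> poly_quadratic_module UNIV I g" unfolding poly_quadratic_module_def using s(2,3,5,6)
    by (intro CollectI exI[of _ "\<sigma>0 + \<tau>0"] exI[of _ "\<lambda>j. \<sigma> j + \<tau> j"]) (auto intro: sos_add)
next
  let ?S = "sums_of_squares UNIV :: 'a mpoly set"
  fix r x assume r: "r \<in> ?S" and "x \<in> poly_quadratic_module UNIV I g"
  then obtain \<sigma>0 \<sigma> where s: "x = \<sigma>0 + (\<Sum>j\<in>I. \<sigma> j * g j)" "\<sigma>0 \<in> ?S" "\<forall>j\<in>I. \<sigma> j \<in> ?S" unfolding poly_quadratic_module_def by blast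
  have "r * x = (r * \<sigma>0) + (\<Sum>j\<in>I. (r * \<sigma> j) * g j)" unfolding s(1) by (simp add: distrib_left sum_distrib_left mult.assoc)
  then show "r * x \<in> poly_quadratic_module UNIV I g" unfolding poly_quadratic_module_def using s(2,3) r
    by (intro CollectI exI[of _ "r * \<sigma>0"] exI[of _ "\<lambda>j. r * \<sigma> j"]) (auto intro: sos_mult)
next
  have "1 = 1\<^sup>2 + (\<Sum>j\<in>I. 0 * g j)" by simp
  then show "1 \<in> poly_quadratic_module UNIV I g" unfolding poly_quadratic_module_def
    by (intro CollectI exI[of _ "1\<^sup>2"] exI[of _ "\<lambda>_. 0"] conjI ballI sos_zero sos_square UNIV_I) simp
qed

lemma quadratic_module_generator:
  assumes "finite I" "j \<in> I"
  shows "g j \<in> poly_quadratic_module (polys_in V) I g"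
proof -
  have "(\<Sum>i\<in>I. (if i = j then 1\<^sup>2 else 0) * g i) = (\<Sum>i\<in>I. if i = j then g j else 0)" by (intro sum.cong) auto
  then have "g j = 0 + (\<Sum>i\<in>I. (if i = j then 1\<^sup>2 else 0) * g i)" using assms by simp
  moreover have "\<forall>i\<in>I. (if i = j then 1\<^sup>2 else 0) \<in> sums_of_squares (polys_in V)" using sos_zero sos_square[OF polys_in_1] by auto
  ultimately show ?thesis unfolding poly_quadratic_module_def
    by (intro CollectI exI[of _ 0] exI[of _ "\<lambda>i. if i = j then 1\<^sup>2 else 0"] conjI sos_zero)
qed

text \<open>Grouping the subsets by whether they contain \<open>i\<close> turns the sum over all
  subsets into an iterated adjunction, so the preordering axioms follow by induction from
  \<open>ring_preordering_adjoin\<close>.\<close>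

lemma poly_preordering_insert:
  assumes "finite I" "i \<notin> I"
  shows "poly_preordering A (insert i I) g = {p + g i * q | p q. p \<in> poly_preordering A I g \<and> q \<in> poly_preordering A I g}"
proof -
  let ?m = "\<lambda>J. \<Prod>j\<in>J. g j"
  have fin: "finite J" if "J \<in> Pow I" for J using that assms(1) finite_subset by blast
  have split: "(\<Sum>J\<in>Pow (insert i I). \<rho> J * ?m J) = (\<Sum>J\<in>Pow I. \<rho> J * ?m J) + g i * (\<Sum>J\<in>Pow I. \<rho> (insert i J) * ?m J)" for \<rho>
  proof -
    have "(\<Sum>J\<in>Pow (insert i I). \<rho> J * ?m J) = (\<Sum>J\<in>Pow I. \<rho> J * ?m J) + (\<Sum>J\<in>insert i ` Pow I. \<rho> J * ?m J)"
      unfolding Pow_insert using assms by (intro sum.union_disjoint) auto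
    also have "(\<Sum>J\<in>insert i ` Pow I. \<rho> J * ?m J) = (\<Sum>J\<in>Pow I. \<rho> (insert i J) * ?m (insert i J))"
      using assms(2) by (subst sum.reindex) (auto simp: inj_on_def insert_ident)
    also have "\<dots> = g i * (\<Sum>J\<in>Pow I. \<rho> (insert i J) * ?m J)" unfolding sum_distrib_left
    proof (intro sum.cong refl)
      fix J assume J: "J \<in> Pow I"
      then have "i \<notin> J" using assms(2) by blast
      then show "\<rho> (insert i J) * ?m (insert i J) = g i * (\<rho> (insert i J) * ?m J)" using fin[OF J] by (simp add: mult.left_commute)
    qed
    finally show ?thesis .
  qed
  show ?thesis
  proof (intro equalityI subsetI)
    fix x assume "x \<in> poly_preordering A (insert i I) g"
    then obtain \<rho> where r: "x = (\<Sum>J\<in>Pow (insert i I). \<rho> J * ?m J)" "\<forall>J\<in>Pow (insert i I). \<rho> J \<in> sums_of_squares A"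
      unfolding poly_preordering_def by blast
    have "(\<Sum>J\<in>Pow I. \<rho> J * ?m J) \<in> poly_preordering A I g" unfolding poly_preordering_def using r(2) by blast
    moreover have "(\<Sum>J\<in>Pow I. \<rho> (insert i J) * ?m J) \<in> poly_preordering A I g" unfolding poly_preordering_def
      using r(2) by (intro CollectI exI[of _ "\<lambda>J. \<rho> (insert i J)"]) auto
    ultimately show "x \<in> {p + g i * q | p q. p \<in> poly_preordering A I g \<and> q \<in> poly_preordering A I g}"
      unfolding r(1) split by blast
  next
    fix x assume "x \<in> {p + g i * q | p q. p \<in> poly_preordering A I g \<and> q \<in> poly_preordering A I g}"
    then obtain \<sigma> \<tau> where s: "x = (\<Sum>J\<in>Pow I. \<sigma> J * ?m J) + g i * (\<Sum>J\<in>Pow I. \<tau> J * ?m J)"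
      "\<forall>J\<in>Pow I. \<sigma> J \<in> sums_of_squares A" "\<forall>J\<in>Pow I. \<tau> J \<in> sums_of_squares A" unfolding poly_preordering_def by blast
    define \<rho> where "\<rho> = (\<lambda>J. if i \<in> J then \<tau> (J - {i}) else \<sigma> J)"
    have "\<rho> J = \<sigma> J" "\<rho> (insert i J) = \<tau> J" if "J \<in> Pow I" for J
    proof -
      have "i \<notin> J" using assms(2) that by blast
      then show "\<rho> J = \<sigma> J" "\<rho> (insert i J) = \<tau> J" unfolding \<rho>_def by simp_all
    qed
    then have "x = (\<Sum>J\<in>Pow (insert i I). \<rho> J * ?m J)" unfolding split s(1)
      by (intro arg_cong2[where f = plus] arg_cong2[where f = times] sum.cong refl) simp_all
    moreover have "\<forall>J\<in>Pow (insert i I). \<rho> J \<in> sums_of_squares A" unfolding \<rho>_def using s(2,3) by auto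
    ultimately show "x \<in> poly_preordering A (insert i I) g" unfolding poly_preordering_def by blast
  qed
qed

lemma poly_preordering_properties:
  assumes "finite I"
  shows "ring_preordering (poly_preordering UNIV I g)" "\<And>j. j \<in> I \<Longrightarrow> g j \<in> poly_preordering UNIV I g"
    "sums_of_squares UNIV \<subseteq> poly_preordering UNIV I g"
proof -
  have "ring_preordering (poly_preordering UNIV I g) \<and> (\<forall>j\<in>I. g j \<in> poly_preordering UNIV I g) \<and>
    sums_of_squares UNIV \<subseteq> poly_preordering UNIV I g" using assms
  proof (induction I rule: finite_induct)
    case empty
    have "poly_preordering UNIV {} g = sums_of_squares UNIV" unfolding poly_preordering_def by auto
    then show ?case unfolding ring_preordering_def using sos_add sos_mult sos_square[of _ UNIV] by (auto simp: power2_eq_square)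
  next
    case (insert i I)
    note adj = ring_preordering_adjoin[of "poly_preordering UNIV I g" "g i"]
    show ?case unfolding poly_preordering_insert[OF insert(1,2)] using insert(3) adj by blast
  qed
  then show "ring_preordering (poly_preordering UNIV I g)" "\<And>j. j \<in> I \<Longrightarrow> g j \<in> poly_preordering UNIV I g"
    "sums_of_squares UNIV \<subseteq> poly_preordering UNIV I g" by auto
qed

lemma sos_self_mult: "q * q \<in> sums_of_squares UNIV"
  using sos_square[of q UNIV] by (simp add: power2_eq_square)

subsection \<open>Bounded elements\<close>

definition bounded_in :: "'v mpoly set \<Rightarrow> 'v mpoly \<Rightarrow> bool" where
  "bounded_in M p \<longleftrightarrow> (\<exists>r. Const r - p \<in> M) \<and> (\<exists>r. Const r + p \<in> M)"

lemma bounded_in_common: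
  assumes add: "\<And>x y. x \<in> M \<Longrightarrow> y \<in> M \<Longrightarrow> x + y \<in> M" and const: "\<And>r. 0 \<le> r \<Longrightarrow> Const r \<in> M" and p: "bounded_in M p"
  obtains r where "0 < r" "\<And>s. r \<le> s \<Longrightarrow> Const s - p \<in> M" "\<And>s. r \<le> s \<Longrightarrow> Const s + p \<in> M"
proof -
  obtain a b where ab: "Const a - p \<in> M" "Const b + p \<in> M" using p unfolding bounded_in_def by blast
  show ?thesis
  proof (rule that[of "max 1 (max a b)"])
    fix s assume s: "max 1 (max a b) \<le> s"
    show "Const s - p \<in> M" using add[OF ab(1) const[of "s - a"]] s by (simp add: Const_simps)
    show "Const s + p \<in> M" using add[OF ab(2) const[of "s - b"]] s by (simp add: Const_simps add.commute)
  qed simp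
qed

lemma bounded_in_add:
  assumes add: "\<And>x y. x \<in> M \<Longrightarrow> y \<in> M \<Longrightarrow> x + y \<in> M" and "bounded_in M p" "bounded_in M q"
  shows "bounded_in M (p + q)"
proof -
  obtain a b a' b' where *: "Const a - p \<in> M" "Const b + p \<in> M" "Const a' - q \<in> M" "Const b' + q \<in> M"
    using assms(2,3) unfolding bounded_in_def by blast
  have "Const (a + a') - (p + q) \<in> M" using add[OF *(1,3)] by (simp add: Const_simps algebra_simps)
  moreover have "Const (b + b') + (p + q) \<in> M" using add[OF *(2,4)] by (simp add: Const_simps algebra_simps)
  ultimately show ?thesis unfolding bounded_in_def by blast
qed

lemma bounded_in_minus: "bounded_in M p \<Longrightarrow> bounded_in M (- p)"
  unfolding bounded_in_def by simp

lemma bounded_in_Const: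
  assumes const: "\<And>r. 0 \<le> r \<Longrightarrow> Const r \<in> M"
  shows "bounded_in M (Const c)"
proof -
  have "Const (\<bar>c\<bar> - c) \<in> M" "Const (\<bar>c\<bar> + c) \<in> M" by (intro const; simp)+
  then show ?thesis unfolding bounded_in_def Const_simps by blast
qed

lemma Const_half: "Const (1/2) * p + Const (1/2) * p = p"
  by (simp add: distrib_right[symmetric] Const_simps(3)[symmetric] Const_simps(2))

text \<open>Half the sum of (r + p)(s - q) and (r - p)(s + q) is rs - pq, and similarly for rs + pq.
  This version serves the cones, where products of members are available but arbitrary squares are
  not.\<close>

lemma bounded_in_mult_semiring:
  assumes add: "\<And>x y. x \<in> M \<Longrightarrow> y \<in> M \<Longrightarrow> x + y \<in> M" and mult: "\<And>x y. x \<in> M \<Longrightarrow> y \<in> M \<Longrightarrow> x * y \<in> M"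
    and const: "\<And>r. 0 \<le> r \<Longrightarrow> Const r \<in> M" and p: "bounded_in M p" and q: "bounded_in M q"
  shows "bounded_in M (p * q)"
proof -
  obtain r where r: "\<And>s. r \<le> s \<Longrightarrow> Const s - p \<in> M" "\<And>s. r \<le> s \<Longrightarrow> Const s + p \<in> M"
    using bounded_in_common[OF add const p] by metis
  obtain s where s: "\<And>u. s \<le> u \<Longrightarrow> Const u - q \<in> M" "\<And>u. s \<le> u \<Longrightarrow> Const u + q \<in> M"
    using bounded_in_common[OF add const q] by metis
  let ?h = "Const (1/2) :: 'a mpoly"
  have h: "?h \<in> M" by (rule const) simp
  have "?h * ((Const r + p) * (Const s - q) + (Const r - p) * (Const s + q)) \<in> M"
    by (intro mult[OF h] add[OF mult mult] r s order_refl)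
  also have "?h * ((Const r + p) * (Const s - q) + (Const r - p) * (Const s + q)) =
    (?h * (Const r * Const s - p * q)) + (?h * (Const r * Const s - p * q))" by (simp add: algebra_simps)
  finally have 1: "Const (r * s) - p * q \<in> M" unfolding Const_half Const_simps(4) .
  have "?h * ((Const r + p) * (Const s + q) + (Const r - p) * (Const s - q)) \<in> M"
    by (intro mult[OF h] add[OF mult mult] r s order_refl)
  also have "?h * ((Const r + p) * (Const s + q) + (Const r - p) * (Const s - q)) =
    (?h * (Const r * Const s + p * q)) + (?h * (Const r * Const s + p * q))" by (simp add: algebra_simps)
  finally have 2: "Const (r * s) + p * q \<in> M" unfolding Const_half Const_simps(4) .
  show ?thesis using 1 2 unfolding bounded_in_def by blast
qed

section \<open>Boundedness in modules over the sums of squares\<close>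

locale square_module =
  fixes M :: "'v mpoly set"
  assumes M: "module_over (sums_of_squares UNIV) M"
begin

lemmas MD = module_overD[OF M]

lemma square_mem: "q * q \<in> M"
  using MD(4)[OF sos_square[of q UNIV]] by (simp add: power2_eq_square)

lemma const_mult: "0 \<le> r \<Longrightarrow> x \<in> M \<Longrightarrow> Const r * x \<in> M"
  by (rule MD(2)[OF subsetD[OF sos_mono[OF subset_UNIV] sos_Const]])

lemma const_mem: "0 \<le> r \<Longrightarrow> Const r \<in> M"
  using const_mult[OF _ MD(3)] by simp

lemma square_mult: "x \<in> M \<Longrightarrow> q * q * x \<in> M"
  using MD(2)[OF sos_square[of q UNIV], of x] by (simp add: power2_eq_square)

lemma bounded_square:
  assumes "bounded_in M p"
  obtains r where "Const r - p * p \<in> M"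
proof -
  obtain r where r: "0 < r" "Const r - p \<in> M" "Const r + p \<in> M"
    using bounded_in_common[OF MD(1) const_mem assms] by (metis order_refl)
  have "Const (1 / (2 * r)) * ((Const r + p) * (Const r + p) * (Const r - p) + (Const r - p) * (Const r - p) * (Const r + p)) \<in> M"
    using r by (intro const_mult MD(1)[OF square_mult square_mult]) auto
  also have "(Const r + p) * (Const r + p) * (Const r - p) + (Const r - p) * (Const r - p) * (Const r + p)
    = Const (2 * r) * (Const (r * r) - p * p)"
    unfolding mult_2 Const_simps by (simp add: algebra_simps)
  also have "Const (1 / (2 * r)) * (Const (2 * r) * (Const (r * r) - p * p)) = Const (r * r) - p * p"
    using r(1) by (simp add: mult.assoc[symmetric] Const_simps(4)[symmetric] Const_simps(2))
  finally show ?thesis by (rule that)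
qed

text \<open>Polarization: 4pq is the difference of the squares of p + q and p - q, and both squares
  are bounded.\<close>

lemma bounded_mult:
  assumes p: "bounded_in M p" and q: "bounded_in M q"
  shows "bounded_in M (p * q)"
proof -
  have "bounded_in M (p + q)" "bounded_in M (p + - q)"
    using bounded_in_add[OF MD(1) p q] bounded_in_add[OF MD(1) p bounded_in_minus[OF q]] by auto
  then obtain r s where r: "Const r - (p + q) * (p + q) \<in> M" and s: "Const s - (p - q) * (p - q) \<in> M"
    using bounded_square by (metis add_uminus_conv_diff)
  let ?h = "Const (1/2) :: 'v mpoly"
  have quarter: "Const (1/4) * x = ?h * (?h * x)" for x :: "'v mpoly" by (simp add: mult.assoc[symmetric] Const_simps(4)[symmetric])
  have four: "Const (1/4) * (x + x + (x + x)) = x" for x :: "'v mpoly"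
    unfolding quarter distrib_left[of ?h] using Const_half[of x] Const_half[of "?h * x"] Const_half by (simp add: add.assoc)
  have "Const (1/4) * ((p - q) * (p - q) + (Const r - (p + q) * (p + q))) \<in> M" by (intro const_mult MD(1) square_mem r) simp
  also have "Const (1/4) * ((p - q) * (p - q) + (Const r - (p + q) * (p + q))) =
    Const (1/4) * Const r - Const (1/4) * (p * q + p * q + (p * q + p * q))" by (simp add: algebra_simps)
  finally have 1: "Const (1/4 * r) - p * q \<in> M" unfolding four Const_simps(4) .
  have "Const (1/4) * ((p + q) * (p + q) + (Const s - (p - q) * (p - q))) \<in> M" by (intro const_mult MD(1) square_mem s) simp
  also have "Const (1/4) * ((p + q) * (p + q) + (Const s - (p - q) * (p - q))) =
    Const (1/4) * Const s + Const (1/4) * (p * q + p * q + (p * q + p * q))" by (simp add: algebra_simps)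
  finally have 2: "Const (1/4 * s) + p * q \<in> M" unfolding four Const_simps(4) .
  show ?thesis using 1 2 unfolding bounded_in_def by blast
qed

lemma sum_squares_mem: "(\<Sum>v\<in>W. (Var v)\<^sup>2) \<in> M"
  by (induction W rule: infinite_finite_induct) (use const_mem[of 0] in \<open>auto simp: Const_simps power2_eq_square intro: MD(1) square_mem\<close>)

text \<open>Bounded elements form a ring containing the constants, so variables suffice. For these,
  N - v^2 + (1 - v)^2 = N + 1 - 2v, and the same with -v in place of v.\<close>

lemma bounded_polys:
  assumes "finite V" and N: "Const N - (\<Sum>v\<in>V. (Var v)\<^sup>2) \<in> M" and p: "p \<in> polys_in V"
  shows "bounded_in M p"
  using p
proof (induction rule: polys_in_induct)
  case (Var v)
  have "(Const N - (\<Sum>v\<in>V. (Var v)\<^sup>2)) + (\<Sum>v\<in>V - {v}. (Var v)\<^sup>2) \<in> M" by (intro MD(1) N sum_squares_mem)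
  then have *: "Const N - Var v * Var v \<in> M"
    using sum.remove[OF assms(1) Var, of "\<lambda>v. (Var v)\<^sup>2"] by (simp add: power2_eq_square algebra_simps)
  let ?h = "Const (1/2) :: 'v mpoly"
  have eq: "?h * (Const N - x * x + (1 - x) * (1 - x)) = Const ((N + 1) / 2) - x" for x :: "'v mpoly"
  proof -
    have "?h * (Const N - x * x + (1 - x) * (1 - x)) = ?h * Const (N + 1) - (?h * x + ?h * x)"
      by (simp add: Const_simps algebra_simps)
    then show ?thesis unfolding Const_half Const_simps(4)[symmetric] by simp
  qed
  have "?h * (Const N - Var v * Var v + (1 - Var v) * (1 - Var v)) \<in> M" "?h * (Const N - Var v * Var v + (1 - - Var v) * (1 - - Var v)) \<in> M"
    by (intro const_mult MD(1) * square_mem; simp)+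
  then show ?case using eq[of "Var v"] eq[of "- Var v"] unfolding bounded_in_def by auto
qed (use bounded_in_Const[OF const_mem] bounded_in_add[OF MD(1)] bounded_mult in blast)+

end

text \<open>Boundedness is known only for polynomials in \<open>V\<close>, while
  \<open>archimedean_module\<close> demands it for the whole ring. Taking preimages of
  \<open>S\<close> and \<open>M\<close> under \<open>restrict_vars\<close> makes every element
  bounded without changing membership of \<open>p\<close>. The alternative \<open>SM\<close> unites
  the two applications: cones acting on themselves, and modules over sums of squares.\<close>

theorem block_positivstellensatz:
  fixes M S :: "'v mpoly set"
  assumes S: "\<And>x y. x \<in> S \<Longrightarrow> y \<in> S \<Longrightarrow> x + y \<in> S" "\<And>x y. x \<in> S \<Longrightarrow> y \<in> S \<Longrightarrow> x * y \<in> S" "\<And>r. 0 \<le> r \<Longrightarrow> Const r \<in> S"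
    and M: "module_over S M" and SM: "S = M \<or> (\<forall>q. q * q \<in> S)"
    and bounded: "\<And>p. p \<in> polys_in V \<Longrightarrow> bounded_in M p"
    and p: "p \<in> polys_in V" and pos: "\<And>a. (\<And>m. m \<in> M \<Longrightarrow> m \<in> polys_in V \<Longrightarrow> 0 \<le> poly_eval a m) \<Longrightarrow> 0 < poly_eval a p"
  shows "p \<in> M"
proof -
  note MD = module_overD[OF M]
  let ?\<pi> = "restrict_vars V :: 'v mpoly \<Rightarrow> 'v mpoly"
  define S' where "S' = {q. ?\<pi> q \<in> S}"
  define M' where "M' = {q. ?\<pi> q \<in> M}"
  have arch: "\<exists>r. Const r - x \<in> M'" for x
    using bounded[OF restrict_vars_in[of V x]] unfolding bounded_in_def M'_def by (auto simp: restrict_vars_simps)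
  have S'_const: "0 \<le> r \<Longrightarrow> Const r \<in> S'" for r unfolding S'_def using S(3) by simp
  have S'_add: "x \<in> S' \<Longrightarrow> y \<in> S' \<Longrightarrow> x + y \<in> S'" for x y unfolding S'_def using S(1) by (simp add: restrict_vars_simps)
  have S'_mult: "x \<in> S' \<Longrightarrow> y \<in> S' \<Longrightarrow> x * y \<in> S'" for x y unfolding S'_def using S(2) by (simp add: restrict_vars_simps)
  have SM': "S' = M' \<or> (\<forall>q. q * q \<in> S')" using SM unfolding S'_def M'_def by (auto simp: restrict_vars_simps)
  have "archimedean_module Const S' M'"
  proof (rule archimedean_module.intro)
    show "is_ring_hom Const" unfolding is_ring_hom_def by (simp add: Const_simps)
    show "module_over S' M'" using MD unfolding module_over_def S'_def M'_def by (simp add: restrict_vars_simps)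
    show "\<exists>s\<in>S'. \<exists>s'\<in>S'. x = s - s'" for x
      using SM'
    proof
      assume eq: "S' = M'"
      obtain r where r: "Const r - (- x) \<in> S'" using arch eq by blast
      have "Const r - (- x) + Const (max r 0 - r) \<in> S'" by (intro S'_add r S'_const) simp
      then have "x + Const (max r 0) \<in> S'" by (simp add: Const_simps add.commute)
      moreover have "x = (x + Const (max r 0)) - Const (max r 0)" by simp
      ultimately show ?thesis using S'_const[of "max r 0"] by (metis max.cobounded2)
    next
      assume sq: "\<forall>q. q * q \<in> S'"
      let ?h = "Const (1/2) :: 'v mpoly"
      \<comment> \<open>x is the difference of the squares of (x + 1)/2 and (x - 1)/2.\<close>
      have "((?h * x) + ?h) * ((?h * x) + ?h) - ((?h * x) - ?h) * ((?h * x) - ?h) = (?h + ?h) * ((?h + ?h) * x)"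
        by (simp add: algebra_simps)
      also have "?h + ?h = 1" using Const_half[of 1] by simp
      finally have "x = ((?h * x) + ?h) * ((?h * x) + ?h) - ((?h * x) - ?h) * ((?h * x) - ?h)" by simp
      then show ?thesis using sq by blast
    qed
    show "\<exists>k0. \<forall>k\<ge>k0. (Const k - s) * (Const k - s) \<in> S'" if "s \<in> S'" for s
      using SM'
    proof
      assume eq: "S' = M'"
      obtain r where r: "Const r - s \<in> S'" using arch eq by blast
      have "(Const k - s) * (Const k - s) \<in> S'" if "r \<le> k" for k
      proof -
        have "Const r - s + Const (k - r) \<in> S'" using that by (intro S'_add r S'_const) simp
        then have "Const k - s \<in> S'" by (simp add: Const_simps)
        then show ?thesis using S'_mult by blast
      qed
      then show ?thesis by blast
    qed blast
  qed (fact arch S'_const S'_add S'_mult)+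
  then interpret archimedean_module Const S' M' .
  have "p \<in> M'"
  proof (rule positive_imp_mem)
    fix \<phi> :: "'v mpoly \<Rightarrow> real" assume h: "is_ring_hom \<phi>" "\<And>r. \<phi> (Const r) = r" "\<And>x. x \<in> M' \<Longrightarrow> 0 \<le> \<phi> x"
    \<comment> \<open>On polynomials in \<open>V\<close> a homomorphism fixing constants is
      evaluation at the images of the variables.\<close>
    have ev: "\<phi> q = poly_eval (\<lambda>v. \<phi> (Var v)) q" if "q \<in> polys_in V" for q
      using that by (induction rule: polys_in_induct) (simp_all add: h(2) is_ring_homD[OF h(1)] poly_eval_simps)
    have "0 < poly_eval (\<lambda>v. \<phi> (Var v)) p"
    proof (rule pos)
      fix m assume m: "m \<in> M" "m \<in> polys_in V"
      then have "m \<in> M'" unfolding M'_def by (simp add: restrict_vars_id)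
      then show "0 \<le> poly_eval (\<lambda>v. \<phi> (Var v)) m" unfolding ev[OF m(2), symmetric] by (rule h(3))
    qed
    then show "0 < \<phi> p" using ev[OF p] by simp
  qed
  then show ?thesis unfolding M'_def using restrict_vars_id[OF p] by simp
qed

subsection \<open>The theorems of Putinar, Schmuedgen and Krivine--Handelman\<close>

theorem putinar:
  fixes g :: "'i \<Rightarrow> 'v mpoly"
  assumes "finite I" "finite V" and g: "\<forall>j\<in>I. g j \<in> polys_in V"
    and N: "Const N - (\<Sum>v\<in>V. (Var v)\<^sup>2) \<in> poly_quadratic_module (polys_in V) I g"
    and p: "p \<in> polys_in V" and pos: "\<And>a. (\<And>j. j \<in> I \<Longrightarrow> 0 \<le> poly_eval a (g j)) \<Longrightarrow> 0 < poly_eval a p"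
  shows "p \<in> poly_quadratic_module (polys_in V) I g"
proof -
  interpret square_module "poly_quadratic_module UNIV I g" by unfold_locales (rule module_over_quadratic_module)
  note sub = quadratic_module_mono[OF subset_UNIV, of "polys_in V" I g]
  have "p \<in> poly_quadratic_module UNIV I g"
  proof (rule block_positivstellensatz[where S = "sums_of_squares UNIV" and V = V])
    show "bounded_in (poly_quadratic_module UNIV I g) q" if "q \<in> polys_in V" for q
      using bounded_polys[OF assms(2) _ that] N sub by blast
    show "\<And>r. 0 \<le> r \<Longrightarrow> Const r \<in> sums_of_squares UNIV" by (rule subsetD[OF sos_mono[OF subset_UNIV] sos_Const])
    show "sums_of_squares UNIV = poly_quadratic_module UNIV I g \<or> (\<forall>q::'v mpoly. q * q \<in> sums_of_squares UNIV)"
      by (simp add: sos_self_mult)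
    fix a assume a: "\<And>m. m \<in> poly_quadratic_module UNIV I g \<Longrightarrow> m \<in> polys_in V \<Longrightarrow> 0 \<le> poly_eval a m"
    show "0 < poly_eval a p"
    proof (rule pos)
      fix j assume "j \<in> I"
      then show "0 \<le> poly_eval a (g j)" using a quadratic_module_generator[OF assms(1), of j g V] sub g by blast
    qed
  qed (auto intro: sos_add sos_mult module_over_quadratic_module p)
  then show ?thesis using restrict_quadratic_module[OF g] restrict_vars_id[OF p] by metis
qed

lemma ring_preordering_module:
  assumes "ring_preordering T" "sums_of_squares UNIV \<subseteq> T"
  shows "module_over (sums_of_squares UNIV) (T :: 'v mpoly set)"
  unfolding module_over_def using ring_preorderingD[OF assms(1)] assms(2) by blast

text \<open>The first half is the Krivine--Stengle Positivstellensatz, applied to the empty set on which all \<open>g j\<close> are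
  nonnegative and the squared norm is at least \<open>B\<close>; the second half is Woermann's argument.\<close>

lemma preordering_archimedean:
  fixes g :: "'i \<Rightarrow> 'v mpoly"
  assumes I: "finite I" and V: "finite V" and g: "\<forall>j\<in>I. g j \<in> polys_in V"
    and bound: "\<And>a. (\<And>j. j \<in> I \<Longrightarrow> 0 \<le> poly_eval a (g j)) \<Longrightarrow> (\<Sum>v\<in>V. (a v)\<^sup>2) < B"
  shows "\<exists>N. Const N - (\<Sum>v\<in>V. (Var v)\<^sup>2) \<in> poly_preordering UNIV I g"
proof -
  \<comment> \<open>The constant b later multiplies a member of \<open>T\<close> and so must be
    nonnegative.\<close>
  define b where "b = max B 0"
  have b: "0 \<le> b" "B \<le> b" unfolding b_def by auto
  define n :: "'v mpoly" where "n = (\<Sum>v\<in>V. (Var v)\<^sup>2)"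
  define h where "h = Const b - n"
  define T where "T = poly_preordering UNIV I g"
  note TP = poly_preordering_properties[OF I, where g = g, folded T_def]
  note TD = ring_preorderingD[OF TP(1)]
  have nV: "n \<in> polys_in V" unfolding n_def by (intro polys_in_sum polys_in_power polys_in_Var)
  have hV: "h \<in> polys_in V" unfolding h_def by (intro polys_in_diff polys_in_Const nV)
  have n_eval: "poly_eval a n = (\<Sum>v\<in>V. (a v)\<^sup>2)" for a unfolding n_def by (simp add: poly_eval_simps)
  have "- 1 \<in> {p + (- h) * q | p q. p \<in> T \<and> q \<in> T}"
  proof (rule ccontr)
    assume "\<not> ?thesis"
    with ring_preordering_adjoin(1)[OF TP(1)] obtain P where P: "prime_cone P" "{p + (- h) * q | p q. p \<in> T \<and> q \<in> T} \<subseteq> P"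
      by (rule prime_cone_extension)
    have mem: "g j \<in> P" if "j \<in> I" for j using P(2) ring_preordering_adjoin(2)[OF TP(1)] TP(2)[OF that] by blast
    have memh: "- h \<in> P" using P(2) ring_preordering_adjoin(3)[OF TP(1)] by blast
    have "finite (insert (- h) (g ` I))" using I by simp
    then obtain a where a: "\<And>p. p \<in> insert (- h) (g ` I) \<Longrightarrow> p \<in> P \<longleftrightarrow> 0 \<le> poly_eval a p"
      using prime_cone_realizable[OF P(1)] unfolding realizable_def by meson
    have "0 \<le> poly_eval a (g j)" if "j \<in> I" for j using a[of "g j"] mem that by simp
    then have "(\<Sum>v\<in>V. (a v)\<^sup>2) < B" by (rule bound)
    moreover have "0 \<le> poly_eval a (- h)" using a[of "- h"] memh by simp
    then have "b \<le> (\<Sum>v\<in>V. (a v)\<^sup>2)" unfolding h_def by (simp add: poly_eval_simps n_eval)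
    ultimately show False using b(2) by simp
  qed
  then obtain t0 s0 where ts0: "- 1 = t0 + (- h) * s0" "t0 \<in> T" "s0 \<in> T" by blast
  \<comment> \<open>The certificate is moved into the block, because only polynomials in
    \<open>V\<close> are known to be bounded.\<close>
  define t where "t = restrict_vars V t0"
  define s where "s = restrict_vars V s0"
  have t: "t \<in> T" "t \<in> polys_in V" and s: "s \<in> T"
    unfolding t_def s_def T_def using restrict_preordering[OF g] ts0(2,3) preordering_mono[OF subset_UNIV, of "polys_in V" I g] restrict_vars_in
    unfolding T_def by blast+
  have "- 1 = t + (- h) * s" using arg_cong[OF ts0(1), of "restrict_vars V"]
    unfolding t_def s_def by (simp add: restrict_vars_simps restrict_vars_id[OF hV])
  then have hs: "(1 + t) = h * s" using neg_one_eqD by fastforce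
  \<comment> \<open>With \<open>h\<close> adjoined, \<open>T0\<close> is archimedean by
    construction; the remaining steps remove the dependence on \<open>h\<close>.\<close>
  define T0 where "T0 = {p + h * q | p q. p \<in> T \<and> q \<in> T}"
  have sosT: "sums_of_squares UNIV \<subseteq> T0" using ring_preordering_adjoin(2)[OF TP(1)] TP(3) unfolding T0_def by blast
  interpret T0: square_module T0
    by unfold_locales (intro ring_preordering_module sosT ring_preordering_adjoin(1)[OF TP(1)] | unfold T0_def)+
  have "h \<in> T0" unfolding T0_def by (rule ring_preordering_adjoin(3)[OF TP(1)])
  then have "bounded_in T0 t" using T0.bounded_polys[OF V _ t(2)] unfolding h_def n_def by blast
  then obtain r where "Const r - t \<in> T0" unfolding bounded_in_def by blast
  then obtain p q where pq: "Const r - t = p + h * q" "p \<in> T" "q \<in> T" unfolding T0_def by blast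
  interpret T: square_module T by unfold_locales (intro ring_preordering_module TP)
  \<comment> \<open>Multiplication by 1 + t, which equals h s, turns the factor h into h^2 s, a
    member of \<open>T\<close>. So (1 + t)(r - t) lies in \<open>T\<close>, and adding (r/2 - t)^2
    leaves r + r^2/4 - t: the cofactor \<open>t\<close> is bounded in \<open>T\<close>
    itself.\<close>
  have "(1 + t) * p + h * h * s * q \<in> T" by (intro TD(1) TD(2) TD(3) TD(5) t s pq)
  also have "(1 + t) * p + h * h * s * q = (1 + t) * (Const r - t)"
    unfolding pq(1) distrib_left[of "1 + t"] by (simp add: hs mult.commute mult.left_commute)
  finally have "(1 + t) * (Const r - t) + (Const (r/2) - t) * (Const (r/2) - t) \<in> T" by (intro T.MD(1) T.square_mem)
  also have "(1 + t) * (Const r - t) + (Const (r/2) - t) * (Const (r/2) - t) =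
    (Const r + Const (r/2) * Const (r/2)) - t + (Const r - (Const (r/2) + Const (r/2))) * t" by (simp add: algebra_simps)
  also have "Const (r/2) + Const (r/2) = Const r" by (simp add: Const_simps(3)[symmetric])
  also have "Const r + Const (r/2) * Const (r/2) - t + (Const r - Const r) * t = Const (r + r/2 * (r/2)) - t"
    unfolding Const_simps by simp
  finally have rt: "Const (r + r/2 * (r/2)) - t \<in> T" .
  define r1 where "r1 = r + r/2 * (r/2)"
  have nT: "n \<in> T" unfolding n_def by (rule T.sum_squares_mem)
  \<comment> \<open>Since h^2 s = (1 + t)(b - n), adding t n removes the product of t and n, and the
    bound for \<open>t\<close>, scaled by b, removes b t.\<close>
  have "h * h * s + t * n + Const b * (Const r1 - t) \<in> T"
    unfolding r1_def by (intro TD(1) TD(2)[OF TD(3) s] TD(2)[OF t(1) nT] T.const_mult[OF b(1) rt])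
  also have "h * h * s + t * n + Const b * (Const r1 - t) = (1 + t) * h + t * n + Const b * (Const r1 - t)"
    unfolding hs by (simp add: algebra_simps)
  also have "\<dots> = Const (b + b * r1) - n" unfolding h_def Const_simps by (simp add: algebra_simps)
  finally show ?thesis unfolding T_def n_def by blast
qed

theorem schmuedgen:
  fixes g :: "'i \<Rightarrow> 'v mpoly"
  assumes I: "finite I" and V: "finite V" and g: "\<forall>j\<in>I. g j \<in> polys_in V"
    and bound: "\<And>a. (\<And>j. j \<in> I \<Longrightarrow> 0 \<le> poly_eval a (g j)) \<Longrightarrow> (\<Sum>v\<in>V. (a v)\<^sup>2) < B"
    and p: "p \<in> polys_in V" and pos: "\<And>a. (\<And>j. j \<in> I \<Longrightarrow> 0 \<le> poly_eval a (g j)) \<Longrightarrow> 0 < poly_eval a p"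
  shows "p \<in> poly_preordering (polys_in V) I g"
proof -
  note TP = poly_preordering_properties[OF I, where g = g]
  have M: "module_over (sums_of_squares UNIV) (poly_preordering UNIV I g)" by (intro ring_preordering_module TP)
  interpret square_module "poly_preordering UNIV I g" by unfold_locales (rule M)
  obtain N where N: "Const N - (\<Sum>v\<in>V. (Var v)\<^sup>2) \<in> poly_preordering UNIV I g" using preordering_archimedean[OF I V g bound] by blast
  have "p \<in> poly_preordering UNIV I g"
  proof (rule block_positivstellensatz[where S = "sums_of_squares UNIV" and V = V])
    show "bounded_in (poly_preordering UNIV I g) q" if "q \<in> polys_in V" for q
      using bounded_polys[OF V N that] .
    show "\<And>r. 0 \<le> r \<Longrightarrow> Const r \<in> sums_of_squares UNIV" by (rule subsetD[OF sos_mono[OF subset_UNIV] sos_Const])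
    show "sums_of_squares UNIV = poly_preordering UNIV I g \<or> (\<forall>q::'v mpoly. q * q \<in> sums_of_squares UNIV)"
      by (simp add: sos_self_mult)
    fix a assume a: "\<And>m. m \<in> poly_preordering UNIV I g \<Longrightarrow> m \<in> polys_in V \<Longrightarrow> 0 \<le> poly_eval a m"
    show "0 < poly_eval a p" using pos a TP(2) g by blast
  qed (auto intro: sos_add sos_mult M p)
  then show ?thesis using restrict_preordering[OF g] restrict_vars_id[OF p] by metis
qed

subsection \<open>The cone generated by \<open>g\<close> and \<open>1 - g\<close>\<close>

abbreviation cone_term :: "'i set \<Rightarrow> ('i \<Rightarrow> 'v mpoly) \<Rightarrow> ('i \<Rightarrow> nat) \<Rightarrow> ('i \<Rightarrow> nat) \<Rightarrow> 'v mpoly" where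
  "cone_term I g \<alpha> \<beta> \<equiv> \<Prod>j\<in>I. g j ^ \<alpha> j * (1 - g j) ^ \<beta> j"

lemma cone_zero: "0 \<in> poly_cone I g"
  unfolding poly_cone_def by (intro CollectI exI[of _ "{}"]) auto

lemma cone_add_term:
  assumes x: "x \<in> poly_cone I g" and r: "0 \<le> r"
  shows "x + Const r * cone_term I g \<alpha> \<beta> \<in> poly_cone I g"
proof -
  obtain F c where F: "x = (\<Sum>(a, b)\<in>F. Const (c a b) * cone_term I g a b)" "finite F"
    "F \<subseteq> (I \<rightarrow>\<^sub>E UNIV) \<times> (I \<rightarrow>\<^sub>E UNIV)" "\<forall>(a, b)\<in>F. 0 \<le> c a b" using x unfolding poly_cone_def by blast
  define e where "e = (restrict \<alpha> I, restrict \<beta> I)"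
  define F' where "F' = insert e F"
  \<comment> \<open>If the exponent vector already occurs in \<open>F\<close>, its coefficient is
    increased instead of a second term being added.\<close>
  define c' where "c' = (\<lambda>a b. (if (a, b) \<in> F then c a b else 0) + (if (a, b) = e then r else 0))"
  have e: "cone_term I g (fst e) (snd e) = cone_term I g \<alpha> \<beta>" unfolding e_def by (intro prod.cong) auto
  have "(\<Sum>(a, b)\<in>F'. Const (c' a b) * cone_term I g a b) =
    (\<Sum>ab\<in>F'. (if ab \<in> F then Const (c (fst ab) (snd ab)) * cone_term I g (fst ab) (snd ab) else 0) +
      (if ab = e then Const r * cone_term I g (fst e) (snd e) else 0))"
    unfolding c'_def by (intro sum.cong refl) (auto simp: Const_simps distrib_right split: prod.splits)
  also have "\<dots> = (\<Sum>ab\<in>F'. if ab \<in> F then Const (c (fst ab) (snd ab)) * cone_term I g (fst ab) (snd ab) else 0) +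
      Const r * cone_term I g \<alpha> \<beta>"
    using F(2) unfolding sum.distrib e F'_def by simp
  also have "(\<Sum>ab\<in>F'. if ab \<in> F then Const (c (fst ab) (snd ab)) * cone_term I g (fst ab) (snd ab) else 0) = x"
    unfolding F(1) using F(2) unfolding F'_def by (intro sum.mono_neutral_cong_right) auto
  finally have "x + Const r * cone_term I g \<alpha> \<beta> = (\<Sum>(a, b)\<in>F'. Const (c' a b) * cone_term I g a b)" by simp
  moreover have "finite F'" "F' \<subseteq> (I \<rightarrow>\<^sub>E UNIV) \<times> (I \<rightarrow>\<^sub>E UNIV)" using F(2,3) unfolding F'_def e_def by auto
  moreover have "\<forall>(a, b)\<in>F'. 0 \<le> c' a b" using F(4) r unfolding F'_def c'_def by auto
  ultimately show ?thesis unfolding poly_cone_def by blast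
qed

lemma cone_induct [consumes 1, case_names zero add]:
  assumes x: "x \<in> poly_cone I g" and zero: "Q 0"
    and add: "\<And>x r \<alpha> \<beta>. 0 \<le> r \<Longrightarrow> Q x \<Longrightarrow> Q (x + Const r * cone_term I g \<alpha> \<beta>)"
  shows "Q x"
proof -
  obtain F c where F: "x = (\<Sum>(a, b)\<in>F. Const (c a b) * cone_term I g a b)" "finite F"
    "\<forall>(a, b)\<in>F. 0 \<le> c a b" using x unfolding poly_cone_def by blast
  from F(2,3) have "Q (\<Sum>(a, b)\<in>F. Const (c a b) * cone_term I g a b)"
  proof (induction F rule: finite_induct)
    case (insert e F)
    obtain a b where "e = (a, b)" by force
    then have "Q ((\<Sum>(a, b)\<in>F. Const (c a b) * cone_term I g a b) + Const (c a b) * cone_term I g a b)"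
      using insert by (intro add) auto
    then show ?case using insert(1,2) \<open>e = (a, b)\<close> by (simp add: add.commute)
  qed (simp add: zero)
  then show ?thesis unfolding F(1) .
qed

lemma cone_add:
  assumes "y \<in> poly_cone I g" "x \<in> poly_cone I g" shows "x + y \<in> poly_cone I g"
  using assms by (induction rule: cone_induct) (simp_all add: add.assoc[symmetric] cone_add_term)

lemma cone_mult:
  assumes "y \<in> poly_cone I g" "x \<in> poly_cone I g" shows "x * y \<in> poly_cone I g"
  using assms(1)
proof (induction rule: cone_induct)
  case (add y r \<alpha> \<beta>)
  have "x * (Const r * cone_term I g \<alpha> \<beta>) \<in> poly_cone I g" using assms(2)
  proof (induction rule: cone_induct)
    case (add x s \<alpha>' \<beta>')
    have "cone_term I g \<alpha>' \<beta>' * cone_term I g \<alpha> \<beta> = cone_term I g (\<lambda>j. \<alpha>' j + \<alpha> j) (\<lambda>j. \<beta>' j + \<beta> j)"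
      unfolding prod.distrib[symmetric] by (intro prod.cong) (simp_all add: power_add algebra_simps)
    then have "(x + Const s * cone_term I g \<alpha>' \<beta>') * (Const r * cone_term I g \<alpha> \<beta>) =
      x * (Const r * cone_term I g \<alpha> \<beta>) + Const (s * r) * cone_term I g (\<lambda>j. \<alpha>' j + \<alpha> j) (\<lambda>j. \<beta>' j + \<beta> j)"
      unfolding Const_simps by (simp add: algebra_simps)
    then show ?case using cone_add_term[OF add(2)] add(1) \<open>0 \<le> r\<close> by simp
  qed (simp add: cone_zero)
  then show ?case using add by (simp add: distrib_left cone_add)
qed (simp add: cone_zero)

lemma cone_Const: "0 \<le> r \<Longrightarrow> Const r \<in> poly_cone I g"
  using cone_add_term[OF cone_zero, where \<alpha> = "\<lambda>_. 0" and \<beta> = "\<lambda>_. 0"] by fastforce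

lemma cone_generators:
  assumes "finite I" "j \<in> I"
  shows "g j \<in> poly_cone I g" "1 - g j \<in> poly_cone I g"
proof -
  have "cone_term I g (\<lambda>i. if i = j then 1 else 0) (\<lambda>_. 0) = (\<Prod>i\<in>I. if i = j then g j else 1)"
    by (intro prod.cong) auto
  then have 1: "g j = 0 + Const 1 * cone_term I g (\<lambda>i. if i = j then 1 else 0) (\<lambda>_. 0)" using assms by (simp add: Const_simps)
  show "g j \<in> poly_cone I g" by (subst 1) (rule cone_add_term[OF cone_zero zero_le_one])
  have "cone_term I g (\<lambda>_. 0) (\<lambda>i. if i = j then 1 else 0) = (\<Prod>i\<in>I. if i = j then 1 - g j else 1)"
    by (intro prod.cong) auto
  then have 2: "1 - g j = 0 + Const 1 * cone_term I g (\<lambda>_. 0) (\<lambda>i. if i = j then 1 else 0)" using assms by (simp add: Const_simps)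
  show "1 - g j \<in> poly_cone I g" by (subst 2) (rule cone_add_term[OF cone_zero zero_le_one])
qed

text \<open>Both g_j and 1 - g_j lie in the cone, so each generator is bounded. Bounded elements
  form a subalgebra, and generation extends boundedness to all of \<open>polys_in V\<close>.\<close>

theorem krivine_handelman:
  fixes g :: "'i \<Rightarrow> 'v mpoly"
  assumes I: "finite I" and g: "\<forall>j\<in>I. g j \<in> polys_in V"
    and gen: "generates_algebra ({0, 1} \<union> g ` I) (polys_in V)"
    and p: "p \<in> polys_in V" and pos: "\<And>a. (\<And>j. j \<in> I \<Longrightarrow> 0 \<le> poly_eval a (g j)) \<Longrightarrow> 0 < poly_eval a p"
  shows "p \<in> poly_cone I g"
proof (rule block_positivstellensatz[where S = "poly_cone I g" and V = V])
  note const = cone_Const[of _ I g]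
  have "is_subalgebra {q. bounded_in (poly_cone I g) q}" unfolding is_subalgebra_def
    by (auto intro!: bounded_in_Const const bounded_in_add cone_add bounded_in_mult_semiring cone_mult)
  moreover have "{0, 1} \<union> g ` I \<subseteq> {q. bounded_in (poly_cone I g) q}"
  proof -
    have "bounded_in (poly_cone I g) (g j)" if "j \<in> I" for j unfolding bounded_in_def
      using cone_generators[OF I that, of g] by (intro conjI exI[of _ 1] exI[of _ 0]) (auto simp: Const_simps)
    then show ?thesis using bounded_in_Const[OF const, of 0] bounded_in_Const[OF const, of 1] by (auto simp: Const_simps)
  qed
  ultimately have "is_subalgebra hull ({0, 1} \<union> g ` I) \<subseteq> {q. bounded_in (poly_cone I g) q}" by (intro hull_minimal)
  then show "bounded_in (poly_cone I g) q" if "q \<in> polys_in V" for q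
    using gen that unfolding generates_algebra_def by blast
  show "module_over (poly_cone I g) (poly_cone I g)" unfolding module_over_def
    using cone_add cone_mult const[of 1] by (auto simp: Const_simps)
  fix a assume a: "\<And>m. m \<in> poly_cone I g \<Longrightarrow> m \<in> polys_in V \<Longrightarrow> 0 \<le> poly_eval a m"
  show "0 < poly_eval a p" using pos a cone_generators(1)[OF I] g by blast
qed (use cone_add cone_mult cone_Const p in auto)

section \<open>Splitting off a function of the common variables\<close>

lemma compact_preimage:
  fixes f :: "'a::metric_space \<Rightarrow> 'b::topological_space"
  assumes "compact A" "continuous_on A f" "closed C"
  shows "compact {a \<in> A. f a \<in> C}"
proof -
  have "{a \<in> A. f a \<in> C} = A \<inter> f -` C" by auto
  then show ?thesis using closedin_compact[OF assms(1) continuous_closedin_preimage[OF assms(2,3)]] by simp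
qed

text \<open>On the compact fibres over \<open>y\<close> the maximum of \<open>u\<close> and the
  minimum of \<open>w\<close> leave room for a constant \<open>c\<close>, also when a fibre is
  empty. The points with u >= c and those with w <= c have compact images that miss
  \<open>y\<close>, so a ball around \<open>y\<close> avoids both.\<close>

lemma local_separating_constant:
  fixes pa :: "'a::metric_space \<Rightarrow> 'y::metric_space" and pb :: "'b::metric_space \<Rightarrow> 'y"
  assumes A: "compact A" and B: "compact B" and pa: "continuous_on A pa" and pb: "continuous_on B pb"
    and u: "continuous_on A u" and w: "continuous_on B w"
    and less: "\<And>a b. a \<in> A \<Longrightarrow> b \<in> B \<Longrightarrow> pa a = pb b \<Longrightarrow> u a < (w b :: real)"
  shows "\<exists>c e. 0 < e \<and> (\<forall>a\<in>A. dist y (pa a) < e \<longrightarrow> u a < c) \<and> (\<forall>b\<in>B. dist y (pb b) < e \<longrightarrow> c < w b)"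
proof -
  define Ay where "Ay = {a \<in> A. pa a = y}"
  define By where "By = {b \<in> B. pb b = y}"
  have cA: "compact {a \<in> A. pa a \<in> {y}}" by (intro compact_preimage A pa closed_singleton)
  have cB: "compact {b \<in> B. pb b \<in> {y}}" by (intro compact_preimage B pb closed_singleton)
  have Ay: "compact Ay" and By: "compact By" using cA cB unfolding Ay_def By_def by simp_all
  have uy: "continuous_on Ay u" and wy: "continuous_on By w"
    using continuous_on_subset[OF u] continuous_on_subset[OF w] unfolding Ay_def By_def by auto
  have lt: "u a < w b" if "a \<in> Ay" "b \<in> By" for a b using less that unfolding Ay_def By_def by auto
  have "\<exists>c. (\<forall>a\<in>Ay. u a < c) \<and> (\<forall>b\<in>By. c < w b)"
  proof (cases "Ay = {}"; cases "By = {}")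
    assume ne: "Ay \<noteq> {}" "By \<noteq> {}"
    obtain a where a: "a \<in> Ay" "\<forall>x\<in>Ay. u x \<le> u a" using continuous_attains_sup[OF Ay ne(1) uy] by blast
    obtain b where b: "b \<in> By" "\<forall>x\<in>By. w b \<le> w x" using continuous_attains_inf[OF By ne(2) wy] by blast
    obtain c where "u a < c" "c < w b" using dense[OF lt[OF a(1) b(1)]] by blast
    then have "\<forall>x\<in>Ay. u x < c" "\<forall>x\<in>By. c < w x" using a(2) b(2) by fastforce+
    then show ?thesis by blast
  next
    assume ne: "Ay \<noteq> {}" "By = {}"
    obtain a where a: "a \<in> Ay" "\<forall>x\<in>Ay. u x \<le> u a" using continuous_attains_sup[OF Ay ne(1) uy] by blast
    then show ?thesis using ne by (intro exI[of _ "u a + 1"]) force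
  next
    assume ne: "Ay = {}" "By \<noteq> {}"
    obtain b where b: "b \<in> By" "\<forall>x\<in>By. w b \<le> w x" using continuous_attains_inf[OF By ne(2) wy] by blast
    then show ?thesis using ne by (intro exI[of _ "w b - 1"]) force
  qed auto
  then obtain c where c: "\<forall>a\<in>Ay. u a < c" "\<forall>b\<in>By. c < w b" by blast
  have "compact {a \<in> A. u a \<in> {c..}}" by (intro compact_preimage A u closed_atLeast)
  then have "compact (pa ` {a \<in> A. u a \<in> {c..}})" by (intro compact_continuous_image continuous_on_subset[OF pa]) auto
  then have "open (- (pa ` {a \<in> A. u a \<in> {c..}}))" using compact_imp_closed by blast
  moreover have "y \<in> - (pa ` {a \<in> A. u a \<in> {c..}})" using c(1) unfolding Ay_def by force
  ultimately obtain e1 where e1: "0 < e1" "ball y e1 \<subseteq> - (pa ` {a \<in> A. u a \<in> {c..}})" using openE by blast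
  have "compact {b \<in> B. w b \<in> {..c}}" by (intro compact_preimage B w closed_atMost)
  then have "compact (pb ` {b \<in> B. w b \<in> {..c}})" by (intro compact_continuous_image continuous_on_subset[OF pb]) auto
  then have "open (- (pb ` {b \<in> B. w b \<in> {..c}}))" using compact_imp_closed by blast
  moreover have "y \<in> - (pb ` {b \<in> B. w b \<in> {..c}})" using c(2) unfolding By_def by force
  ultimately obtain e2 where e2: "0 < e2" "ball y e2 \<subseteq> - (pb ` {b \<in> B. w b \<in> {..c}})" using openE by blast
  have "u a < c" if "a \<in> A" "dist y (pa a) < min e1 e2" for a
  proof (rule ccontr)
    assume "\<not> u a < c"
    then have "pa a \<in> pa ` {a \<in> A. u a \<in> {c..}}" using that by auto
    moreover have "pa a \<in> ball y e1" using that by simp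
    ultimately show False using e1(2) by blast
  qed
  moreover have "c < w b" if "b \<in> B" "dist y (pb b) < min e1 e2" for b
  proof (rule ccontr)
    assume "\<not> c < w b"
    then have "pb b \<in> pb ` {b \<in> B. w b \<in> {..c}}" using that by auto
    moreover have "pb b \<in> ball y e2" using that by simp
    ultimately show False using e2(2) by blast
  qed
  ultimately show ?thesis using e1(1) e2(1) by (intro exI[of _ c] exI[of _ "min e1 e2"]) auto
qed

text \<open>The local constants are averaged with tent functions \<open>h t\<close> supported on the
  chosen balls. A weight that is positive at y belongs to a ball containing y, so its constant obeys
  the strict inequalities over y, and the average inherits them.\<close>

lemma continuous_separation:
  fixes pa :: "'a::metric_space \<Rightarrow> 'y::metric_space" and pb :: "'b::metric_space \<Rightarrow> 'y"
  assumes A: "compact A" and B: "compact B" and pa: "continuous_on A pa" and pb: "continuous_on B pb"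
    and u: "continuous_on A u" and w: "continuous_on B w"
    and less: "\<And>a b. a \<in> A \<Longrightarrow> b \<in> B \<Longrightarrow> pa a = pb b \<Longrightarrow> u a < (w b :: real)"
  obtains \<phi> where "continuous_on (pa ` A \<union> pb ` B) \<phi>" "\<And>a. a \<in> A \<Longrightarrow> u a < \<phi> (pa a)" "\<And>b. b \<in> B \<Longrightarrow> \<phi> (pb b) < w b"
proof -
  let ?Y = "pa ` A \<union> pb ` B"
  have "\<forall>y. \<exists>c e. 0 < e \<and> (\<forall>a\<in>A. dist y (pa a) < e \<longrightarrow> u a < c) \<and> (\<forall>b\<in>B. dist y (pb b) < e \<longrightarrow> c < w b)"
    using local_separating_constant[OF assms] by blast
  then obtain c e where ce: "\<And>y. 0 < e y" "\<And>y a. a \<in> A \<Longrightarrow> dist y (pa a) < e y \<Longrightarrow> u a < c y"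
    "\<And>y b. b \<in> B \<Longrightarrow> dist y (pb b) < e y \<Longrightarrow> c y < w b" by metis
  have cY: "compact ?Y" using A B pa pb by (intro compact_Un compact_continuous_image)
  have cover: "?Y \<subseteq> (\<Union>y\<in>?Y. ball y (e y))"
  proof
    fix y assume y: "y \<in> ?Y"
    have "y \<in> ball y (e y)" using ce(1) by simp
    then show "y \<in> (\<Union>y\<in>?Y. ball y (e y))" using y by blast
  qed
  obtain T where T: "T \<subseteq> ?Y" "finite T" "?Y \<subseteq> (\<Union>y\<in>T. ball y (e y))"
    by (rule compactE_image[OF cY open_ball cover])
  define h where "h = (\<lambda>t y. max 0 (e t - dist t y))"
  define \<phi> where "\<phi> = (\<lambda>y. (\<Sum>t\<in>T. h t y * c t) / (\<Sum>t\<in>T. h t y))"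
  have h0: "0 \<le> h t y" for t y unfolding h_def by simp
  have h_pos: "dist t y < e t" if "0 < h t y" for t y using that unfolding h_def by (simp add: max_def split: if_splits)
  have wit: "\<exists>t\<in>T. 0 < h t y" if y: "y \<in> ?Y" for y
  proof -
    obtain t where "t \<in> T" "y \<in> ball t (e t)" using subsetD[OF T(3) y] by blast
    then show ?thesis unfolding h_def by (intro bexI[of _ t]) auto
  qed
  have H: "0 < (\<Sum>t\<in>T. h t y)" if y: "y \<in> ?Y" for y
  proof -
    obtain t where "t \<in> T" "0 < h t y" using wit[OF y] by blast
    then show ?thesis using T(2) h0 by (intro sum_pos2[of T t]) auto
  qed
  show ?thesis
  proof (rule that[of \<phi>])
    have "continuous_on ?Y (h t)" for t unfolding h_def by (intro continuous_intros)
    then show "continuous_on ?Y \<phi>" unfolding \<phi>_def using H by (intro continuous_intros) fastforce+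
  next
    fix a assume a: "a \<in> A"
    let ?y = "pa a"
    have y: "?y \<in> ?Y" using a by blast
    obtain t where t: "t \<in> T" "0 < h t ?y" using wit[OF y] by blast
    have "0 < (\<Sum>t\<in>T. h t ?y * (c t - u a))"
    proof (rule sum_pos2[OF T(2) t(1)])
      show "0 < h t ?y * (c t - u a)" using t(2) ce(2)[OF a h_pos[OF t(2)]] by simp
      show "0 \<le> h s ?y * (c s - u a)" for s
        using h0[of s ?y] ce(2)[OF a h_pos, of s] by (cases "h s ?y = 0") (auto intro!: mult_nonneg_nonneg simp: order_le_less)
    qed
    also have "(\<Sum>t\<in>T. h t ?y * (c t - u a)) = (\<Sum>t\<in>T. h t ?y * c t) - u a * (\<Sum>t\<in>T. h t ?y)"
      by (simp add: right_diff_distrib sum_subtractf sum_distrib_left mult.commute)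
    finally show "u a < \<phi> ?y" unfolding \<phi>_def using H[OF y] by (simp add: field_simps)
  next
    fix b assume b: "b \<in> B"
    let ?y = "pb b"
    have y: "?y \<in> ?Y" using b by blast
    obtain t where t: "t \<in> T" "0 < h t ?y" using wit[OF y] by blast
    have "0 < (\<Sum>t\<in>T. h t ?y * (w b - c t))"
    proof (rule sum_pos2[OF T(2) t(1)])
      show "0 < h t ?y * (w b - c t)" using t(2) ce(3)[OF b h_pos[OF t(2)]] by simp
      show "0 \<le> h s ?y * (w b - c s)" for s
        using h0[of s ?y] ce(3)[OF b h_pos, of s] by (cases "h s ?y = 0") (auto intro!: mult_nonneg_nonneg simp: order_le_less)
    qed
    also have "(\<Sum>t\<in>T. h t ?y * (w b - c t)) = w b * (\<Sum>t\<in>T. h t ?y) - (\<Sum>t\<in>T. h t ?y * c t)"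
      by (simp add: right_diff_distrib sum_subtractf sum_distrib_left mult.commute)
    finally show "\<phi> ?y < w b" unfolding \<phi>_def using H[OF y] by (simp add: field_simps)
  qed
qed

lemma positive_gap:
  fixes d :: "'a::topological_space \<Rightarrow> real"
  assumes "compact A" "continuous_on A d" "\<And>a. a \<in> A \<Longrightarrow> 0 < d a"
  shows "\<exists>\<delta>>0. \<forall>a\<in>A. \<delta> \<le> d a"
proof (cases "A = {}")
  case False
  then obtain a where "a \<in> A" "\<forall>x\<in>A. d a \<le> d x" using continuous_attains_inf[OF assms(1) _ assms(2)] by blast
  then show ?thesis using assms(3) by blast
qed (auto intro: exI[of _ 1])

text \<open>By compactness the continuous function keeps a positive distance from both
  \<open>u\<close> and \<open>w\<close>, and an approximation within the smaller distance still
  separates them.\<close>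

lemma polynomial_separation:
  fixes pa :: "'a::metric_space \<Rightarrow> 'y::euclidean_space" and pb :: "'b::metric_space \<Rightarrow> 'y"
  assumes A: "compact A" and B: "compact B" and pa: "continuous_on A pa" and pb: "continuous_on B pb"
    and u: "continuous_on A u" and w: "continuous_on B w"
    and less: "\<And>a b. a \<in> A \<Longrightarrow> b \<in> B \<Longrightarrow> pa a = pb b \<Longrightarrow> u a < (w b :: real)"
  shows "\<exists>r. real_polynomial_function r \<and> (\<forall>a\<in>A. u a < r (pa a)) \<and> (\<forall>b\<in>B. r (pb b) < w b)"
proof -
  obtain \<phi> where \<phi>: "continuous_on (pa ` A \<union> pb ` B) \<phi>" "\<And>a. a \<in> A \<Longrightarrow> u a < \<phi> (pa a)" "\<And>b. b \<in> B \<Longrightarrow> \<phi> (pb b) < w b"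
    using continuous_separation[OF assms] by blast
  have "continuous_on A (\<lambda>a. \<phi> (pa a) - u a)"
    by (intro continuous_intros u continuous_on_compose2[OF \<phi>(1) pa]) auto
  then have "\<exists>\<delta>>0. \<forall>a\<in>A. \<delta> \<le> \<phi> (pa a) - u a" by (rule positive_gap[OF A]) (simp add: \<phi>(2))
  then obtain \<delta>1 where 1: "0 < \<delta>1" "\<And>a. a \<in> A \<Longrightarrow> \<delta>1 \<le> \<phi> (pa a) - u a" by blast
  have "continuous_on B (\<lambda>b. w b - \<phi> (pb b))"
    by (intro continuous_intros w continuous_on_compose2[OF \<phi>(1) pb]) auto
  then have "\<exists>\<delta>>0. \<forall>b\<in>B. \<delta> \<le> w b - \<phi> (pb b)" by (rule positive_gap[OF B]) (simp add: \<phi>(3))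
  then obtain \<delta>2 where 2: "0 < \<delta>2" "\<And>b. b \<in> B \<Longrightarrow> \<delta>2 \<le> w b - \<phi> (pb b)" by blast
  have "compact (pa ` A \<union> pb ` B)" using A B pa pb by (intro compact_Un compact_continuous_image)
  then obtain r where r: "real_polynomial_function r" "\<And>y. y \<in> pa ` A \<union> pb ` B \<Longrightarrow> \<bar>\<phi> y - r y\<bar> < min \<delta>1 \<delta>2"
    using Stone_Weierstrass_real_polynomial_function[OF _ \<phi>(1), of "min \<delta>1 \<delta>2"] 1(1) 2(1) by auto
  have "u a < r (pa a)" if "a \<in> A" for a using 1(2)[OF that] r(2)[of "pa a"] that by fastforce
  moreover have "r (pb b) < w b" if "b \<in> B" for b using 2(2)[OF that] r(2)[of "pb b"] that by fastforce
  ultimately show ?thesis using r(1) by blast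
qed

section \<open>The sparse Positivstellensatz\<close>

lemma polynomial_function_imp_mpoly:
  fixes r :: "real ^ 'y::finite \<Rightarrow> real"
  assumes "real_polynomial_function r"
  shows "\<exists>q :: ('x::finite, 'y, 'z::finite) xyz_var mpoly. q \<in> polys_in (range VY) \<and> (\<forall>x y z. eval_xyz q x y z = r y)"
  using assms
proof (induction rule: real_polynomial_function.induct)
  case (linear l)
  interpret bounded_linear l by fact
  have l: "l y = (\<Sum>i\<in>UNIV. l (axis i 1) * y $ i)" for y
  proof -
    have "l y = l (\<Sum>i\<in>UNIV. (y $ i) *\<^sub>R axis i 1)" using basis_expansion[of y] by (simp add: scalar_mult_eq_scaleR)
    then show ?thesis by (simp add: sum scaleR mult.commute)
  qed
  show ?case
    by (intro exI[of _ "\<Sum>i\<in>UNIV. Const (l (axis i 1)) * Var (VY i)"] conjI allI polys_in_sum polys_in_mult polys_in_Const polys_in_Var)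
      (auto simp: eval_xyz_def poly_eval_simps l[symmetric])
next
  case (const c)
  show ?case by (intro exI[of _ "Const c"]) (simp add: eval_xyz_def polys_in_Const)
next
  case (add r s)
  then obtain p q where "p \<in> polys_in (range VY)" "\<forall>x y z. eval_xyz (p :: ('x, 'y, 'z) xyz_var mpoly) x y z = r y"
    "q \<in> polys_in (range VY)" "\<forall>x y z. eval_xyz (q :: ('x, 'y, 'z) xyz_var mpoly) x y z = s y" by blast
  then show ?case by (intro exI[of _ "p + q"]) (simp add: eval_xyz_def poly_eval_simps polys_in_add)
next
  case (mult r s)
  then obtain p q where "p \<in> polys_in (range VY)" "\<forall>x y z. eval_xyz (p :: ('x, 'y, 'z) xyz_var mpoly) x y z = r y"
    "q \<in> polys_in (range VY)" "\<forall>x y z. eval_xyz (q :: ('x, 'y, 'z) xyz_var mpoly) x y z = s y" by blast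
  then show ?case by (intro exI[of _ "p * q"]) (simp add: eval_xyz_def poly_eval_simps polys_in_mult)
qed

lemma continuous_on_eval_xyz:
  assumes "continuous_on S X1" "continuous_on S Y1" "continuous_on S Z1"
  shows "continuous_on S (\<lambda>s. eval_xyz p (X1 s) (Y1 s) (Z1 s))"
proof -
  have "continuous_on S (\<lambda>s. assignment (X1 s) (Y1 s) (Z1 s) v)" for v
    by (cases v) (auto intro!: continuous_intros assms)
  then show ?thesis unfolding eval_xyz_def poly_eval_def by (intro continuous_intros)
qed

lemma sum_squares_norm:
  fixes x :: "real ^ 'n::finite"
  shows "(\<Sum>i\<in>UNIV. (x $ i)\<^sup>2) = (norm x)\<^sup>2"
  by (simp add: norm_vec_def L2_set_def sum_nonneg)

lemma compact_pair_norm_bound: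
  fixes K :: "((real ^ 'm::finite) \<times> (real ^ 'n::finite)) set"
  assumes "compact K"
  obtains B where "\<And>x y. (x, y) \<in> K \<Longrightarrow> (\<Sum>i\<in>UNIV. (x $ i)\<^sup>2) + (\<Sum>i\<in>UNIV. (y $ i)\<^sup>2) < B"
proof -
  obtain b where b: "\<And>k. k \<in> K \<Longrightarrow> norm k \<le> b" using compact_imp_bounded[OF assms] unfolding bounded_iff by blast
  have "(\<Sum>i\<in>UNIV. (x $ i)\<^sup>2) + (\<Sum>i\<in>UNIV. (y $ i)\<^sup>2) < b\<^sup>2 + 1" if "(x, y) \<in> K"
    for x :: "real ^ 'm" and y :: "real ^ 'n"
  proof -
    have "(norm (x, y))\<^sup>2 \<le> b\<^sup>2" using b[OF that] by (intro power_mono) auto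
    then show ?thesis unfolding sum_squares_norm by (simp add: norm_Pair)
  qed
  then show ?thesis by (rule that)
qed

section \<open>The one-block theorems for (X, Y) and for (Y, Z)\<close>

abbreviation vars_xy :: "('x, 'y, 'z) xyz_var set" where
  "vars_xy \<equiv> range VX \<union> range VY"

lemma sum_vars_xy:
  "(\<Sum>v\<in>vars_xy. F v) = (\<Sum>i\<in>UNIV. F (VX (i::'x::finite))) + (\<Sum>i\<in>UNIV. F (VY (i::'y::finite)))"
proof -
  have "(\<Sum>v\<in>vars_xy. F v) = (\<Sum>v\<in>range VX. F v) + (\<Sum>v\<in>range VY. F v)" by (intro sum.union_disjoint) auto
  then show ?thesis by (simp add: sum.reindex inj_on_def)
qed

lemma poly_eval_xy:
  fixes p :: "('x::finite, 'y::finite, 'z::finite) xyz_var mpoly"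
  assumes "p \<in> ring_xy"
  shows "poly_eval a p = eval_xy p (\<chi> i. a (VX i)) (\<chi> i. a (VY i))"
  using assms unfolding ring_xy_def eval_xy_def eval_xyz_def by (intro poly_eval_cong) auto

text \<open>The one-block theorems quantify over assignments of all variables, whereas
  \<open>K_xy\<close> consists of pairs; for members of \<open>ring_xy\<close> the values at Z do
  not matter. All three certificates are for the same \<open>p\<close>, so they can be combined
  freely with those of the other block.\<close>

lemma xy_block:
  fixes g :: "'i \<Rightarrow> ('x::finite, 'y::finite, 'z::finite) xyz_var mpoly"
  assumes I: "finite I" and g: "\<forall>j\<in>I. g j \<in> ring_xy" and K: "compact (K_xy I g)"
    and p: "p \<in> ring_xy" and pos: "\<forall>(x, y)\<in>K_xy I g. 0 < eval_xy p x y"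
  shows "p \<in> poly_preordering ring_xy I g"
    and "\<exists>N. Const N - norm_sq_xy \<in> poly_quadratic_module ring_xy I g \<Longrightarrow> p \<in> poly_quadratic_module ring_xy I g"
    and "generates_algebra ({0, 1} \<union> g ` I) ring_xy \<Longrightarrow> p \<in> poly_cone I g"
proof -
  have inK: "((\<chi> i. a (VX i)), (\<chi> i. a (VY i))) \<in> K_xy I g" if "\<And>j. j \<in> I \<Longrightarrow> 0 \<le> poly_eval a (g j)" for a
    using that g unfolding K_xy_def by (simp add: poly_eval_xy[symmetric])
  have pos': "0 < poly_eval a p" if "\<And>j. j \<in> I \<Longrightarrow> 0 \<le> poly_eval a (g j)" for a
    using inK[OF that] pos poly_eval_xy[OF p, of a] by auto
  have fin: "finite (vars_xy :: ('x, 'y, 'z) xyz_var set)" by simp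
  note r = ring_xy_def[symmetric]
  obtain B where B: "\<And>x y. (x, y) \<in> K_xy I g \<Longrightarrow> (\<Sum>i\<in>UNIV. (x $ i)\<^sup>2) + (\<Sum>i\<in>UNIV. (y $ i)\<^sup>2) < B"
    using compact_pair_norm_bound[OF K] by blast
  have bound: "(\<Sum>v\<in>vars_xy. (a v)\<^sup>2) < B" if "\<And>j. j \<in> I \<Longrightarrow> 0 \<le> poly_eval a (g j)" for a
    using B[OF inK[OF that]] by (simp add: sum_vars_xy)
  show "p \<in> poly_preordering ring_xy I g"
    using schmuedgen[OF I fin _ bound _ pos', unfolded r] g p by blast
  have norm: "norm_sq_xy = (\<Sum>v\<in>vars_xy. (Var v)\<^sup>2 :: ('x, 'y, 'z) xyz_var mpoly)"
    unfolding norm_sq_xy_def sum_vars_xy ..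
  show "p \<in> poly_quadratic_module ring_xy I g" if "\<exists>N. Const N - norm_sq_xy \<in> poly_quadratic_module ring_xy I g"
    using that putinar[OF I fin _ _ _ pos', unfolded r] g p unfolding norm by blast
  show "p \<in> poly_cone I g" if "generates_algebra ({0, 1} \<union> g ` I) ring_xy"
    using that krivine_handelman[where V = vars_xy, OF I _ _ _ pos', unfolded r] g p by blast
qed

abbreviation vars_yz :: "('x, 'y, 'z) xyz_var set" where
  "vars_yz \<equiv> range VY \<union> range VZ"

lemma sum_vars_yz:
  "(\<Sum>v\<in>vars_yz. F v) = (\<Sum>i\<in>UNIV. F (VY (i::'y::finite))) + (\<Sum>i\<in>UNIV. F (VZ (i::'z::finite)))"
proof -
  have "(\<Sum>v\<in>vars_yz. F v) = (\<Sum>v\<in>range VY. F v) + (\<Sum>v\<in>range VZ. F v)" by (intro sum.union_disjoint) auto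
  then show ?thesis by (simp add: sum.reindex inj_on_def)
qed

lemma poly_eval_yz:
  fixes p :: "('x::finite, 'y::finite, 'z::finite) xyz_var mpoly"
  assumes "p \<in> ring_yz"
  shows "poly_eval a p = eval_yz p (\<chi> i. a (VY i)) (\<chi> i. a (VZ i))"
  using assms unfolding ring_yz_def eval_yz_def eval_xyz_def by (intro poly_eval_cong) auto

lemma yz_block:
  fixes g :: "'i \<Rightarrow> ('x::finite, 'y::finite, 'z::finite) xyz_var mpoly"
  assumes I: "finite I" and g: "\<forall>j\<in>I. g j \<in> ring_yz" and K: "compact (K_yz I g)"
    and p: "p \<in> ring_yz" and pos: "\<forall>(y, z)\<in>K_yz I g. 0 < eval_yz p y z"
  shows "p \<in> poly_preordering ring_yz I g"
    and "\<exists>N. Const N - norm_sq_yz \<in> poly_quadratic_module ring_yz I g \<Longrightarrow> p \<in> poly_quadratic_module ring_yz I g"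
    and "generates_algebra ({0, 1} \<union> g ` I) ring_yz \<Longrightarrow> p \<in> poly_cone I g"
proof -
  have inK: "((\<chi> i. a (VY i)), (\<chi> i. a (VZ i))) \<in> K_yz I g" if "\<And>j. j \<in> I \<Longrightarrow> 0 \<le> poly_eval a (g j)" for a
    using that g unfolding K_yz_def by (simp add: poly_eval_yz[symmetric])
  have pos': "0 < poly_eval a p" if "\<And>j. j \<in> I \<Longrightarrow> 0 \<le> poly_eval a (g j)" for a
    using inK[OF that] pos poly_eval_yz[OF p, of a] by auto
  have fin: "finite (vars_yz :: ('x, 'y, 'z) xyz_var set)" by simp
  note r = ring_yz_def[symmetric]
  obtain B where B: "\<And>x y. (x, y) \<in> K_yz I g \<Longrightarrow> (\<Sum>i\<in>UNIV. (x $ i)\<^sup>2) + (\<Sum>i\<in>UNIV. (y $ i)\<^sup>2) < B"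
    using compact_pair_norm_bound[OF K] by blast
  have bound: "(\<Sum>v\<in>vars_yz. (a v)\<^sup>2) < B" if "\<And>j. j \<in> I \<Longrightarrow> 0 \<le> poly_eval a (g j)" for a
    using B[OF inK[OF that]] by (simp add: sum_vars_yz)
  show "p \<in> poly_preordering ring_yz I g"
    using schmuedgen[OF I fin _ bound _ pos', unfolded r] g p by blast
  have norm: "norm_sq_yz = (\<Sum>v\<in>vars_yz. (Var v)\<^sup>2 :: ('x, 'y, 'z) xyz_var mpoly)"
    unfolding norm_sq_yz_def sum_vars_yz ..
  show "p \<in> poly_quadratic_module ring_yz I g" if "\<exists>N. Const N - norm_sq_yz \<in> poly_quadratic_module ring_yz I g"
    using that putinar[OF I fin _ _ _ pos', unfolded r] g p unfolding norm by blast
  show "p \<in> poly_cone I g" if "generates_algebra ({0, 1} \<union> g ` I) ring_yz"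
    using that krivine_handelman[where V = vars_yz, OF I _ _ _ pos', unfolded r] g p by blast
qed

text \<open>The separation is applied to -p and q over the projections of the two sets to y; a pair
  of points with equal projections is exactly a point of \<open>K_xyz\<close>. The separating
  polynomial involves only Y and therefore lies in both rings.\<close>

lemma split_positive:
  fixes g :: "'i \<Rightarrow> ('x::finite, 'y::finite, 'z::finite) xyz_var mpoly"
  assumes g: "\<forall>j\<in>I. g j \<in> ring_xy" and h: "\<forall>k\<in>L. h k \<in> ring_yz"
    and Kxy: "compact (K_xy I g)" and Kyz: "compact (K_yz L h)"
    and f: "f \<in> ring_xy + ring_yz" and pos: "\<forall>(x, y, z)\<in>K_xyz I g L h. 0 < eval_xyz f x y z"
  obtains p q where "f = p + q" "p \<in> ring_xy" "q \<in> ring_yz" "\<forall>(x, y)\<in>K_xy I g. 0 < eval_xy p x y"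
    "\<forall>(y, z)\<in>K_yz L h. 0 < eval_yz q y z"
proof -
  obtain p q where pq: "f = p + q" "p \<in> ring_xy" "q \<in> ring_yz" using f by (rule set_plus_elim)
  have "continuous_on (K_xy I g) (\<lambda>k. - eval_xy p (fst k) (snd k))"
    unfolding eval_xy_def by (intro continuous_intros continuous_on_eval_xyz)
  moreover have "continuous_on (K_yz L h) (\<lambda>k. eval_yz q (fst k) (snd k))"
    unfolding eval_yz_def by (intro continuous_intros continuous_on_eval_xyz)
  moreover have "- eval_xy p (fst a) (snd a) < eval_yz q (fst b) (snd b)"
    if ab: "a \<in> K_xy I g" "b \<in> K_yz L h" "snd a = fst b" for a b
  proof -
    have "(fst a, snd a, snd b) \<in> K_xyz I g L h" unfolding K_xyz_def using ab by (cases a; cases b) auto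
    then have "0 < eval_xyz f (fst a) (snd a) (snd b)" using pos by blast
    also have "eval_xyz f (fst a) (snd a) (snd b) = eval_xyz p (fst a) (snd a) (snd b) + eval_xyz q (fst a) (snd a) (snd b)"
      unfolding pq(1) eval_xyz_def by (rule poly_eval_add)
    also have "\<dots> = eval_xy p (fst a) (snd a) + eval_yz q (fst b) (snd b)"
      unfolding ab(3)[symmetric] using eval_xy_eq[OF pq(2)] eval_yz_eq[OF pq(3)] by metis
    finally show ?thesis by simp
  qed
  ultimately have "\<exists>r. real_polynomial_function r \<and> (\<forall>a\<in>K_xy I g. - eval_xy p (fst a) (snd a) < r (snd a)) \<and>
      (\<forall>b\<in>K_yz L h. r (fst b) < eval_yz q (fst b) (snd b))"
    by (rule polynomial_separation[OF Kxy Kyz continuous_on_snd[OF continuous_on_id] continuous_on_fst[OF continuous_on_id]])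
  then obtain r where r: "real_polynomial_function r" "\<And>a. a \<in> K_xy I g \<Longrightarrow> - eval_xy p (fst a) (snd a) < r (snd a)"
    "\<And>b. b \<in> K_yz L h \<Longrightarrow> r (fst b) < eval_yz q (fst b) (snd b)"
    by blast
  obtain s :: "('x, 'y, 'z) xyz_var mpoly" where s: "s \<in> polys_in (range VY)" "\<forall>x y z. eval_xyz s x y z = r y"
    using polynomial_function_imp_mpoly[OF r(1)] by blast
  have sr: "s \<in> ring_xy" "s \<in> ring_yz" using s(1) unfolding ring_xy_def ring_yz_def polys_in_def by blast+
  show ?thesis
  proof (rule that[of "p + s" "q - s"])
    show "f = p + s + (q - s)" using pq(1) by simp
    show "p + s \<in> ring_xy" using pq(2) sr(1) unfolding ring_xy_def by (rule polys_in_add)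
    show "q - s \<in> ring_yz" using pq(3) sr(2) unfolding ring_yz_def by (rule polys_in_diff)
    show "\<forall>(x, y)\<in>K_xy I g. 0 < eval_xy (p + s) x y"
      using r(2) s(2) unfolding eval_xy_def eval_xyz_def by (fastforce simp: poly_eval_simps)
    show "\<forall>(y, z)\<in>K_yz L h. 0 < eval_yz (q - s) y z"
      using r(3) s(2) unfolding eval_yz_def eval_xyz_def by (fastforce simp: poly_eval_simps)
  qed
qed

theorem theorem2p1:
  fixes I :: "'i set" and L :: "'k set"
    and g :: "'i \<Rightarrow> ('x::finite, 'y::finite, 'z::finite) xyz_var mpoly"
    and h :: "'k \<Rightarrow> ('x, 'y, 'z) xyz_var mpoly"
    and f :: "('x, 'y, 'z) xyz_var mpoly"
  assumes "finite I" and "finite L"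
    and "\<forall>j\<in>I. g j \<in> ring_xy" and "\<forall>k\<in>L. h k \<in> ring_yz"
    and "compact (K_xy I g)" and "compact (K_yz L h)" and "compact (K_xyz I g L h)"
    and "interior (K_xyz I g L h) \<noteq> {}"
    and "f \<in> ring_xy + ring_yz"
  shows
    "((\<forall>(x, y, z)\<in>K_xyz I g L h. 0 < eval_xyz f x y z) \<longrightarrow>
        f \<in> poly_preordering ring_xy I g + poly_preordering ring_yz L h)
     \<and>
     ((\<forall>(x, y, z)\<in>K_xyz I g L h. 0 < eval_xyz f x y z) \<longrightarrow>
        ((\<exists>N. Const N - norm_sq_xy \<in> poly_quadratic_module ring_xy I g) \<longrightarrow>
           f \<in> poly_quadratic_module ring_xy I g + poly_preordering ring_yz L h) \<and>
        ((\<exists>N. Const N - norm_sq_yz \<in> poly_quadratic_module ring_yz L h) \<longrightarrow>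
           f \<in> poly_preordering ring_xy I g + poly_quadratic_module ring_yz L h) \<and>
        ((\<exists>N. Const N - norm_sq_xy \<in> poly_quadratic_module ring_xy I g) \<and>
         (\<exists>N. Const N - norm_sq_yz \<in> poly_quadratic_module ring_yz L h) \<longrightarrow>
           f \<in> poly_quadratic_module ring_xy I g + poly_quadratic_module ring_yz L h))
     \<and>
     ((\<forall>j\<in>I. \<forall>(x, y)\<in>K_xy I g. 0 \<le> eval_xy (g j) x y \<and> eval_xy (g j) x y \<le> 1) \<longrightarrow>
      (\<forall>k\<in>L. \<forall>(y, z)\<in>K_yz L h. 0 \<le> eval_yz (h k) y z \<and> eval_yz (h k) y z \<le> 1) \<longrightarrow>
      generates_algebra ({0, 1} \<union> g ` I) ring_xy \<longrightarrow>
      generates_algebra ({0, 1} \<union> h ` L) ring_yz \<longrightarrow>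
      (\<forall>(x, y, z)\<in>K_xyz I g L h. 0 < eval_xyz f x y z) \<longrightarrow>
        f \<in> poly_cone I g + poly_cone L h)"
proof (cases "\<forall>(x, y, z)\<in>K_xyz I g L h. 0 < eval_xyz f x y z")
  case True
  obtain p q where pq: "f = p + q" "p \<in> ring_xy" "q \<in> ring_yz" "\<forall>(x, y)\<in>K_xy I g. 0 < eval_xy p x y"
    "\<forall>(y, z)\<in>K_yz L h. 0 < eval_yz q y z"
    using split_positive[OF assms(3-6) assms(9) True] by blast
  \<comment> \<open>The splitting does not depend on the kind of certificate, so this one pair
    serves every combination in (a), (b) and (c).\<close>
  note xy = xy_block[OF assms(1,3,5) pq(2,4)] and yz = yz_block[OF assms(2,4,6) pq(3,5)]
  show ?thesis unfolding pq(1) using xy yz by (blast intro: set_plus_intro)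
qed blast

end
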